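(* The invariant $\mathbf{F}^3_{(1,1,1)}$ distinguishes the two links in each of the following six pairs of oriented three-component links (named according to LinkInfo): $$\begin{array}{ll} L11n325\{1,1\}, & L11n424\{0,0\};\\ L11n356\{1,0\}, & L11n434\{0,0\};\\ L10n79\{1,1\}, & L10n95\{1,0\};\\ L11a404\{1,1\}, & L11a428\{0,1\};\\ L10n76\{1,1\}, & L11n425\{1,0\};\\ L11n358\{1,1\}, & L11n418\{1,0\}. \end{array}$$ That is, for each of these pairs $(L,L')$ one has $\mathbf{F}^3_{(1,1,1)}(L)\neq \mathbf{F}^3_{(1,1,1)}(L')$.
   Context: Links are oriented links in $S^3$. Link names are those of the LinkInfo database (J. C. Cha and C. Livingston, LinkInfo: Table of Link Invariants): the name $L11n325$ etc. is the table name of the link, and the string in braces specifies the orientation of its components in the convention of that database. A coloration of a link is a function from its set of components to a finite set of colors; two colorations are equivalent if they induce the same partition of the set of components (components being equivalent when they have the same color). Two oriented colored links are c-isotopic if they are ambient isotopic and their colorations are equivalent. An invariant of colored links is a function on colored oriented link diagrams that is constant on each class of c-isotopic links. The invariant $F$ (known to exist and to be unique) is the invariant of oriented colored links with values in $\mathbb{Q}(x,t,w)$ determined by: (I) $F=1$ on the unknotted circle. (II) If $L$ is a colored link with $c$ colors and $[L;O]$ is the colored link consisting of $L$ and an unknotted, unlinked circle colored with a new, $(c+1)$-th color, then $F([L;O])=\frac{1}{wx}F(L)$. (III) (skein relation) $\frac1w F(L_+)-wF(L_-)=(1-t^{-1})F(L_\sim)+\frac1w(1-t^{-1})F(L_{+,\sim})$.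 Here $L_+$ and $L_-$ are colored link diagrams that are identical outside a small disc and have inside it, respectively, a positive and a negative crossing of two strands (of any two colors, not necessarily distinct). $L_\sim$ and $L_{+,\sim}$ coincide with $L_+$, $L_-$ outside the disc except possibly for colors; inside the disc $L_\sim$ has the oriented smoothing of the crossing and $L_{+,\sim}$ has the positive crossing. In both $L_\sim$ and $L_{+,\sim}$, all components having either of the two colors of the strands entering the disc are recolored with one single color (the two colors are merged). Let $L$ be an (uncolored) oriented link with $n$ components. A set partition of the set of components into $c$ non-empty blocks has type $p=(n_1,\dots,n_c)$, with $n_1\ge\dots\ge n_c$ and $n_1+\dots+n_c=n$, if the cardinalities of its blocks are $n_1,\dots,n_c$. To each set partition corresponds the colored link obtained by coloring $L$ with $c$ colors so that two components have the same color if and only if they are in the same block. Then $\mathbf{F}^c_p(L)$ is the unordered set of the values of $F$ on the colored links obtained from $L$ by the non-equivalent colorations corresponding to the set partitions of type $p$. In particular, for a three-component link $L$, $\mathbf{F}^3_{(1,1,1)}(L)=\{F^3(L)\}$, where $F^3(L)$ is the value of $F$ on $L$ with its three components colored with three different colors. The invariant $\mathbf{F}^c_p$ distinguishes two links if it takes different values on them. *)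

theory Defs
  imports
    "HOL-Computational_Algebra.Polynomial"
    "HOL-Computational_Algebra.Fraction_Field"
    "HOL-Library.Disjoint_Sets"
    "HOL-Library.Multiset"
begin

text \<open>
  A crossing is written as in planar diagram (PD) notation: the four edges around it are listed
  counterclockwise, starting with the incoming edge of the under-strand. Under-strand: from first to
  third edge. Over-strand: from fourth to second edge at a positive crossing \<open>Xp\<close>, from second to
  fourth edge at a negative crossing \<open>Xm\<close>.
\<close>

datatype 'e crossing = Xp 'e 'e 'e 'e | Xm 'e 'e 'e 'e

fun positive :: "'e crossing \<Rightarrow> bool" where
  "positive (Xp i j k l) = True"
| "positive (Xm i j k l) = False"

fun under_in :: "'e crossing \<Rightarrow> 'e" where
  "under_in (Xp i j k l) = i"
| "under_in (Xm i j k l) = i"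

fun under_out :: "'e crossing \<Rightarrow> 'e" where
  "under_out (Xp i j k l) = k"
| "under_out (Xm i j k l) = k"

fun over_in :: "'e crossing \<Rightarrow> 'e" where
  "over_in (Xp i j k l) = l"
| "over_in (Xm i j k l) = j"

fun over_out :: "'e crossing \<Rightarrow> 'e" where
  "over_out (Xp i j k l) = j"
| "over_out (Xm i j k l) = l"

text \<open>
  Besides its crossings a diagram has a set of circles, the edges that close up without meeting any
  crossing. For a diagram that is not connected, the mutual position of the pieces is not recorded:
  all choices give ambient isotopic (split) links.
\<close>

datatype diagram = Diagram (crossings: "nat crossing set") (circles: "nat set")

definition edges :: "diagram \<Rightarrow> nat set" where
  "edges D = \<Union>(set_crossing ` crossings D) \<union> circles D"

definition well_formed :: "diagram \<Rightarrow> bool" where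
  "well_formed D \<longleftrightarrow>
     (let C = crossings D;
          entry = (\<lambda>(c, over). if over then over_in c else under_in c);
          exit = (\<lambda>(c, over). if over then over_out c else under_out c)
      in finite C \<and> finite (circles D) \<and>
         inj_on entry (C \<times> (UNIV :: bool set)) \<and> inj_on exit (C \<times> (UNIV :: bool set)) \<and>
         entry ` (C \<times> UNIV) = exit ` (C \<times> UNIV) \<and>
         \<Union>(set_crossing ` C) \<inter> circles D = {})"

text \<open>
  The pair \<open>(e, True)\<close> stands for the edge \<open>e\<close> traversed along its orientation, \<open>(e, False)\<close> for \<open>e\<close>
  traversed against it. Turning left at every crossing traces the boundaries of the faces.
  A cellular surface is obtained from each connected piece by filling in the faces; as there are
  twice as many edges as crossings, all these surfaces are spheres iff
  \<open>faces = crossings + 2 * pieces\<close> (Euler).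
\<close>

fun left_turns :: "nat crossing \<Rightarrow> ((nat \<times> bool) \<times> (nat \<times> bool)) set" where
  "left_turns (Xp i j k l) =
     {((i, True), (l, False)), ((j, False), (i, False)), ((k, False), (j, True)), ((l, True), (k, True))}"
| "left_turns (Xm i j k l) =
     {((i, True), (l, True)), ((j, True), (i, False)), ((k, False), (j, False)), ((l, False), (k, True))}"

definition faces :: "nat crossing set \<Rightarrow> (nat \<times> bool) set set" where
  "faces C = {(\<Union>(left_turns ` C))\<^sup>* `` {d} | d. fst d \<in> \<Union>(set_crossing ` C)}"

definition pieces :: "nat crossing set \<Rightarrow> nat set set" where
  "pieces C = {(\<Union>c\<in>C. set_crossing c \<times> set_crossing c)\<^sup>* `` {e} | e. e \<in> \<Union>(set_crossing ` C)}"

definition planar :: "diagram \<Rightarrow> bool" where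
  "planar D \<longleftrightarrow>
     card (faces (crossings D)) = card (crossings D) + 2 * card (pieces (crossings D))"

definition link_diagram :: "diagram \<Rightarrow> bool" where
  "link_diagram D \<longleftrightarrow> well_formed D \<and> planar D \<and> edges D \<noteq> {}"

text \<open>A component of the link is represented by the set of its edges.\<close>

definition components :: "diagram \<Rightarrow> nat set set" where
  "components D =
     {(\<Union>c\<in>crossings D. {(under_in c, under_out c), (over_in c, over_out c)})\<^sup>* `` {e} | e. e \<in> edges D}"

text \<open>A coloration is a function on edges that is constant on each component.\<close>

type_synonym colored_diagram = "diagram \<times> (nat \<Rightarrow> nat)"

definition coloration :: "diagram \<Rightarrow> (nat \<Rightarrow> nat) \<Rightarrow> bool" where
  "coloration D \<kappa> \<longleftrightarrow> (\<forall>K\<in>components D. \<forall>e\<in>K. \<forall>e'\<in>K. \<kappa> e = \<kappa> e')"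

definition colored_link_diagram :: "colored_diagram \<Rightarrow> bool" where
  "colored_link_diagram X \<longleftrightarrow> link_diagram (fst X) \<and> coloration (fst X) (snd X)"

definition equivalent_colorations :: "diagram \<Rightarrow> (nat \<Rightarrow> nat) \<Rightarrow> (nat \<Rightarrow> nat) \<Rightarrow> bool" where
  "equivalent_colorations D \<kappa> \<kappa>' \<longleftrightarrow>
     (\<forall>e\<in>edges D. \<forall>e'\<in>edges D. \<kappa> e = \<kappa> e' \<longleftrightarrow> \<kappa>' e = \<kappa>' e')"

definition relabel :: "(nat \<Rightarrow> nat) \<Rightarrow> diagram \<Rightarrow> diagram" where
  "relabel f D = Diagram (map_crossing f ` crossings D) (f ` circles D)"

text \<open>
  After crossings have been removed, \<open>join p q\<close> connects the end of the edge \<open>p\<close> to the beginning of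
  the edge \<open>q\<close>; the resulting edge is called \<open>p\<close>. In \<open>splice\<close>, which does this for two pairs of
  edges, the second pair has to be updated, since \<open>q\<close> may occur in it.
\<close>

definition join :: "nat \<Rightarrow> nat \<Rightarrow> diagram \<Rightarrow> diagram" where
  "join p q D =
     (if p = q then Diagram (crossings D) (insert p (circles D)) else relabel (id(q := p)) D)"

definition splice :: "nat \<Rightarrow> nat \<Rightarrow> nat \<Rightarrow> nat \<Rightarrow> diagram \<Rightarrow> diagram" where
  "splice p q p' q' D = join ((id(q := p)) p') ((id(q := p)) q') (join p q D)"

text \<open>
  The third Reidemeister move. The strand \<open>t0, t1, t2\<close> passes over the strands \<open>m0, m1, m2\<close> and
  \<open>b0, b1, b2\<close>, and the second of these passes over the third. \<open>tm\<close>, \<open>tb\<close>, \<open>mb\<close> tell which of the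
  three crossings are positive. For given signs there are exactly two configurations of three
  oriented lines in general position; they are exchanged by the move, which reverses the order of
  the two crossings on each strand. Drawing the lines shows that in one of them (\<open>\<epsilon> = True\<close>) \<open>t\<close> meets
  \<open>m\<close> before \<open>b\<close> iff \<open>mb\<close>, \<open>m\<close> meets \<open>t\<close> before \<open>b\<close> iff \<open>tb\<close>, and \<open>b\<close> meets \<open>t\<close> before \<open>m\<close> iff \<open>tm\<close>.
\<close>

definition crossing_of :: "bool \<Rightarrow> nat \<times> nat \<Rightarrow> nat \<times> nat \<Rightarrow> nat crossing" where
  "crossing_of s u ov =
     (if s then Xp (fst u) (snd ov) (snd u) (fst ov) else Xm (fst u) (fst ov) (snd u) (snd ov))"

definition triangle ::
  "bool \<Rightarrow> bool \<Rightarrow> bool \<Rightarrow> bool \<Rightarrow> nat \<times> nat \<times> nat \<Rightarrow> nat \<times> nat \<times> nat \<Rightarrow> nat \<times> nat \<times> nat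
    \<Rightarrow> nat crossing set"
where
  "triangle tm tb mb \<epsilon> t m b =
     (let pass = (\<lambda>first (a0 :: nat, a1 :: nat, a2 :: nat). if first then (a0, a1) else (a1, a2))
      in {crossing_of tm (pass (\<epsilon> = tb) m) (pass (\<epsilon> = mb) t),
          crossing_of tb (pass (\<epsilon> = tm) b) (pass (\<epsilon> \<noteq> mb) t),
          crossing_of mb (pass (\<epsilon> \<noteq> tm) b) (pass (\<epsilon> \<noteq> tb) m)})"

inductive reidemeister :: "diagram \<Rightarrow> diagram \<Rightarrow> bool" where
  R1_under_first:
    "c \<notin> C \<Longrightarrow> under_out c = over_in c \<Longrightarrow>
     reidemeister (Diagram (insert c C) U) (join (under_in c) (over_out c) (Diagram C U))"
| R1_over_first:
    "c \<notin> C \<Longrightarrow> over_out c = under_in c \<Longrightarrow>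
     reidemeister (Diagram (insert c C) U) (join (over_in c) (under_out c) (Diagram C U))"
| R2_parallel:
    "c \<notin> C \<Longrightarrow> c' \<notin> C \<Longrightarrow> positive c \<noteq> positive c' \<Longrightarrow>
     over_out c = over_in c' \<Longrightarrow> under_out c = under_in c' \<Longrightarrow>
     reidemeister (Diagram (insert c (insert c' C)) U)
       (splice (over_in c) (over_out c') (under_in c) (under_out c') (Diagram C U))"
| R2_antiparallel:
    "c \<notin> C \<Longrightarrow> c' \<notin> C \<Longrightarrow> positive c \<noteq> positive c' \<Longrightarrow>
     over_out c = over_in c' \<Longrightarrow> under_out c' = under_in c \<Longrightarrow>
     reidemeister (Diagram (insert c (insert c' C)) U)
       (splice (over_in c) (over_out c') (under_in c') (under_out c) (Diagram C U))"
| R3: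
    "card (triangle tm tb mb True t m b) = 3 \<Longrightarrow> triangle tm tb mb True t m b \<inter> C = {} \<Longrightarrow>
     card (triangle tm tb mb False t m b) = 3 \<Longrightarrow> triangle tm tb mb False t m b \<inter> C = {} \<Longrightarrow>
     reidemeister (Diagram (triangle tm tb mb True t m b \<union> C) U)
       (Diagram (triangle tm tb mb False t m b \<union> C) U)"

text \<open>
  C-isotopy as a relation on diagrams, by Reidemeister's theorem. The same \<open>\<kappa>\<close> can be used before
  and after a Reidemeister move, since the move does not introduce new edge names.
\<close>

inductive c_isotopic :: "colored_diagram \<Rightarrow> colored_diagram \<Rightarrow> bool" where
  recolor:
    "colored_link_diagram (D, \<kappa>) \<Longrightarrow> colored_link_diagram (D, \<kappa>') \<Longrightarrow>
     equivalent_colorations D \<kappa> \<kappa>' \<Longrightarrow> c_isotopic (D, \<kappa>) (D, \<kappa>')"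
| relabel:
    "colored_link_diagram (D, \<kappa> \<circ> f) \<Longrightarrow> inj_on f (edges D) \<Longrightarrow>
     c_isotopic (D, \<kappa> \<circ> f) (relabel f D, \<kappa>)"
| reidemeister:
    "colored_link_diagram (D, \<kappa>) \<Longrightarrow> colored_link_diagram (D', \<kappa>) \<Longrightarrow>
     reidemeister D D' \<Longrightarrow> c_isotopic (D, \<kappa>) (D', \<kappa>)"
| sym: "c_isotopic X Y \<Longrightarrow> c_isotopic Y X"
| trans: "c_isotopic X Y \<Longrightarrow> c_isotopic Y Z \<Longrightarrow> c_isotopic X Z"

type_synonym Qxtw = "rat poly poly poly fract"

definition var_x :: Qxtw where "var_x = Fract [:[:[:0, 1:]:]:] 1"
definition var_t :: Qxtw where "var_t = Fract [:[:0, 1:]:] 1"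
definition var_w :: Qxtw where "var_w = Fract [:0, 1:] 1"

definition colored_link_invariant :: "(colored_diagram \<Rightarrow> 'a) \<Rightarrow> bool" where
  "colored_link_invariant F \<longleftrightarrow> (\<forall>X Y. c_isotopic X Y \<longrightarrow> F X = F Y)"

definition merge_colors :: "nat \<Rightarrow> nat \<Rightarrow> (nat \<Rightarrow> nat) \<Rightarrow> nat \<Rightarrow> nat" where
  "merge_colors a b \<kappa> = (\<lambda>e. if \<kappa> e = b then a else \<kappa> e)"

text \<open>
  In the skein relation \<open>Xm l i j k\<close> is the crossing \<open>Xp i j k l\<close> with its two strands exchanged,
  and the oriented smoothing connects the incoming edges \<open>i\<close>, \<open>l\<close> to the outgoing edges \<open>j\<close>, \<open>k\<close>,
  respectively.
\<close>

definition is_invariant_F :: "(colored_diagram \<Rightarrow> Qxtw) \<Rightarrow> bool" where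
  "is_invariant_F F \<longleftrightarrow>
     colored_link_invariant F \<and>
     (\<forall>e \<kappa>. F (Diagram {} {e}, \<kappa>) = 1) \<and>
     (\<forall>C U \<kappa> e. colored_link_diagram (Diagram C U, \<kappa>) \<longrightarrow>
        e \<notin> edges (Diagram C U) \<longrightarrow> \<kappa> e \<notin> \<kappa> ` edges (Diagram C U) \<longrightarrow>
        F (Diagram C (insert e U), \<kappa>) = 1 / (var_w * var_x) * F (Diagram C U, \<kappa>)) \<and>
     (\<forall>i j k l C U \<kappa>. Xp i j k l \<notin> C \<longrightarrow>
        colored_link_diagram (Diagram (insert (Xp i j k l) C) U, \<kappa>) \<longrightarrow>
        (let \<kappa>' = merge_colors (\<kappa> i) (\<kappa> l) \<kappa>
         in 1 / var_w * F (Diagram (insert (Xp i j k l) C) U, \<kappa>)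
              - var_w * F (Diagram (insert (Xm l i j k) C) U, \<kappa>)
            = (1 - inverse var_t) * F (splice i j l k (Diagram C U), \<kappa>')
              + 1 / var_w * (1 - inverse var_t)
                * F (Diagram (insert (Xp i j k l) C) U, \<kappa>')))"

definition corresponds :: "diagram \<Rightarrow> (nat \<Rightarrow> nat) \<Rightarrow> nat set set set \<Rightarrow> bool" where
  "corresponds D \<kappa> P \<longleftrightarrow>
     (\<forall>K\<in>components D. \<forall>K'\<in>components D. \<forall>e\<in>K. \<forall>e'\<in>K'.
        \<kappa> e = \<kappa> e' \<longleftrightarrow> (\<exists>B\<in>P. K \<in> B \<and> K' \<in> B))"

definition F_set :: "(colored_diagram \<Rightarrow> 'a) \<Rightarrow> nat list \<Rightarrow> diagram \<Rightarrow> 'a set" where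
  "F_set F p D =
     {F (D, \<kappa>) | \<kappa> P. partition_on (components D) P \<and>
        image_mset card (mset_set P) = mset p \<and> corresponds D \<kappa> P}"

text \<open>
  \<open>pd_link R C\<close> is the link diagram with PD code \<open>C\<close>, with the orientation of the edges in \<open>R\<close>
  reversed.
\<close>

fun reorient :: "nat set \<Rightarrow> nat crossing \<Rightarrow> nat crossing" where
  "reorient R (Xp i j k l) =
     (if i \<in> R then if l \<in> R then Xp k l i j else Xm k l i j
      else if l \<in> R then Xm i j k l else Xp i j k l)"
| "reorient R (Xm i j k l) =
     (if i \<in> R then if j \<in> R then Xm k l i j else Xp k l i j
      else if j \<in> R then Xp i j k l else Xm i j k l)"

definition pd_link :: "nat set \<Rightarrow> nat crossing set \<Rightarrow> diagram" where
  "pd_link R C = Diagram (reorient R ` C) {}"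

text \<open>
  The links \<open>L11n325{1,1}\<close>, \<open>L11n424{0,0}\<close> etc. of LinkInfo. In each PD code the edges are numbered
  consecutively along the three components, which gives the orientation \<open>{0,0}\<close>; a digit 1 in first
  or second place of the braces reverses the second or third component.
\<close>

definition L11n325_11 :: diagram where
  "L11n325_11 = pd_link {5..22}
    {Xm 6 1 7 2, Xp 8 4 9 3, Xm 5 14 6 15, Xm 16 7 17 8,
     Xm 9 18 10 19, Xp 11 21 12 20, Xm 13 12 14 5, Xp 2 16 3 15,
     Xm 4 17 1 18, Xm 19 22 20 13, Xp 21 11 22 10}"

definition L11n424_00 :: diagram where
  "L11n424_00 = pd_link {}
    {Xm 8 1 9 2, Xm 3 10 4 11, Xm 5 14 6 15, Xm 7 16 8 17,
     Xm 18 9 19 10, Xp 11 13 12 22, Xm 13 4 14 5, Xm 15 20 16 21,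
     Xp 2 18 3 17, Xp 19 1 20 6, Xp 21 7 22 12}"

definition L11n356_10 :: diagram where
  "L11n356_10 = pd_link {5..14}
    {Xm 6 1 7 2, Xm 10 3 11 4, Xm 2 5 3 6, Xp 16 8 17 7,
     Xm 4 9 1 10, Xm 11 18 12 19, Xp 13 21 14 20, Xp 8 16 9 15,
     Xm 17 14 18 5, Xm 19 22 20 15, Xp 21 13 22 12}"

definition L11n434_00 :: diagram where
  "L11n434_00 = pd_link {}
    {Xm 8 1 9 2, Xp 14 4 15 3, Xp 5 17 6 16, Xm 2 7 3 8,
     Xp 22 10 13 9, Xm 18 11 19 12, Xp 12 14 7 13, Xm 15 20 16 21,
     Xm 10 17 11 18, Xp 19 5 20 4, Xp 6 22 1 21}"

definition L10n79_11 :: diagram where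
  "L10n79_11 = pd_link {5..20}
    {Xm 6 1 7 2, Xp 8 4 9 3, Xm 5 14 6 15, Xm 16 7 17 8,
     Xm 9 18 10 19, Xm 11 20 12 13, Xm 13 12 14 5, Xp 2 16 3 15,
     Xm 4 17 1 18, Xm 19 10 20 11}"

definition L10n95_10 :: diagram where
  "L10n95_10 = pd_link {7..12}
    {Xm 8 1 9 2, Xm 3 10 4 11, Xm 14 5 15 6, Xp 16 8 17 7,
     Xp 9 13 10 20, Xp 18 12 19 11, Xm 4 13 5 14, Xm 6 15 1 16,
     Xp 12 18 7 17, Xm 19 2 20 3}"

definition L11a404_11 :: diagram where
  "L11a404_11 = pd_link {5..22}
    {Xm 6 1 7 2, Xm 12 3 13 4, Xm 2 5 3 6, Xm 14 7 15 8,
     Xm 18 9 19 10, Xm 4 11 1 12, Xm 10 13 5 14, Xp 20 16 21 15,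
     Xm 8 17 9 18, Xp 22 20 11 19, Xp 16 22 17 21}"

definition L11a428_01 :: diagram where
  "L11a428_01 = pd_link {11..22}
    {Xm 6 1 7 2, Xp 12 4 13 3, Xm 14 5 15 6, Xm 20 7 21 8,
     Xm 2 9 3 10, Xp 18 12 19 11, Xm 10 13 5 14, Xp 4 16 1 15,
     Xp 22 18 11 17, Xm 8 19 9 20, Xp 16 22 17 21}"

definition L10n76_11 :: diagram where
  "L10n76_11 = pd_link {5..20}
    {Xm 6 1 7 2, Xp 8 4 9 3, Xm 5 14 6 15, Xm 16 7 17 8,
     Xm 9 18 10 19, Xm 11 20 12 13, Xm 13 10 14 11, Xp 2 16 3 15,
     Xm 4 17 1 18, Xm 19 12 20 5}"

definition L11n425_10 :: diagram where
  "L11n425_10 = pd_link {7..12}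
    {Xm 8 1 9 2, Xm 3 10 4 11, Xm 5 14 6 15, Xp 16 8 17 7,
     Xp 9 19 10 18, Xp 11 13 12 22, Xm 13 4 14 5, Xp 20 16 21 15,
     Xm 17 2 18 3, Xm 6 19 1 20, Xp 21 7 22 12}"

definition L11n358_11 :: diagram where
  "L11n358_11 = pd_link {5..22}
    {Xm 6 1 7 2, Xm 10 3 11 4, Xm 2 5 3 6, Xm 7 16 8 17,
     Xm 4 9 1 10, Xp 11 19 12 18, Xp 13 21 14 20, Xm 15 8 16 9,
     Xp 17 15 18 22, Xp 19 5 20 14, Xp 21 13 22 12}"

definition L11n418_10 :: diagram where
  "L11n418_10 = pd_link {7..12}
    {Xm 8 1 9 2, Xm 3 10 4 11, Xm 5 14 6 15, Xm 7 16 8 17,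
     Xm 18 9 19 10, Xm 11 20 12 21, Xm 13 6 14 1, Xp 15 13 16 22,
     Xp 2 18 3 17, Xp 19 5 20 4, Xm 21 12 22 7}"

end

theory Submission
  imports Defs
begin

text \<open>
  For a crossing between strands of two different colours, subtracting from the skein relation its
  instance for the merged coloration \<open>\<kappa>'\<close> removes the smoothing and leaves
  \<open>F(L\<^sub>+, \<kappa>) - F(L\<^sub>+, \<kappa>') = w\<^sup>2 (F(L\<^sub>-, \<kappa>) - F(L\<^sub>-, \<kappa>'))\<close>. Crossings between differently coloured
  components can therefore be changed, at the price of terms with fewer colours, until the
  components are split. For a crossing between strands of equal colour the skein relation is
  that of the HOMFLY-PT polynomial, which unlinks every diagram. So \<open>F\<close> of each of the twelve
  links is computed by a finite tree of Reidemeister moves and skein relations. The values are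
  compared at a rational point where the two links of each pair, which have the same HOMFLY-PT
  polynomial, take different values.
\<close>

section \<open>Computing with link diagrams\<close>

text \<open>The skein relation and the invariance of \<open>F\<close> are available only for
  diagrams that satisfy \<open>colored_link_diagram\<close>, so every diagram met in a computation
  has to be shown well formed, planar and consistently coloured. This shapes the executable part:
  edges are binary numerals, successor maps are tries, and faces are counted by tracing orbits, so
  that Euler's formula becomes a cheap test. Crossing changes and mergings of colours preserve all
  these properties, hence the test is repeated only after Reidemeister moves and smoothings.

  One rational point is enough: if two fractions whose denominators do not vanish there take
  different values, they are different, and no arithmetic with rational functions in three variables
  is needed. The coefficients of the recursion have denominators built from \<open>w\<close>,
  \<open>t\<close>, \<open>t - 1\<close> and \<open>w x\<close>. At \<open>w = t = 2\<close>,
  \<open>x = 1/2\<close> these become powers of two, with \<open>t - 1 = w x = 1\<close>, so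
  integers with a binary exponent suffice.\<close>

datatype 'a trie = Leaf | Node "'a option" "'a trie" "'a trie"

text \<open>Keys are read digit by digit from the constructors of \<open>num\<close>; evaluation by
  rewriting therefore needs no comparison of numbers.\<close>

fun look :: "'a trie \<Rightarrow> num \<Rightarrow> 'a option" where
  "look Leaf k = None"
| "look (Node v l r) num.One = v"
| "look (Node v l r) (num.Bit0 k) = look l k"
| "look (Node v l r) (num.Bit1 k) = look r k"

fun upd :: "num \<Rightarrow> 'a \<Rightarrow> 'a trie \<Rightarrow> 'a trie" where
  "upd num.One v Leaf = Node (Some v) Leaf Leaf"
| "upd num.One v (Node u l r) = Node (Some v) l r"
| "upd (num.Bit0 k) v Leaf = Node None (upd k v Leaf) Leaf"
| "upd (num.Bit0 k) v (Node u l r) = Node u (upd k v l) r"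
| "upd (num.Bit1 k) v Leaf = Node None Leaf (upd k v Leaf)"
| "upd (num.Bit1 k) v (Node u l r) = Node u l (upd k v r)"

text \<open>The binary numerals \<open>Bit1 e\<close> and \<open>Bit0 e\<close> encode the edge \<open>e\<close> traversed along and against its orientation.\<close>

fun turns :: "num crossing \<Rightarrow> (num \<times> num) list" where
  "turns (Xp i j k l) = [(num.Bit1 i, num.Bit0 l), (num.Bit0 j, num.Bit0 i), (num.Bit0 k, num.Bit1 j), (num.Bit1 l, num.Bit1 k)]"
| "turns (Xm i j k l) = [(num.Bit1 i, num.Bit1 l), (num.Bit1 j, num.Bit0 i), (num.Bit0 k, num.Bit0 j), (num.Bit0 l, num.Bit1 k)]"

text \<open>A repeated key is rejected. For the turns of a diagram this forces every edge to enter
  at most one strand passage and to leave at most one.\<close>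

fun build :: "(num \<times> num) list \<Rightarrow> num trie \<Rightarrow> num trie option" where
  "build [] T = Some T"
| "build ((a, b) # ps) T = (case look T a of None \<Rightarrow> build ps (upd a b T) | Some _ \<Rightarrow> None)"

text \<open>Here and below, a first argument of type \<open>'b list\<close> is fuel: its length bounds the recursion.\<close>

fun path :: "'b list \<Rightarrow> num trie \<Rightarrow> num \<Rightarrow> num \<Rightarrow> num list option" where
  "path [] T s d = None"
| "path (x # f) T s d = (case look T d of None \<Rightarrow> None
     | Some e \<Rightarrow> if e = s then Some [d] else map_option (Cons d) (path f T s e))"

text \<open>Visited elements are skipped, so each cycle is listed exactly once and the length of the
  result counts the orbits.\<close>

fun orbits :: "'b list \<Rightarrow> num trie \<Rightarrow> unit trie \<Rightarrow> num list \<Rightarrow> num list list option" where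
  "orbits f T V [] = Some []"
| "orbits f T V (d # ds) = (case look V d of Some _ \<Rightarrow> orbits f T V ds
     | None \<Rightarrow> (case path f T d d of None \<Rightarrow> None
         | Some p \<Rightarrow> map_option (Cons p) (orbits f T (fold (\<lambda>e. upd e ()) p V) ds)))"

fun edge_list :: "'e crossing \<Rightarrow> 'e list" where
  "edge_list (Xp i j k l) = [i, j, k, l]"
| "edge_list (Xm i j k l) = [i, j, k, l]"

definition mark :: "num list \<Rightarrow> unit trie \<Rightarrow> unit trie" where
  "mark = fold (\<lambda>e. upd e ())"

text \<open>A single pass from left to right. A crossing passed over early may touch edges that are
  marked later, which is why \<open>count_pieces\<close> repeats the pass until nothing more is
  absorbed.\<close>

fun absorb :: "unit trie \<Rightarrow> num crossing list \<Rightarrow> unit trie \<times> num crossing list" where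
  "absorb V [] = (V, [])"
| "absorb V (c # cs) =
    (if list_ex (\<lambda>e. look V e \<noteq> None) (edge_list c) then absorb (mark (edge_list c) V) cs
     else (case absorb V cs of (V', r) \<Rightarrow> (V', c # r)))"

text \<open>The trie holds the edges of the piece found so far; a pass that absorbs nothing completes that piece.\<close>

fun count_pieces :: "'b list \<Rightarrow> unit trie \<Rightarrow> num crossing list \<Rightarrow> nat option" where
  "count_pieces [] V cs = None"
| "count_pieces (x # f) V cs = (case absorb V cs of (V', r) \<Rightarrow>
     if length r < length cs then count_pieces f V' r
     else (case cs of [] \<Rightarrow> Some 0 
       | c # cs' \<Rightarrow> map_option Suc (count_pieces f (mark (edge_list c) Leaf) cs')))"

text \<open>That every edge leaving a crossing also enters one is not tested separately: the traced
  cycles close up only if each turn ends on a dart at which another turn starts. The additional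
  \<open>num.One\<close> in the fuel pays for the final pass over the empty list, the only pass when
  there are no crossings.\<close>

definition check :: "num crossing list \<Rightarrow> num list \<Rightarrow> bool" where
  "check cs us \<longleftrightarrow> (let ts = concat (map turns cs) in
     case build ts Leaf of None \<Rightarrow> False
     | Some T \<Rightarrow> (case orbits ts T Leaf (map fst ts) of None \<Rightarrow> False
       | Some ps \<Rightarrow> (case count_pieces (num.One # map fst ts) Leaf cs of None \<Rightarrow> False
         | Some n \<Rightarrow> length ps = length cs + 2 * n \<and>
             list_all (\<lambda>u. look T (num.Bit1 u) = None) us \<and> (cs \<noteq> [] \<or> us \<noteq> []))))"

definition dg :: "num crossing list \<Rightarrow> num list \<Rightarrow> diagram" where
  "dg cs us = Diagram (map_crossing numeral ` set cs) (numeral ` set us)"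

section \<open>Correctness of the tries and of orbit tracing\<close>

lemma look_upd: "look (upd k v t) k' = (if k' = k then Some v else look t k')"
  by (induction k v t arbitrary: k' rule: upd.induct; case_tac k'; simp)

lemma look_fold_upd:
  "look (fold (\<lambda>e. upd e v) xs t) k = (if k \<in> set xs then Some v else look t k)"
  by (induction xs arbitrary: t) (auto simp: look_upd)

lemma build_sound:
  "build ps T = Some T' \<Longrightarrow> distinct (map fst ps) \<and> (\<forall>a\<in>fst ` set ps. look T a = None) \<and>
     look T' = (\<lambda>a. case map_of ps a of Some b \<Rightarrow> Some b | None \<Rightarrow> look T a)"
proof (induction ps T rule: build.induct)
  case (1 T)
  then show ?case by simp
next
  case (2 a b ps T)
  from "2.prems" have n: "look T a = None" and b: "build ps (upd a b T) = Some T'"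
    by (auto split: option.splits)
  note IH = "2.IH"[OF n b]
  have "\<forall>c\<in>fst ` set ps. c \<noteq> a \<and> look T c = None"
    using IH by (auto simp: look_upd split: if_splits)
  moreover have "look T' = (\<lambda>c. case map_of ((a, b) # ps) c of Some b \<Rightarrow> Some b | None \<Rightarrow> look T c)"
  proof
    fix c
    have "a \<notin> fst ` set ps" using calculation by auto
    then have "map_of ps a = None" by (simp add: map_of_eq_None_iff)
    then show "look T' c = (case map_of ((a, b) # ps) c of Some b \<Rightarrow> Some b | None \<Rightarrow> look T c)"
      using IH by (auto simp: look_upd split: option.splits)
  qed
  moreover have "distinct (map fst ps)" using IH by simp
  ultimately show ?case using n by force
qed

lemma build_Leaf:
  assumes "build ps Leaf = Some T"
  shows "distinct (map fst ps)" and "look T a = Some b \<longleftrightarrow> (a, b) \<in> set ps"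
proof -
  have d: "distinct (map fst ps)" and l: "look T = map_of ps"
    using build_sound[OF assms] by (auto simp: fun_eq_iff split: option.splits)
  show "distinct (map fst ps)" by (fact d)
  show "look T a = Some b \<longleftrightarrow> (a, b) \<in> set ps"
    using d by (simp add: l)
qed

text \<open>The target \<open>s\<close> stays fixed while \<open>d\<close> moves towards it, so the
  path is closed under \<open>R\<close> only up to \<open>s\<close>. Starting at
  \<open>d = s\<close> removes this exception, since \<open>d\<close> belongs to the path.\<close>

lemma path_sound:
  assumes "path f T s d = Some p"
  defines "R \<equiv> {(a, b). look T a = Some b}"
  shows "d \<in> set p \<and> (\<forall>a\<in>set p. (\<exists>b\<in>insert s (set p). look T a = Some b) \<and> (d, a) \<in> R\<^sup>* \<and> (a, s) \<in> R\<^sup>*)"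
  using assms(1) unfolding R_def
proof (induction f T s d arbitrary: p rule: path.induct)
  case (1 T s d)
  then show ?case by simp
next
  case (2 x f T s d)
  from "2.prems" obtain e where e: "look T d = Some e"
    by (auto split: option.splits)
  have de: "(d, e) \<in> {(a, b). look T a = Some b}\<^sup>*" using e by auto
  show ?case
  proof (cases "e = s")
    case True
    then show ?thesis using "2.prems" e de by auto
  next
    case False
    then obtain q where q: "path f T s e = Some q" "p = d # q" using "2.prems" e by auto
    from "2.IH"[OF e False q(1)] show ?thesis
      using q(2) e de by (auto intro: rtrancl_trans)
  qed
qed

lemma rtrancl_Image_eqI:
  assumes "R `` A \<subseteq> A" "\<And>b. b \<in> A \<Longrightarrow> (a, b) \<in> R\<^sup>*" "a \<in> A"
  shows "R\<^sup>* `` {a} = A"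
proof -
  have "R\<^sup>* `` A = A" using assms(1) by (rule Image_closed_trancl)
  then show ?thesis using assms(2,3) by auto
qed

lemma path_cycle:
  assumes "path f T d d = Some p"
  defines "R \<equiv> {(a, b). look T a = Some b}"
  assumes "a \<in> set p"
  shows "R\<^sup>* `` {a} = set p" and "a \<in> Domain R"
proof -
  note s = path_sound[OF assms(1), folded R_def]
  have "R `` set p \<subseteq> set p" using s unfolding R_def by fastforce
  then show "R\<^sup>* `` {a} = set p"
    by (rule rtrancl_Image_eqI) (use s assms(3) in \<open>auto intro: rtrancl_trans\<close>)
  show "a \<in> Domain R" using s assms(3) unfolding R_def by blast
qed

text \<open>The visited set \<open>X\<close> has to be closed under \<open>R\<close>: a cycle that
  starts outside of \<open>X\<close> then cannot run into it, because it could never return to its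
  start.\<close>

lemma orbits_sound:
  assumes "orbits f T V ds = Some ps"
  defines "R \<equiv> {(a, b). look T a = Some b}"
  assumes "\<And>a. a \<in> X \<Longrightarrow> R\<^sup>* `` {a} \<subseteq> X" and "\<And>a. look V a \<noteq> None \<longleftrightarrow> a \<in> X"
  shows "distinct (map set ps) \<and> set ` set ps = {R\<^sup>* `` {d} | d. d \<in> set ds - X} \<and>
     (\<forall>p\<in>set ps. set p \<noteq> {} \<and> set p \<inter> X = {} \<and> set p \<subseteq> Domain R) \<and> set ds - X \<subseteq> Domain R"
  using assms(1,3,4)
proof (induction ds arbitrary: V X ps)
  case Nil
  then show ?case by simp
next
  case (Cons d ds)
  show ?case
  proof (cases "look V d")
    case (Some u)
    then have "d \<in> X" using Cons.prems(3)[of d] by auto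
    moreover from Some Cons.prems(1) have "orbits f T V ds = Some ps" by simp
    note Cons.IH[OF this Cons.prems(2,3)]
    moreover have "set (d # ds) - X = set ds - X" using \<open>d \<in> X\<close> by auto
    ultimately show ?thesis by simp
  next
    case None
    then have dX: "d \<notin> X" using Cons.prems(3)[of d] by auto
    from None Cons.prems(1) obtain p qs where p: "path f T d d = Some p"
      and qs: "orbits f T (fold (\<lambda>e. upd e ()) p V) ds = Some qs" "ps = p # qs"
      by (auto split: option.splits)
    note cyc = path_cycle[OF p, folded R_def]
    have dp: "d \<in> set p" using path_sound[OF p] by simp
    have disj: "set p \<inter> X = {}"
    proof (rule ccontr)
      assume "set p \<inter> X \<noteq> {}"
      then obtain e where "e \<in> set p" "e \<in> X" by auto
      then have "d \<in> X" using Cons.prems(2)[of e] cyc(1)[of e] dp by auto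
      with dX show False by simp
    qed
    have IH: "distinct (map set qs) \<and> set ` set qs = {R\<^sup>* `` {d} | d. d \<in> set ds - (X \<union> set p)} \<and>
     (\<forall>p'\<in>set qs. set p' \<noteq> {} \<and> set p' \<inter> (X \<union> set p) = {} \<and> set p' \<subseteq> Domain R) \<and> set ds - (X \<union> set p) \<subseteq> Domain R"
    proof (rule Cons.IH[OF qs(1)])
      show "R\<^sup>* `` {a} \<subseteq> X \<union> set p" if "a \<in> X \<union> set p" for a
        using that Cons.prems(2)[of a] cyc(1)[of a] by auto
      show "look (fold (\<lambda>e. upd e ()) p V) a \<noteq> None \<longleftrightarrow> a \<in> X \<union> set p" for a
        using Cons.prems(3)[of a] by (auto simp: look_fold_upd)
    qed
    have "distinct (map set ps)"
      using IH qs(2) dp by auto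
    moreover have "set ` set ps = {R\<^sup>* `` {e} | e. e \<in> set (d # ds) - X}"
    proof -
      have "{R\<^sup>* `` {e} | e. e \<in> set (d # ds) - X} =
        {R\<^sup>* `` {e} | e. e \<in> set ds - (X \<union> set p)} \<union> {R\<^sup>* `` {e} | e. e \<in> insert d (set ds) \<inter> set p}"
        using dX dp disj by auto
      also have "{R\<^sup>* `` {e} | e. e \<in> insert d (set ds) \<inter> set p} = {set p}"
        using cyc(1) dp by auto
      finally show ?thesis using IH qs(2) by auto
    qed
    moreover have "\<forall>p\<in>set ps. set p \<noteq> {} \<and> set p \<inter> X = {} \<and> set p \<subseteq> Domain R"
      using IH qs(2) dp disj cyc(2) by auto
    moreover have "set (d # ds) - X \<subseteq> Domain R"
      using IH cyc(2) dp by auto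
    ultimately show ?thesis by blast
  qed
qed

lemma orbits_Leaf:
  assumes "orbits f T Leaf ds = Some ps"
  defines "R \<equiv> {(a, b). look T a = Some b}"
  shows "distinct (map set ps)" and "set ` set ps = {R\<^sup>* `` {d} | d. d \<in> set ds}"
    and "set ds \<subseteq> Domain R" and "p \<in> set ps \<Longrightarrow> set p \<subseteq> Domain R" and "card {R\<^sup>* `` {d} | d. d \<in> set ds} = length ps"
proof -
  note s = orbits_sound[OF assms(1), of "{}", folded R_def, simplified]
  from s show 1: "distinct (map set ps)" and 2: "set ` set ps = {R\<^sup>* `` {d} | d. d \<in> set ds}"
    and "set ds \<subseteq> Domain R" and "p \<in> set ps \<Longrightarrow> set p \<subseteq> Domain R" by auto
  have "card (set (map set ps)) = length ps" using distinct_card[OF 1] by simp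
  then show "card {R\<^sup>* `` {d} | d. d \<in> set ds} = length ps" using 2 by simp
qed

text \<open>Carries orbits of numerals over to darts and to edges in \<open>nat\<close>. Injectivity
  prevents images of unrelated pairs from composing to a new chain.\<close>

lemma rtrancl_image_inj:
  assumes "inj f"
  shows "(map_prod f f ` R)\<^sup>* `` {f a} = f ` (R\<^sup>* `` {a})"
proof
  have "(x, y) \<in> (map_prod f f ` R)\<^sup>* \<Longrightarrow> x = f a \<Longrightarrow> \<exists>b. y = f b \<and> (a, b) \<in> R\<^sup>*" for x y
  proof (induction rule: rtrancl_induct)
    case base
    then show ?case by auto
  next
    case (step y z)
    then show ?case using injD[OF assms] by (fastforce intro: rtrancl_into_rtrancl)
  qed
  then show "(map_prod f f ` R)\<^sup>* `` {f a} \<subseteq> f ` (R\<^sup>* `` {a})" by auto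
  have "(a, b) \<in> R\<^sup>* \<Longrightarrow> (f a, f b) \<in> (map_prod f f ` R)\<^sup>*" for b
  proof (induction rule: rtrancl_induct)
    case base
    then show ?case by simp
  next
    case (step y z)
    then have "(f y, f z) \<in> map_prod f f ` R" by force
    with step.IH show ?case by (rule rtrancl_into_rtrancl)
  qed
  then show "f ` (R\<^sup>* `` {a}) \<subseteq> (map_prod f f ` R)\<^sup>* `` {f a}" by auto
qed

text \<open>The numeral \<open>num.One\<close> encodes no dart. Edge \<open>0\<close> is a safe
  value for it, because \<open>numeral\<close> never takes the value \<open>0\<close>, and keeps
  \<open>dart\<close> injective.\<close>

fun dart :: "num \<Rightarrow> nat \<times> bool" where
  "dart num.One = (0, True)"
| "dart (num.Bit0 e) = (numeral e, False)"
| "dart (num.Bit1 e) = (numeral e, True)"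

lemma inj_dart: "inj dart"
proof (rule injI)
  show "dart x = dart y \<Longrightarrow> x = y" for x y by (cases x; cases y) auto
qed

lemma turns_dart: "map_prod dart dart ` set (turns c) = left_turns (map_crossing numeral c)"
  by (cases c) auto

section \<open>Well-formedness read off from the turns\<close>

lemma entries_map:
  "under_in (map_crossing f c) = f (under_in c)" "over_in (map_crossing f c) = f (over_in c)"
  "under_out (map_crossing f c) = f (under_out c)" "over_out (map_crossing f c) = f (over_out c)"
  "positive (map_crossing f c) = positive c"
  by (cases c; simp)+

lemma fst_turns:
  "fst ` set (turns c) =
     {num.Bit1 (under_in c), num.Bit1 (over_in c), num.Bit0 (under_out c), num.Bit0 (over_out c)}"
  "snd ` set (turns c) =
     {num.Bit0 (under_in c), num.Bit0 (over_in c), num.Bit1 (under_out c), num.Bit1 (over_out c)}"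
  "distinct (map fst (turns c)) \<longleftrightarrow> under_in c \<noteq> over_in c \<and> under_out c \<noteq> over_out c"
  by (cases c; auto)+

lemma set_crossing_strands: "set_crossing c = {under_in c, over_in c, under_out c, over_out c}"
  by (cases c) auto

lemma inj_map_crossing: "inj f \<Longrightarrow> inj (map_crossing f)"
  by (simp add: crossing.inj_map)

lemma inj_num: "inj (numeral :: num \<Rightarrow> nat)"
  by (simp add: inj_def)

text \<open>Turns start at \<open>Bit1\<close> of incoming and \<open>Bit0\<close> of outgoing
  edges, and end at \<open>Bit0\<close> of incoming and \<open>Bit1\<close> of outgoing edges.
  Distinct starts therefore make both the entry map and the exit map injective, and the inclusion of
  the ends in the starts yields, for the two tags separately, the two inclusions between entered and
  left edges.\<close>

lemma well_formedI:
  assumes d: "distinct (map fst (concat (map turns cs)))"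
    and t: "snd ` set (concat (map turns cs)) \<subseteq> fst ` set (concat (map turns cs))"
    and u: "\<forall>u\<in>set us. num.Bit1 u \<notin> fst ` set (concat (map turns cs))"
  shows "well_formed (dg cs us)" and "distinct cs"
    and "dart ` fst ` set (concat (map turns cs)) = {d. fst d \<in> \<Union>(set_crossing ` crossings (dg cs us))}"
proof -
  define S where "S = (\<lambda>c. fst ` set (turns c))"
  have dc: "distinct (concat (map (\<lambda>c. map fst (turns c)) cs))"
    using d by (simp add: map_concat comp_def)
  \<comment> \<open>As no sublist is empty, distinctness of the concatenation makes the sublists
    themselves, and hence the crossings, pairwise distinct.\<close>
  have ne: "map fst (turns c) \<noteq> []" for c by (cases c) auto
  then have dm: "distinct (map (\<lambda>c. map fst (turns c)) cs)" and dt: "\<And>c. c \<in> set cs \<Longrightarrow> distinct (map fst (turns c))"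
    and dj: "\<And>xs ys. xs \<in> (\<lambda>c. map fst (turns c)) ` set cs \<Longrightarrow> ys \<in> (\<lambda>c. map fst (turns c)) ` set cs \<Longrightarrow> xs \<noteq> ys \<Longrightarrow> set xs \<inter> set ys = {}"
    using dc unfolding distinct_concat_iff
    by (auto simp: removeAll_filter_not_eq filter_id_conv)
  then show dcs: "distinct cs" by (simp add: distinct_map)
  have disj: "S c \<inter> S c' = {}" if "c \<in> set cs" "c' \<in> set cs" "c \<noteq> c'" for c c'
  proof -
    have "map fst (turns c) \<noteq> map fst (turns c')"
      using dm that by (auto simp: distinct_map inj_on_def)
    then show ?thesis using dj[of "map fst (turns c)" "map fst (turns c')"] that
      by (simp add: S_def)
  qed
  have io: "under_in c \<noteq> over_in c" "under_out c \<noteq> over_out c" if "c \<in> set cs" for c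
    using dt[OF that] by (simp_all add: fst_turns)
  define en ex where "en = (\<lambda>(c :: nat crossing, over). if over then over_in c else under_in c)"
    and "ex = (\<lambda>(c :: nat crossing, over). if over then over_out c else under_out c)"
  let ?C = "map_crossing numeral ` set cs :: nat crossing set"
  have inj: "inj_on en (?C \<times> UNIV)" "inj_on ex (?C \<times> UNIV)"
  proof -
    have "c = c' \<and> b = b'" if cc: "c \<in> set cs" "c' \<in> set cs" 
      and e: "(if b then over_in c else under_in c) = (if b' then over_in c' else under_in c')" for c c' b b'
    proof (cases "c = c'")
      case True
      then show ?thesis using e io[OF cc(1)] by (auto split: if_splits)
    next
      case False
      have "num.Bit1 (if b then over_in c else under_in c) \<in> S c \<inter> S c'"
        using e by (auto simp: S_def fst_turns split: if_splits)
      then show ?thesis using disj[OF cc False] by auto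
    qed
    note 1 = this
    show "inj_on en (?C \<times> UNIV)"
    proof (rule inj_onI)
      fix x y assume xy: "x \<in> ?C \<times> UNIV" "y \<in> ?C \<times> UNIV" "en x = en y"
      then obtain c b c' b' where c: "c \<in> set cs" "c' \<in> set cs" "x = (map_crossing numeral c, b)"
        "y = (map_crossing numeral c', b')" by auto
      with xy(3) have "(if b then over_in c else under_in c) = (if b' then over_in c' else under_in c')"
        by (simp add: en_def entries_map split: if_splits)
      from 1[OF c(1,2) this] c(3,4) show "x = y" by simp
    qed
    have "c = c' \<and> b = b'" if cc: "c \<in> set cs" "c' \<in> set cs" 
      and e: "(if b then over_out c else under_out c) = (if b' then over_out c' else under_out c')" for c c' b b'
    proof (cases "c = c'")
      case True
      then show ?thesis using e io[OF cc(1)] by (auto split: if_splits)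
    next
      case False
      have "num.Bit0 (if b then over_out c else under_out c) \<in> S c \<inter> S c'"
        using e by (auto simp: S_def fst_turns split: if_splits)
      then show ?thesis using disj[OF cc False] by auto
    qed
    note 2 = this
    show "inj_on ex (?C \<times> UNIV)"
    proof (rule inj_onI)
      fix x y assume xy: "x \<in> ?C \<times> UNIV" "y \<in> ?C \<times> UNIV" "ex x = ex y"
      then obtain c b c' b' where c: "c \<in> set cs" "c' \<in> set cs" "x = (map_crossing numeral c, b)"
        "y = (map_crossing numeral c', b')" by auto
      with xy(3) have "(if b then over_out c else under_out c) = (if b' then over_out c' else under_out c')"
        by (simp add: ex_def entries_map split: if_splits)
      from 2[OF c(1,2) this] c(3,4) show "x = y" by simp
    qed
  qed
  define I where "I = (\<Union>c\<in>set cs. {under_in c, over_in c})"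
  define O' where "O' = (\<Union>c\<in>set cs. {under_out c, over_out c})"
  have fs: "fst ` set (concat (map turns cs)) = num.Bit1 ` I \<union> num.Bit0 ` O'"
  proof -
    have "fst ` set (concat (map turns cs)) = (\<Union>c\<in>set cs. fst ` set (turns c))" by auto
    then show ?thesis unfolding fst_turns I_def O'_def by auto
  qed
  have ss: "snd ` set (concat (map turns cs)) = num.Bit0 ` I \<union> num.Bit1 ` O'"
  proof -
    have "snd ` set (concat (map turns cs)) = (\<Union>c\<in>set cs. snd ` set (turns c))" by auto
    then show ?thesis unfolding fst_turns I_def O'_def by auto
  qed
  have IO: "I = O'" using t unfolding fs ss by auto
  have eI: "en ` (?C \<times> UNIV) = numeral ` I" "ex ` (?C \<times> UNIV) = numeral ` O'"
    by (auto simp: en_def ex_def I_def O'_def entries_map image_iff split: if_splits; (metis (full_types))?)+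
  have ed: "\<Union>(set_crossing ` ?C) = numeral ` I"
    using IO by (auto simp: set_crossing_strands entries_map I_def O'_def)
  have "numeral ` I \<inter> numeral ` set us = ({} :: nat set)"
    using u unfolding fs by auto
  then show "well_formed (dg cs us)"
    unfolding well_formed_def Let_def en_def[symmetric] ex_def[symmetric] dg_def diagram.sel
    using inj eI IO ed by simp
  show "dart ` fst ` set (concat (map turns cs)) = {d. fst d \<in> \<Union>(set_crossing ` crossings (dg cs us))}"
    unfolding fs dg_def diagram.sel ed IO[symmetric]
  proof (rule set_eqI)
    fix x :: "nat \<times> bool"
    obtain n b where [simp]: "x = (n, b)" by force
    show "x \<in> dart ` (num.Bit1 ` I \<union> num.Bit0 ` I) \<longleftrightarrow> x \<in> {d. fst d \<in> numeral ` I}"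
      by (cases b) (auto simp: image_image image_Un)
  qed
qed

section \<open>Connected pieces\<close>

definition pair_rel :: "'e crossing set \<Rightarrow> ('e \<times> 'e) set" where
  "pair_rel C = (\<Union>c\<in>C. set_crossing c \<times> set_crossing c)"

lemma pieces_alt: "pieces C = (\<lambda>e. (pair_rel C)\<^sup>* `` {e}) ` \<Union>(set_crossing ` C)"
  by (auto simp: pieces_def pair_rel_def)

text \<open>\<open>A\<close> consists of the crossings absorbed in the pass. Each of them met an
  edge already marked, which connects its other edges to \<open>E\<close> inside \<open>A\<close>.
  The last clause is the stopping criterion: if nothing was absorbed, no crossing touches
  \<open>E\<close>.\<close>

lemma absorb_sound:
  assumes "absorb V cs = (V', r)" and "\<And>e. look V e \<noteq> None \<longleftrightarrow> e \<in> E"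
  shows "\<exists>A E'. set cs = A \<union> set r \<and> (\<forall>e. look V' e \<noteq> None \<longleftrightarrow> e \<in> E') \<and> E' = E \<union> \<Union>(set_crossing ` A) \<and>
    E' \<subseteq> (pair_rel A)\<^sup>* `` E \<and> length r \<le> length cs \<and> (length r = length cs \<longrightarrow> (\<forall>c\<in>set cs. set_crossing c \<inter> E = {}))"
  using assms
proof (induction V cs arbitrary: V' r E rule: absorb.induct)
  case (1 V)
  then show ?case by auto
next
  case (2 V c cs)
  have sl: "set (edge_list c) = set_crossing c" by (cases c) auto
  show ?case
  proof (cases "list_ex (\<lambda>e. look V e \<noteq> None) (edge_list c)")
    case True
    then have meet: "set_crossing c \<inter> E \<noteq> {}"
      using "2.prems"(2) by (auto simp: list_ex_iff sl)
    have "look (mark (edge_list c) V) e \<noteq> None \<longleftrightarrow> e \<in> E \<union> set_crossing c" for e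
      using "2.prems"(2)[of e] by (auto simp: mark_def look_fold_upd sl)
    with "2.IH"(1)[OF True, of V' r "E \<union> set_crossing c"] True "2.prems"(1)
    obtain A E' where A: "set cs = A \<union> set r" "\<forall>e. look V' e \<noteq> None \<longleftrightarrow> e \<in> E'"
      "E' = E \<union> set_crossing c \<union> \<Union>(set_crossing ` A)" "E' \<subseteq> (pair_rel A)\<^sup>* `` (E \<union> set_crossing c)"
      "length r \<le> length cs" by auto
    have mono: "(pair_rel A)\<^sup>* \<subseteq> (pair_rel (insert c A))\<^sup>*" by (rule rtrancl_mono) (auto simp: pair_rel_def)
    obtain e0 where "e0 \<in> set_crossing c" "e0 \<in> E" using meet by auto
    then have "(e0, e) \<in> (pair_rel (insert c A))\<^sup>*" if "e \<in> set_crossing c" for e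
      using that by (auto simp: pair_rel_def)
    then have "set_crossing c \<subseteq> (pair_rel (insert c A))\<^sup>* `` E" using \<open>e0 \<in> E\<close> by auto
    then have "E \<union> set_crossing c \<subseteq> (pair_rel (insert c A))\<^sup>* `` E" by auto
    then have "(pair_rel A)\<^sup>* `` (E \<union> set_crossing c) \<subseteq> (pair_rel (insert c A))\<^sup>* `` ((pair_rel (insert c A))\<^sup>* `` E)"
      by (rule Image_mono[OF mono])
    also have "\<dots> = (pair_rel (insert c A))\<^sup>* `` E"
      by (simp flip: relcomp_Image)
    finally have "(pair_rel A)\<^sup>* `` (E \<union> set_crossing c) \<subseteq> (pair_rel (insert c A))\<^sup>* `` E" .
    with A(4) have "E' \<subseteq> (pair_rel (insert c A))\<^sup>* `` E" by (rule order.trans)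
    moreover have "set (c # cs) = insert c A \<union> set r" "E' = E \<union> \<Union>(set_crossing ` insert c A)"
      "length r < length (c # cs)" using A(1,3,5) by auto
    ultimately show ?thesis using A(2)
      by (metis less_imp_le less_irrefl)
  next
    case False
    then have disj: "set_crossing c \<inter> E = {}"
      using "2.prems"(2) by (auto simp: list_ex_iff sl)
    obtain V1 r1 where r1: "absorb V cs = (V1, r1)" by force
    then have eq: "V' = V1" "r = c # r1" using False "2.prems"(1) by auto
    from "2.IH"(2)[OF False r1 "2.prems"(2)] obtain A E' where
      "set cs = A \<union> set r1" "\<forall>e. look V1 e \<noteq> None \<longleftrightarrow> e \<in> E'" "E' = E \<union> \<Union>(set_crossing ` A)"
      "E' \<subseteq> (pair_rel A)\<^sup>* `` E" "length r1 \<le> length cs" "length r1 = length cs \<longrightarrow> (\<forall>c\<in>set cs. set_crossing c \<inter> E = {})"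
      by auto
    then show ?thesis using disj eq
      by (intro exI[of _ A] exI[of _ E']) auto
  qed
qed

text \<open>\<open>A\<close> is the piece under construction. The count \<open>n\<close> refers only
  to the pieces still to be found, whence the correction by one when \<open>A\<close> is non-empty.
  A pass without absorption shows that the remaining crossings share no edge with \<open>A\<close>,
  so the classes of the union split into those of the rest and the single class of
  \<open>A\<close>.\<close>

lemma count_pieces_sound:
  assumes "count_pieces f V cs = Some n" and "\<And>e. look V e \<noteq> None \<longleftrightarrow> e \<in> \<Union>(set_crossing ` A)"
    and "\<And>e e'. e \<in> \<Union>(set_crossing ` A) \<Longrightarrow> e' \<in> \<Union>(set_crossing ` A) \<Longrightarrow> (e, e') \<in> (pair_rel A)\<^sup>*"
  shows "card ((\<lambda>e. (pair_rel (A \<union> set cs))\<^sup>* `` {e}) ` \<Union>(set_crossing ` (A \<union> set cs))) = n + (if A = {} then 0 else 1)"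
  using assms
proof (induction f V cs arbitrary: n A rule: count_pieces.induct)
  case (1 V cs)
  then show ?case by simp
next
  case (2 x f V cs)
  let ?E = "\<lambda>A. \<Union>(set_crossing ` A)"
  let ?cls = "\<lambda>A. (\<lambda>e. (pair_rel A)\<^sup>* `` {e}) ` ?E A"
  have ne: "set_crossing c \<noteq> {}" for c :: "num crossing" by (simp add: set_crossing_strands)
  obtain V' r where ab: "absorb V cs = (V', r)" by force
  from absorb_sound[OF ab "2.prems"(2)] obtain B E' where B: "set cs = B \<union> set r"
    "\<forall>e. look V' e \<noteq> None \<longleftrightarrow> e \<in> E'" "E' = ?E A \<union> ?E B" "E' \<subseteq> (pair_rel B)\<^sup>* `` ?E A"
    "length r \<le> length cs" "length r = length cs \<longrightarrow> (\<forall>c\<in>set cs. set_crossing c \<inter> ?E A = {})"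
    by auto
  show ?case
  proof (cases "length r < length cs")
    case True
    have mono: "(pair_rel A)\<^sup>* \<subseteq> (pair_rel (A \<union> B))\<^sup>*" "(pair_rel B)\<^sup>* \<subseteq> (pair_rel (A \<union> B))\<^sup>*"
      by (rule rtrancl_mono; auto simp: pair_rel_def)+
    have sym: "sym ((pair_rel (A \<union> B))\<^sup>*)"
      by (rule sym_rtrancl) (auto simp: sym_def pair_rel_def)
    have con: "(e, e') \<in> (pair_rel (A \<union> B))\<^sup>*" if e: "e \<in> E'" "e' \<in> E'" for e e'
    proof -
      obtain a where a: "(a, e) \<in> (pair_rel B)\<^sup>*" "a \<in> ?E A"
        using subsetD[OF B(4) e(1)] by (rule ImageE)
      obtain a' where a': "(a', e') \<in> (pair_rel B)\<^sup>*" "a' \<in> ?E A"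
        using subsetD[OF B(4) e(2)] by (rule ImageE)
      have "(a, a') \<in> (pair_rel A)\<^sup>*" by (rule "2.prems"(3)[OF a(2) a'(2)])
      moreover have "(a, e) \<in> (pair_rel (A \<union> B))\<^sup>*" "(a', e') \<in> (pair_rel (A \<union> B))\<^sup>*"
        by (rule subsetD[OF mono(2) a(1)], rule subsetD[OF mono(2) a'(1)])
      moreover have "(e, a) \<in> (pair_rel (A \<union> B))\<^sup>*"
        using calculation(2) by (rule symD[OF sym])
      ultimately have "(e, a) \<in> (pair_rel (A \<union> B))\<^sup>*" "(a, a') \<in> (pair_rel (A \<union> B))\<^sup>*" "(a', e') \<in> (pair_rel (A \<union> B))\<^sup>*"
        using mono(1) by blast+
      then show ?thesis by (blast intro: rtrancl_trans)
    qed
    \<comment> \<open>With no edge marked a pass absorbs nothing, so a pass that shortens the list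
      belongs to a non-empty piece.\<close>
    have Ane: "A \<noteq> {}"
    proof
      assume "A = {}"
      then have "E' = {}" using B(4) by auto
      then have "B = {}" using B(3) ne by auto
      have "?E A = {}" using \<open>A = {}\<close> by simp
      then have "V' = V \<and> r = cs"
        using ab "2.prems"(2)
      proof (induction V cs arbitrary: V' r rule: absorb.induct)
        case (2 V c cs)
        then show ?case by (auto simp: list_ex_iff split: prod.splits)
      qed simp
      then show False using True by simp
    qed
    have "count_pieces f V' r = Some n" using True ab "2.prems"(1) by simp
    from "2.IH"(1)[OF ab[symmetric] True this, of "A \<union> B"]
    show ?thesis using B con Ane by (simp add: Un_assoc)
  next
    case False
    then have dj: "\<forall>c\<in>set cs. set_crossing c \<inter> ?E A = {}" using B by auto
    show ?thesis
    proof (cases cs)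
      case Nil
      then have n: "n = 0" using False ab "2.prems"(1) by simp
      have "?cls A = {?E A}" if "A \<noteq> {}"
      proof -
        have "(pair_rel A)\<^sup>* `` {e} = ?E A" if "e \<in> ?E A" for e
          by (rule rtrancl_Image_eqI) (use that "2.prems"(3) in \<open>auto simp: pair_rel_def\<close>)
        moreover have "?E A \<noteq> {}" using that ne by auto
        ultimately show ?thesis by force
      qed
      then show ?thesis using Nil n by auto
    next
      case (Cons c cs')
      then obtain m where m: "count_pieces f (mark (edge_list c) Leaf) cs' = Some m" "n = Suc m"
        using False ab "2.prems"(1) by auto
      have sl: "set (edge_list c) = set_crossing c" by (cases c) auto
      have "look (mark (edge_list c) Leaf) e \<noteq> None \<longleftrightarrow> e \<in> ?E {c}" for e
        by (simp add: mark_def look_fold_upd sl)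
      moreover have "(e, e') \<in> (pair_rel {c})\<^sup>*" if "e \<in> ?E {c}" "e' \<in> ?E {c}" for e e'
        using that by (auto simp: pair_rel_def)
      ultimately have IH: "card (?cls (set cs)) = n"
        using "2.IH"(2)[OF ab[symmetric] False Cons m(1), of "{c}"] m(2) Cons by simp
      have U: "?cls (A \<union> set cs) = ?cls (set cs) \<union> (if A = {} then {} else {?E A})"
      proof -
        have A1: "(pair_rel (A \<union> set cs))\<^sup>* `` {e} = ?E A" if "e \<in> ?E A" for e
        proof (rule rtrancl_Image_eqI)
          show "pair_rel (A \<union> set cs) `` ?E A \<subseteq> ?E A" using dj by (auto simp: pair_rel_def)
          have "(pair_rel A)\<^sup>* \<subseteq> (pair_rel (A \<union> set cs))\<^sup>*" by (rule rtrancl_mono) (auto simp: pair_rel_def)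
          then show "(e, b) \<in> (pair_rel (A \<union> set cs))\<^sup>*" if "b \<in> ?E A" for b
            using "2.prems"(3)[OF \<open>e \<in> ?E A\<close> that] by auto
        qed (fact that)
        have A2: "(pair_rel (A \<union> set cs))\<^sup>* `` {e} = (pair_rel (set cs))\<^sup>* `` {e}" if "e \<in> ?E (set cs)" for e
        proof (rule rtrancl_Image_eqI)
          have cl: "(pair_rel (set cs))\<^sup>* `` {e} \<subseteq> ?E (set cs)"
          proof -
            have "(e, b) \<in> (pair_rel (set cs))\<^sup>* \<Longrightarrow> b \<in> ?E (set cs)" for b
              by (induction rule: rtrancl_induct) (use that in \<open>auto simp: pair_rel_def\<close>)
            then show ?thesis by auto
          qed
          show "pair_rel (A \<union> set cs) `` ((pair_rel (set cs))\<^sup>* `` {e}) \<subseteq> (pair_rel (set cs))\<^sup>* `` {e}"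
          proof
            fix z assume "z \<in> pair_rel (A \<union> set cs) `` ((pair_rel (set cs))\<^sup>* `` {e})"
            then obtain y where y: "(e, y) \<in> (pair_rel (set cs))\<^sup>*" "(y, z) \<in> pair_rel (A \<union> set cs)" by auto
            then have "y \<in> ?E (set cs)" using cl by auto
            then have "(y, z) \<in> pair_rel (set cs)" using y(2) dj by (auto simp: pair_rel_def)
            then show "z \<in> (pair_rel (set cs))\<^sup>* `` {e}" using y(1) by auto
          qed
          have "(pair_rel (set cs))\<^sup>* \<subseteq> (pair_rel (A \<union> set cs))\<^sup>*" by (rule rtrancl_mono) (auto simp: pair_rel_def)
          then show "(e, b) \<in> (pair_rel (A \<union> set cs))\<^sup>*" if "b \<in> (pair_rel (set cs))\<^sup>* `` {e}" for b
            using that by auto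
        qed auto
        have "?cls (A \<union> set cs) = (\<lambda>e. (pair_rel (A \<union> set cs))\<^sup>* `` {e}) ` ?E A \<union> (\<lambda>e. (pair_rel (A \<union> set cs))\<^sup>* `` {e}) ` ?E (set cs)"
          by (simp add: image_Un)
        also have "(\<lambda>e. (pair_rel (A \<union> set cs))\<^sup>* `` {e}) ` ?E (set cs) = ?cls (set cs)"
          using A2 by (intro image_cong) auto
        also have "(\<lambda>e. (pair_rel (A \<union> set cs))\<^sup>* `` {e}) ` ?E A = (if A = {} then {} else {?E A})"
        proof (cases "A = {}")
          case False
          then obtain e where "e \<in> ?E A" using ne by fastforce
          then show ?thesis using A1 False by force
        qed simp
        finally show ?thesis by auto
      qed
      have "?E A \<notin> ?cls (set cs)" if "A \<noteq> {}"
      proof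
        assume "?E A \<in> ?cls (set cs)"
        then obtain e where "e \<in> ?E (set cs)" "?E A = (pair_rel (set cs))\<^sup>* `` {e}" by auto
        then have "e \<in> ?E A" "e \<in> ?E (set cs)" by auto
        then show False using dj by auto
      qed
      moreover have "finite (?cls (set cs))"
        by (auto simp: set_crossing_strands)
      ultimately show ?thesis using IH U by auto
    qed
  qed
qed

lemma pair_rel_map: "pair_rel (map_crossing f ` C) = map_prod f f ` pair_rel C"
  by (auto simp: pair_rel_def crossing.set_map)

text \<open>The injections \<open>dart\<close> and \<open>numeral\<close> turn the traced orbits
  into the faces and the counted classes into the pieces of the specification, so the tested
  equation is the one that defines \<open>planar\<close>.\<close>

lemma link_diagram_check:
  assumes "check cs us"
  shows "link_diagram (dg cs us)" and "distinct cs"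
proof -
  define ts where "ts = concat (map turns cs)"
  obtain T ps n where T: "build ts Leaf = Some T" and ps: "orbits ts T Leaf (map fst ts) = Some ps"
    and n: "count_pieces (num.One # map fst ts) Leaf cs = Some n"
    and l: "length ps = length cs + 2 * n" and us: "\<forall>u\<in>set us. look T (num.Bit1 u) = None" "cs \<noteq> [] \<or> us \<noteq> []"
    using assms unfolding check_def Let_def ts_def[symmetric]
    by (auto split: option.splits simp: list_all_iff)
  define R where "R = {(a, b). look T a = Some b}"
  have R: "R = set ts" using build_Leaf(2)[OF T] by (auto simp: R_def)
  note o = orbits_Leaf[OF ps, folded R_def]
  have d: "distinct (map fst ts)" by (rule build_Leaf(1)[OF T])
  have t: "snd ` set ts \<subseteq> fst ` set ts"
  proof
    fix b assume "b \<in> snd ` set ts"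
    then obtain a where ab: "(a, b) \<in> R" by (auto simp: R)
    then have "a \<in> set (map fst ts)" by (force simp: R)
    then have "R\<^sup>* `` {a} \<in> set ` set ps" unfolding o(2) by blast
    then obtain p where p: "p \<in> set ps" "set p = R\<^sup>* `` {a}" by auto
    have "b \<in> set p" using p ab by auto
    have "set p \<subseteq> Domain R" by (rule o(4)[OF p(1)])
    then show "b \<in> fst ` set ts" using \<open>b \<in> set p\<close> by (auto simp: R Domain_fst)
  qed
  have u: "\<forall>u\<in>set us. num.Bit1 u \<notin> fst ` set ts"
    using us(1) R by (force simp: R_def)
  note w = well_formedI[OF d[unfolded ts_def] t[unfolded ts_def] u[unfolded ts_def], folded ts_def]
  show "distinct cs" by (fact w(2))
  let ?C = "map_crossing numeral ` set cs :: nat crossing set"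
  have "map_prod dart dart ` R = \<Union>(left_turns ` ?C)"
    by (simp add: R ts_def image_UN turns_dart)
  then have "faces ?C = (\<lambda>d. (map_prod dart dart ` R)\<^sup>* `` {d}) ` {d. fst d \<in> \<Union>(set_crossing ` ?C)}"
    by (simp only: faces_def setcompr_eq_image)
  also have "{d. fst d \<in> \<Union>(set_crossing ` ?C)} = dart ` set (map fst ts)"
    using w(3) by (simp add: dg_def)
  also have "(\<lambda>d. (map_prod dart dart ` R)\<^sup>* `` {d}) ` dart ` set (map fst ts)
      = (`) dart ` {R\<^sup>* `` {d} | d. d \<in> set (map fst ts)}"
    by (simp only: rtrancl_image_inj[OF inj_dart] image_image setcompr_eq_image Collect_mem_eq)
  finally have "card (faces ?C) = card {R\<^sup>* `` {d} | d. d \<in> set (map fst ts)}"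
    by (simp add: card_image inj_dart inj_on_image inj_on_subset[OF inj_dart])
  then have faces: "card (faces ?C) = length ps" using o(5) by simp
  have "pieces ?C = (\<lambda>e. (map_prod numeral numeral ` pair_rel (set cs))\<^sup>* `` {numeral e}) ` \<Union>(set_crossing ` set cs)"
    by (auto simp: pieces_alt pair_rel_map crossing.set_map)
  also have "\<dots> = (`) numeral ` ((\<lambda>e. (pair_rel (set cs))\<^sup>* `` {e}) ` \<Union>(set_crossing ` set cs))"
    by (simp only: rtrancl_image_inj[OF inj_num] image_image)
  finally have "card (pieces ?C) = card ((\<lambda>e. (pair_rel (set cs))\<^sup>* `` {e}) ` \<Union>(set_crossing ` set cs))"
    by (simp add: card_image inj_num inj_on_image inj_on_subset[OF inj_num])
  also have "\<dots> = n" using count_pieces_sound[OF n, of "{}"] by simp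
  finally have "card (pieces ?C) = n" .
  moreover have "card ?C = length cs"
    using w(2) distinct_card by (subst card_image) (auto intro: inj_on_subset[OF inj_map_crossing[OF inj_num]])
  ultimately have "planar (dg cs us)"
    using faces l by (simp add: planar_def dg_def)
  moreover have "edges (dg cs us) \<noteq> {}"
    using us(2) by (cases cs; cases us) (auto simp: edges_def dg_def set_crossing_strands)
  ultimately show "link_diagram (dg cs us)" using w(1) by (simp add: link_diagram_def)
qed

section \<open>Reidemeister moves and crossing changes\<close>

fun pick :: "num \<Rightarrow> num crossing list \<Rightarrow> (num crossing \<times> num crossing list) option" where
  "pick e [] = None"
| "pick e (c # cs) = (if under_in c = e then Some (c, cs)
     else case pick e cs of None \<Rightarrow> None | Some (d, r) \<Rightarrow> Some (d, c # r))"

lemma pick_sound: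
  "pick e cs = Some (c, r) \<Longrightarrow> set cs = insert c (set r) \<and> (distinct cs \<longrightarrow> c \<notin> set r \<and> distinct r)"
  by (induction cs arbitrary: c r) (auto split: if_splits option.splits)

definition rename :: "num \<Rightarrow> num \<Rightarrow> num \<Rightarrow> num" where
  "rename p q x = (if x = q then p else x)"

fun join_list :: "num \<Rightarrow> num \<Rightarrow> num crossing list \<times> num list \<Rightarrow> num crossing list \<times> num list" where
  "join_list p q (cs, us) = (if p = q then (cs, p # us)
     else (map (map_crossing (rename p q)) cs, map (rename p q) us))"

definition splice_list ::
  "num \<Rightarrow> num \<Rightarrow> num \<Rightarrow> num \<Rightarrow> num crossing list \<times> num list \<Rightarrow> num crossing list \<times> num list" where
  "splice_list p q p' q' D = join_list (rename p q p') (rename p q q') (join_list p q D)"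

lemma numeral_rename: "(id(numeral q := numeral p)) (numeral x :: nat) = numeral (rename p q x)"
  by (simp add: rename_def)

lemma dg_join_list:
  "case_prod dg (join_list p q D) = join (numeral p) (numeral q) (case_prod dg D)"
proof -
  have "map_crossing (numeral :: num \<Rightarrow> nat) (map_crossing (rename p q) c) =
      map_crossing (id(numeral q := numeral p)) (map_crossing numeral c)" for c
    by (cases c) (simp_all add: rename_def)
  then show ?thesis
    by (cases D) (auto simp: dg_def join_def relabel_def image_image rename_def)
qed

lemma dg_splice_list:
  "case_prod dg (splice_list p q p' q' D) =
     splice (numeral p) (numeral q) (numeral p') (numeral q') (case_prod dg D)"
  by (simp only: splice_list_def splice_def dg_join_list numeral_rename)

text \<open>Crossings are named by their incoming under-edge. For \<open>R2\<close> they are listed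
  in the order in which the over-strand meets them; for \<open>R3\<close> the order is top over
  middle, top over bottom, middle over bottom.\<close>

datatype move = R1 num | R2 num num | R3 num num num

definition triangle_list ::
  "bool \<Rightarrow> bool \<Rightarrow> bool \<Rightarrow> bool \<Rightarrow> num \<times> num \<times> num \<Rightarrow> num \<times> num \<times> num \<Rightarrow> num \<times> num \<times> num
    \<Rightarrow> num crossing list" where
  "triangle_list tm tb mb \<epsilon> t m b =
     (let pass = (\<lambda>first (a0, a1, a2). if first then (a0, a1) else (a1, a2));
          cross = (\<lambda>s u ov. if s then Xp (fst u) (snd ov) (snd u) (fst ov) else Xm (fst u) (fst ov) (snd u) (snd ov))
      in [cross tm (pass (\<epsilon> = tb) m) (pass (\<epsilon> = mb) t),
          cross tb (pass (\<epsilon> = tm) b) (pass (\<epsilon> \<noteq> mb) t),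
          cross mb (pass (\<epsilon> \<noteq> tm) b) (pass (\<epsilon> \<noteq> tb) m)])"

lemma set_triangle_list:
  "map_crossing numeral ` set (triangle_list tm tb mb \<epsilon> (t0, t1, t2) (m0, m1, m2) (b0, b1, b2)) =
     triangle tm tb mb \<epsilon> (numeral t0, numeral t1, numeral t2) (numeral m0, numeral m1, numeral m2)
       (numeral b0, numeral b1, numeral b2)"
  unfolding triangle_list_def triangle_def Let_def crossing_of_def
  by (cases tm; cases tb; cases mb; cases \<epsilon>) simp_all

text \<open>\<open>R1\<close> and \<open>R2\<close> are used only to remove crossings. For
  \<open>R3\<close> the configuration is reconstructed: \<epsilon> follows from the sign
  \<open>mb\<close> and from whether the top strand meets \<open>c\<close> before \<open>c'\<close>,
  and then \<epsilon> with the signs fixes the order along each strand. The comparison with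
  \<open>[c, c', c'']\<close> rejects triples that do not bound such a triangle.\<close>

fun step :: "move \<Rightarrow> num crossing list \<Rightarrow> num list \<Rightarrow> (num crossing list \<times> num list) option" where
  "step (R1 e) cs us = (case pick e cs of None \<Rightarrow> None | Some (c, r) \<Rightarrow>
     if under_out c = over_in c then Some (join_list (under_in c) (over_out c) (r, us))
     else if over_out c = under_in c then Some (join_list (over_in c) (under_out c) (r, us))
     else None)"
| "step (R2 e e') cs us = (case pick e cs of None \<Rightarrow> None | Some (c, r) \<Rightarrow>
     (case pick e' r of None \<Rightarrow> None | Some (c', r') \<Rightarrow>
       if positive c \<noteq> positive c' \<and> over_out c = over_in c' then
         if under_out c = under_in c'
         then Some (splice_list (over_in c) (over_out c') (under_in c) (under_out c') (r', us))
         else if under_out c' = under_in c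
         then Some (splice_list (over_in c) (over_out c') (under_in c') (under_out c) (r', us))
         else None
       else None))"
| "step (R3 e e' e'') cs us = (case pick e cs of None \<Rightarrow> None | Some (c, r) \<Rightarrow>
     (case pick e' r of None \<Rightarrow> None | Some (c', r') \<Rightarrow>
       (case pick e'' r' of None \<Rightarrow> None | Some (c'', r'') \<Rightarrow>
         let tm = positive c; tb = positive c'; mb = positive c'';
             \<epsilon> = (mb = (over_out c = over_in c'));
             t = (if \<epsilon> = mb then (over_in c, over_out c, over_out c') else (over_in c', over_out c', over_out c));
             m = (if \<epsilon> = tb then (under_in c, under_out c, over_out c'') else (over_in c'', over_out c'', under_out c));
             b = (if \<epsilon> = tm then (under_in c', under_out c', under_out c'') else (under_in c'', under_out c'', under_out c'))
         in if triangle_list tm tb mb \<epsilon> t m b = [c, c', c'']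
            then Some (triangle_list tm tb mb (\<not> \<epsilon>) t m b @ r'', us) else None)))"

lemma dg_insert:
  "set cs = insert c (set r) \<Longrightarrow>
    dg cs us = Diagram (insert (map_crossing numeral c) (map_crossing numeral ` set r)) (numeral ` set us)"
  by (simp add: dg_def)

lemma map_num_notin: "c \<notin> set r \<Longrightarrow> (map_crossing numeral c :: nat crossing) \<notin> map_crossing numeral ` set r"
  by (simp add: inj_image_mem_iff inj_map_crossing inj_num)

text \<open>The disjunction comes from \<open>R3\<close>, whose rule leads only from the
  configuration \<open>True\<close> to \<open>False\<close>. Distinctness of the result provides the
  side conditions that the new triangle has three crossings, none of which occurs elsewhere in the
  diagram.\<close>

lemma step_sound:
  assumes "step mv cs us = Some (cs', us')" and "distinct cs" and "distinct cs'"
  shows "reidemeister (dg cs us) (dg cs' us') \<or> reidemeister (dg cs' us') (dg cs us)"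
proof (cases mv)
  case (R1 e)
  with assms(1) obtain c r where ex: "pick e cs = Some (c, r)" by (auto split: option.splits)
  note x = pick_sound[OF ex]
  then have cr: "c \<notin> set r" and dg: "dg cs us = Diagram (insert (map_crossing numeral c) (map_crossing numeral ` set r)) (numeral ` set us)"
    using assms(2) by (auto simp: dg_insert)
  consider "under_out c = over_in c" "(cs', us') = join_list (under_in c) (over_out c) (r, us)"
    | "over_out c = under_in c" "(cs', us') = join_list (over_in c) (under_out c) (r, us)"
    using assms(1) R1 ex by (auto split: if_splits)
  then show ?thesis
  proof cases
    case 1
    have "dg cs' us' = join (numeral (under_in c)) (numeral (over_out c)) (Diagram (map_crossing numeral ` set r) (numeral ` set us))"
      using dg_join_list[of "under_in c" "over_out c" "(r, us)", folded 1(2)] by (simp add: dg_def)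
    then show ?thesis unfolding dg
      using R1_under_first[OF map_num_notin[OF cr], of "numeral ` set us"] 1(1) by (simp add: entries_map)
  next
    case 2
    have "dg cs' us' = join (numeral (over_in c)) (numeral (under_out c)) (Diagram (map_crossing numeral ` set r) (numeral ` set us))"
      using dg_join_list[of "over_in c" "under_out c" "(r, us)", folded 2(2)] by (simp add: dg_def)
    then show ?thesis unfolding dg
      using R1_over_first[OF map_num_notin[OF cr], of "numeral ` set us"] 2(1) by (simp add: entries_map)
  qed
next
  case (R2 e e')
  with assms(1) obtain c r c' r' where ex: "pick e cs = Some (c, r)" "pick e' r = Some (c', r')"
    by (auto split: option.splits)
  note x = pick_sound[OF ex(1)] pick_sound[OF ex(2)]
  have cr: "c \<notin> set r'" "c' \<notin> set r'" using x assms(2) by auto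
  have dg: "dg cs us = Diagram (insert (map_crossing numeral c) (insert (map_crossing numeral c') (map_crossing numeral ` set r'))) (numeral ` set us)"
    using x by (simp add: dg_def)
  have pos: "positive c \<noteq> positive c'" "over_out c = over_in c'"
    using assms(1) R2 ex by (auto split: if_splits)
  consider "under_out c = under_in c'" "(cs', us') = splice_list (over_in c) (over_out c') (under_in c) (under_out c') (r', us)"
    | "under_out c' = under_in c" "(cs', us') = splice_list (over_in c) (over_out c') (under_in c') (under_out c) (r', us)"
    using assms(1) R2 ex by (auto split: if_splits)
  then show ?thesis
  proof cases
    case 1
    have "dg cs' us' = splice (numeral (over_in c)) (numeral (over_out c')) (numeral (under_in c)) (numeral (under_out c'))
       (Diagram (map_crossing numeral ` set r') (numeral ` set us))"
      using dg_splice_list[of "over_in c" "over_out c'" "under_in c" "under_out c'" "(r', us)", folded 1(2)] by (simp add: dg_def)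
    then show ?thesis unfolding dg
      using R2_parallel[OF map_num_notin[OF cr(1)] map_num_notin[OF cr(2)], of "numeral ` set us"] 1(1) pos by (simp add: entries_map)
  next
    case 2
    have "dg cs' us' = splice (numeral (over_in c)) (numeral (over_out c')) (numeral (under_in c')) (numeral (under_out c))
       (Diagram (map_crossing numeral ` set r') (numeral ` set us))"
      using dg_splice_list[of "over_in c" "over_out c'" "under_in c'" "under_out c" "(r', us)", folded 2(2)] by (simp add: dg_def)
    then show ?thesis unfolding dg
      using R2_antiparallel[OF map_num_notin[OF cr(1)] map_num_notin[OF cr(2)], of "numeral ` set us"] 2(1) pos by (simp add: entries_map)
  qed
next
  case (R3 e e' e'')
  with assms(1) obtain c r c' r' c'' r'' where ex: "pick e cs = Some (c, r)" "pick e' r = Some (c', r')" "pick e'' r' = Some (c'', r'')"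
    by (auto split: option.splits)
  note x = pick_sound[OF ex(1)] pick_sound[OF ex(2)] pick_sound[OF ex(3)]
  obtain tm tb mb \<epsilon> t m b where tr: "triangle_list tm tb mb \<epsilon> t m b = [c, c', c'']"
    and cs': "cs' = triangle_list tm tb mb (\<not> \<epsilon>) t m b @ r''" "us' = us"
    using assms(1) R3 ex by (auto simp: Let_def split: if_splits)
  obtain t0 t1 t2 m0 m1 m2 b0 b1 b2 where [simp]: "t = (t0, t1, t2)" "m = (m0, m1, m2)" "b = (b0, b1, b2)"
    by (metis prod_cases3)
  let ?T = "\<lambda>\<epsilon>. triangle tm tb mb \<epsilon> (numeral t0, numeral t1, numeral t2) (numeral m0, numeral m1, numeral m2)
       (numeral b0, numeral b1, numeral b2)"
  let ?L = "\<lambda>\<epsilon>. triangle_list tm tb mb \<epsilon> t m b"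
  have len: "length (?L \<epsilon>) = 3" for \<epsilon> by (simp add: triangle_list_def Let_def)
  have T: "?T \<epsilon> = map_crossing numeral ` set (?L \<epsilon>)" for \<epsilon> by (simp add: set_triangle_list)
  have d: "distinct (?L \<epsilon> @ r'')" "distinct (?L (\<not> \<epsilon>) @ r'')" using x assms(2,3) tr cs' by auto
  then have d2: "distinct (?L \<delta> @ r'')" for \<delta> by (cases "\<delta> = \<epsilon>") auto
  have inj: "inj (map_crossing (numeral :: num \<Rightarrow> nat))" by (rule inj_map_crossing[OF inj_num])
  have c3: "card (?T \<delta>) = 3" for \<delta>
    using d2[of \<delta>] distinct_card[of "?L \<delta>"] len[of \<delta>] by (simp add: T card_image inj_on_subset[OF inj])
  have disj: "?T \<delta> \<inter> map_crossing numeral ` set r'' = {}" for \<delta>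
    using d2[of \<delta>] by (simp add: T flip: image_Int[OF inj])
  have 1: "dg cs us = Diagram (?T \<epsilon> \<union> map_crossing numeral ` set r'') (numeral ` set us)"
    unfolding T tr using x by (simp add: dg_def)
  have 2: "dg cs' us' = Diagram (?T (\<not> \<epsilon>) \<union> map_crossing numeral ` set r'') (numeral ` set us)"
    unfolding T cs' by (simp add: dg_def image_Un)
  note r3 = reidemeister.R3[OF c3 disj c3 disj, of "numeral ` set us"]
  show ?thesis unfolding 1 2 using r3 by (cases \<epsilon>) auto
qed

text \<open>The crossing change in PD notation: the cyclic order of the four edges is kept and
  rotated to begin with the incoming edge of the former over-strand.\<close>

fun flip :: "'e crossing \<Rightarrow> 'e crossing" where
  "flip (Xp i j k l) = Xm l i j k"
| "flip (Xm i j k l) = Xp j k l i"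

lemma flip_simps [simp]:
  "under_in (flip c) = over_in c" "over_in (flip c) = under_in c"
  "under_out (flip c) = over_out c" "over_out (flip c) = under_out c"
  "flip (flip c) = c" "set_crossing (flip c) = set_crossing c" "positive (flip c) \<longleftrightarrow> \<not> positive c"
  by (cases c; auto)+

text \<open>Faces depend only on the underlying plane curve. This is why a changed crossing calls
  for no new test of planarity.\<close>

lemma left_turns_flip [simp]: "left_turns (flip c) = left_turns c"
  by (cases c) auto

lemma map_flip: "map_crossing f (flip c) = flip (map_crossing f c)"
  by (cases c) auto

text \<open>The under-strand of \<open>flip c\<close> is entered by the edge that enters the
  over-strand of \<open>c\<close>, and an edge enters only one passage.\<close>

lemma flip_notin:
  assumes "well_formed (Diagram (insert c C) U)" and "c \<notin> C"
  shows "flip c \<notin> C"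
proof
  assume "flip c \<in> C"
  moreover have "inj_on (\<lambda>(c, over). if over then over_in c else under_in c) (insert c C \<times> UNIV)"
    using assms(1) by (simp add: well_formed_def Let_def)
  ultimately have "(flip c, False) = (c, True)"
    by (intro inj_onD[of "\<lambda>(c, over). if over then over_in c else under_in c" "insert c C \<times> UNIV"]) auto
  then show False by simp
qed

lemma well_formed_flip:
  assumes "well_formed (Diagram (insert c C) U)" and "c \<notin> C"
  shows "well_formed (Diagram (insert (flip c) C) U)"
proof -
  \<comment> \<open>A bijection between the strand passages of the two diagrams, which exchanges
    over and under at the changed crossing and preserves the edges entered and left.\<close>
  define g where "g = (\<lambda>(d, b). if d = flip c then (c, \<not> b) else (d, b))"
  define en ex where "en = (\<lambda>(c :: nat crossing, over). if over then over_in c else under_in c)"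
    and "ex = (\<lambda>(c :: nat crossing, over). if over then over_out c else under_out c)"
  note nc = flip_notin[OF assms]
  have g: "bij_betw g (insert (flip c) C \<times> UNIV) (insert c C \<times> UNIV)"
    by (rule bij_betw_byWitness[where f' = "\<lambda>(d, b). if d = c then (flip c, \<not> b) else (d, b)"])
      (use nc assms(2) in \<open>auto simp: g_def split: if_splits\<close>)
  have eg: "en x = en (g x)" "ex x = ex (g x)" if "x \<in> insert (flip c) C \<times> UNIV" for x
    using that by (auto simp: en_def ex_def g_def)
  have w: "finite C" "finite U" "inj_on en (insert c C \<times> UNIV)" "inj_on ex (insert c C \<times> UNIV)"
    "en ` (insert c C \<times> UNIV) = ex ` (insert c C \<times> UNIV)" "\<Union>(set_crossing ` insert c C) \<inter> U = {}"
    using assms(1) by (auto simp: well_formed_def Let_def en_def ex_def)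
  have "inj_on (en \<circ> g) (insert (flip c) C \<times> UNIV)" "inj_on (ex \<circ> g) (insert (flip c) C \<times> UNIV)"
    using g w(3,4) by (auto simp: bij_betw_def intro!: comp_inj_on)
  then have "inj_on en (insert (flip c) C \<times> UNIV)" "inj_on ex (insert (flip c) C \<times> UNIV)"
    using eg by (simp_all cong: inj_on_cong)
  moreover have "en ` (insert (flip c) C \<times> UNIV) = en ` g ` (insert (flip c) C \<times> UNIV)"
    "ex ` (insert (flip c) C \<times> UNIV) = ex ` g ` (insert (flip c) C \<times> UNIV)"
    unfolding image_image using eg by (auto intro!: image_cong simp del: insert_iff)
  ultimately show ?thesis
    using w g unfolding well_formed_def Let_def en_def[symmetric] ex_def[symmetric]
    by (simp add: bij_betw_def)
qed

lemma colored_flip: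
  assumes "colored_link_diagram (Diagram (insert c C) U, \<kappa>)" and "c \<notin> C"
  shows "colored_link_diagram (Diagram (insert (flip c) C) U, \<kappa>)"
proof -
  have w: "well_formed (Diagram (insert c C) U)" and fin: "finite C"
    using assms(1) by (auto simp: colored_link_diagram_def link_diagram_def well_formed_def Let_def)
  have old: "planar (Diagram (insert c C) U)" "edges (Diagram (insert c C) U) \<noteq> {}"
    "coloration (Diagram (insert c C) U) \<kappa>"
    using assms(1) unfolding colored_link_diagram_def link_diagram_def fst_conv snd_conv by blast+
  have fa: "faces (insert (flip c) C) = faces (insert c C)" "pieces (insert (flip c) C) = pieces (insert c C)"
    by (simp_all add: faces_def pieces_def)
  have ed: "edges (Diagram (insert (flip c) C) U) = edges (Diagram (insert c C) U)"
    by (simp add: edges_def)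
  have co: "components (Diagram (insert (flip c) C) U) = components (Diagram (insert c C) U)"
  proof -
    have "(\<Union>c\<in>insert (flip c) C. {(under_in c, under_out c), (over_in c, over_out c)}) =
        (\<Union>c\<in>insert c C. {(under_in c, under_out c), (over_in c, over_out c)})"
      by auto
    then show ?thesis by (simp only: components_def diagram.sel ed)
  qed
  have ca: "card (insert (flip c) C) = card (insert c C)"
    using fin assms(2) flip_notin[OF w assms(2)] by simp
  have "planar (Diagram (insert (flip c) C) U)" "coloration (Diagram (insert (flip c) C) U) \<kappa>"
    using old(1,3) by (simp_all only: planar_def coloration_def diagram.sel fa co ca)
  then show ?thesis
    using old(2) well_formed_flip[OF w assms(2)]
    unfolding colored_link_diagram_def link_diagram_def fst_conv snd_conv ed by blast
qed

lemma colorationI: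
  assumes "\<And>c. c \<in> crossings D \<Longrightarrow> \<kappa> (under_in c) = \<kappa> (under_out c) \<and> \<kappa> (over_in c) = \<kappa> (over_out c)"
  shows "coloration D \<kappa>"
proof -
  let ?R = "\<Union>c\<in>crossings D. {(under_in c, under_out c), (over_in c, over_out c)}"
  have "\<kappa> e' = \<kappa> e" if "(e, e') \<in> ?R\<^sup>*" for e e'
    using that by (induction rule: rtrancl_induct) (use assms in auto)
  then show ?thesis by (fastforce simp: coloration_def components_def)
qed

text \<open>A colour for the edges below the first threshold, then a new colour from each threshold
  on. Since edges are numbered consecutively along the components, three intervals describe three
  colours. Moves and smoothings reuse edge names, so a palette changes only by merging.\<close>

type_synonym palette = "nat \<times> (num \<times> nat) list"

fun colour :: "palette \<Rightarrow> num \<Rightarrow> nat" where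
  "colour (a, []) e = a"
| "colour (a, (n, b) # l) e = (if e < n then a else colour (b, l) e)"

definition colouring :: "palette \<Rightarrow> nat \<Rightarrow> nat" where
  "colouring p e = colour p (num_of_nat e)"

lemma colouring_numeral [simp]: "colouring p (numeral e) = colour p e"
  by (simp add: colouring_def num_of_nat_numeral_eq)

text \<open>Once a single colour is left the thresholds are dropped; an empty list tells
  \<open>valid\<close> that the coloration is trivially constant on components.\<close>

fun merge :: "nat \<Rightarrow> nat \<Rightarrow> palette \<Rightarrow> palette" where
  "merge a b (c, l) = (let f = (\<lambda>c. if c = b then a else c)
     in if list_all (\<lambda>(n, d). f d = f c) l then (f c, []) else (f c, map (apsnd f) l))"

lemma colour_constant: "list_all (\<lambda>(n, d). d = c) l \<Longrightarrow> colour (c, l) e = c"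
  by (induction l) (auto simp: list_all_iff)

lemma colour_map: "colour (f c, map (apsnd f) l) e = f (colour (c, l) e)"
  by (induction l arbitrary: c) auto

lemma colouring_merge: "colouring (merge a b p) = merge_colors a b (colouring p)"
proof
  fix e
  obtain c l where p: "p = (c, l)" by force
  let ?f = "\<lambda>c. if c = b then a else c"
  have "colour (merge a b p) (num_of_nat e) = colour (?f c, map (apsnd ?f) l) (num_of_nat e)"
  proof (cases "list_all (\<lambda>(n, d). ?f d = ?f c) l")
    case True
    then have "list_all (\<lambda>(n, d). d = ?f c) (map (apsnd ?f) l)" by (auto simp: list_all_iff)
    from colour_constant[OF this] True show ?thesis by (simp add: p Let_def)
  qed (simp add: p Let_def)
  also have "\<dots> = ?f (colour p (num_of_nat e))" unfolding p by (rule colour_map[where f = ?f])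
  finally show "colouring (merge a b p) e = merge_colors a b (colouring p) e"
    by (simp add: colouring_def merge_colors_def)
qed

definition valid :: "num crossing list \<Rightarrow> num list \<Rightarrow> palette \<Rightarrow> bool" where
  "valid cs us p \<longleftrightarrow> check cs us \<and> (snd p = [] \<or> list_all (\<lambda>c.
     colour p (under_in c) = colour p (under_out c) \<and> colour p (over_in c) = colour p (over_out c)) cs)"

lemma valid_sound:
  assumes "valid cs us p"
  shows "colored_link_diagram (dg cs us, colouring p)" and "distinct cs"
proof -
  have "link_diagram (dg cs us)" "distinct cs"
    using link_diagram_check assms by (auto simp: valid_def)
  moreover have "coloration (dg cs us) (colouring p)"
    by (rule colorationI, cases p) (use assms in \<open>auto simp: valid_def dg_def entries_map list_all_iff\<close>)
  ultimately show "colored_link_diagram (dg cs us, colouring p)" "distinct cs"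
    by (simp_all add: colored_link_diagram_def)
qed

section \<open>Specialization of the variables\<close>

text \<open>
  Evaluation at \<open>w = t = 2\<close>, \<open>x = 1/2\<close>; \<open>has_value\<close> extends it to the fractions whose denominator does not
  vanish there. All elements that occur in the skein computations then have dyadic values.
\<close>

definition ev :: "rat poly poly poly \<Rightarrow> rat" where
  "ev p = poly (poly (poly p [:[:2:]:]) [:2:]) (1 / 2)"

definition has_value :: "Qxtw \<Rightarrow> rat \<Rightarrow> bool" where
  "has_value z r \<longleftrightarrow> (\<exists>a b. z = Fract a b \<and> ev b \<noteq> 0 \<and> r = ev a / ev b)"

lemma ev_simps: "ev (a + b) = ev a + ev b" "ev (a * b) = ev a * ev b" "ev (- a) = - ev a" "ev 0 = 0" "ev 1 = 1"
  by (simp_all add: ev_def)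

text \<open>The fractions with a denominator outside the kernel of \<open>ev\<close> form a local
  ring, on which evaluation is a homomorphism. Independence of the chosen representative is
  cross-multiplication together with multiplicativity of \<open>ev\<close>.\<close>

lemma has_value_unique:
  assumes "has_value z r" and "has_value z s"
  shows "r = s"
proof -
  obtain a b where ab: "z = Fract a b" "ev b \<noteq> 0" "r = ev a / ev b"
    using assms(1) unfolding has_value_def by blast
  obtain c d where cd: "z = Fract c d" "ev d \<noteq> 0" "s = ev c / ev d"
    using assms(2) unfolding has_value_def by blast
  note * = ab cd
  then have "b \<noteq> 0" "d \<noteq> 0" by (auto simp: ev_simps)
  with * have "a * d = c * b" by (simp add: eq_fract)
  then have "ev a * ev d = ev c * ev b" by (metis ev_simps(2))
  then show ?thesis by (simp add: *(3,6) frac_eq_eq[OF *(2) *(5)])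
qed

lemma has_value_add:
  assumes "has_value y r" and "has_value z s"
  shows "has_value (y + z) (r + s)"
proof -
  obtain a b where ab: "y = Fract a b" "ev b \<noteq> 0" "r = ev a / ev b"
    using assms(1) unfolding has_value_def by blast
  obtain c d where cd: "z = Fract c d" "ev d \<noteq> 0" "s = ev c / ev d"
    using assms(2) unfolding has_value_def by blast
  note * = ab cd
  then have "b \<noteq> 0" "d \<noteq> 0" by (auto simp: ev_simps)
  with * show ?thesis unfolding has_value_def
    by (intro exI[of _ "a * d + c * b"] exI[of _ "b * d"]) (auto simp: ev_simps field_simps)
qed

lemma has_value_mult:
  assumes "has_value y r" and "has_value z s"
  shows "has_value (y * z) (r * s)"
proof -
  obtain a b where ab: "y = Fract a b" "ev b \<noteq> 0" "r = ev a / ev b"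
    using assms(1) unfolding has_value_def by blast
  obtain c d where cd: "z = Fract c d" "ev d \<noteq> 0" "s = ev c / ev d"
    using assms(2) unfolding has_value_def by blast
  note * = ab cd
  then show ?thesis unfolding has_value_def
    by (intro exI[of _ "a * c"] exI[of _ "b * d"]) (auto simp: ev_simps)
qed

lemma has_value_uminus: "has_value z r \<Longrightarrow> has_value (- z) (- r)"
  unfolding has_value_def by (metis minus_fract minus_divide_left ev_simps(3))

lemma has_value_diff: "has_value y r \<Longrightarrow> has_value z s \<Longrightarrow> has_value (y - z) (r - s)"
  using has_value_add[OF _ has_value_uminus] by (simp add: diff_conv_add_uminus del: add_uminus_conv_diff)

lemma has_value_inverse:
  assumes "has_value z r" and "r \<noteq> 0"
  shows "has_value (inverse z) (inverse r)"
proof -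
  obtain a b where *: "z = Fract a b" "ev b \<noteq> 0" "r = ev a / ev b"
    using assms by (auto simp: has_value_def)
  with assms(2) show ?thesis unfolding has_value_def
    by (intro exI[of _ b] exI[of _ a]) auto
qed

lemma has_value_divide: "has_value y r \<Longrightarrow> has_value z s \<Longrightarrow> s \<noteq> 0 \<Longrightarrow> has_value (y / z) (r / s)"
  unfolding divide_inverse by (intro has_value_mult has_value_inverse)

lemma has_value_1: "has_value 1 1"
  unfolding has_value_def One_fract_def by (intro exI[of _ 1]) (auto simp: ev_simps)

lemma has_value_vars: "has_value var_w 2" "has_value var_t 2" "has_value var_x (1 / 2)"
  unfolding has_value_def var_w_def var_t_def var_x_def
  by (rule exI, rule exI[of _ 1], rule conjI[OF refl], simp add: ev_def)+

lemmas has_value_intros = has_value_add has_value_mult has_value_diff has_value_divide has_value_1 has_value_vars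

lemma has_value_nonzero: "has_value z r \<Longrightarrow> r \<noteq> 0 \<Longrightarrow> z \<noteq> 0"
proof
  assume "has_value z r" "r \<noteq> 0" "z = 0"
  moreover have "has_value 0 0" using has_value_diff[OF has_value_1 has_value_1] by simp
  ultimately show False using has_value_unique by blast
qed

lemma var_nonzero: "var_w \<noteq> 0" "var_t \<noteq> 0" "var_t \<noteq> 1"
proof -
  show "var_w \<noteq> 0" "var_t \<noteq> 0"
    by (rule has_value_nonzero[OF has_value_vars(1)] has_value_nonzero[OF has_value_vars(2)], simp)+
  have "var_t - 1 \<noteq> 0"
    by (rule has_value_nonzero[OF has_value_diff[OF has_value_vars(2) has_value_1]]) simp
  then show "var_t \<noteq> 1" by simp
qed

text \<open>The factor contributed by a split circle whose colour already occurs.\<close>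

definition delta :: Qxtw where
  "delta = (1 / var_w - var_t * var_w) / (var_t - 1)"

lemma skein_clear_denominators:
  fixes t w :: "'a :: field"
  assumes "1 / w * P - w * M = (1 - inverse t) * S + 1 / w * (1 - inverse t) * P'" and "w \<noteq> 0" and "t \<noteq> 0"
  shows "t * P - t * w\<^sup>2 * M = (t - 1) * w * S + (t - 1) * P'"
proof -
  have "t * P - t * w\<^sup>2 * M = t * w * (1 / w * P - w * M)"
    using assms(2) by (simp add: field_simps power2_eq_square)
  also have "\<dots> = (t - 1) * w * S + (t - 1) * P'"
    unfolding assms(1) using assms(2,3) by (simp add: field_simps)
  finally show ?thesis .
qed

section \<open>Consequences of the skein relation\<close>

locale invariant_F =
  fixes F :: "colored_diagram \<Rightarrow> Qxtw"
  assumes F: "is_invariant_F F"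
begin

lemma F_isotopic: "c_isotopic X Y \<Longrightarrow> F X = F Y"
  using F unfolding is_invariant_F_def colored_link_invariant_def by blast

lemma F_circle: "F (Diagram {} {e}, \<kappa>) = 1"
  using F by (simp add: is_invariant_F_def)

lemma F_new_circle:
  "colored_link_diagram (Diagram C U, \<kappa>) \<Longrightarrow> e \<notin> edges (Diagram C U) \<Longrightarrow>
    \<kappa> e \<notin> \<kappa> ` edges (Diagram C U) \<Longrightarrow>
    F (Diagram C (insert e U), \<kappa>) = 1 / (var_w * var_x) * F (Diagram C U, \<kappa>)"
  using F by (simp add: is_invariant_F_def)

lemma F_skein:
  assumes "Xp i j k l \<notin> C" and "colored_link_diagram (Diagram (insert (Xp i j k l) C) U, \<kappa>)"
  defines "\<kappa>' \<equiv> merge_colors (\<kappa> i) (\<kappa> l) \<kappa>"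
  shows "1 / var_w * F (Diagram (insert (Xp i j k l) C) U, \<kappa>) - var_w * F (Diagram (insert (Xm l i j k) C) U, \<kappa>)
    = (1 - inverse var_t) * F (splice i j l k (Diagram C U), \<kappa>')
      + 1 / var_w * (1 - inverse var_t) * F (Diagram (insert (Xp i j k l) C) U, \<kappa>')"
  using F assms(1,2) unfolding is_invariant_F_def Let_def \<kappa>'_def by blast

text \<open>If the two strands already have the same colour, merging changes nothing: the last term
  of the skein relation is a multiple of the first one, and collecting them leaves a relation of
  HOMFLY-PT type.\<close>

lemma F_skein_same:
  assumes "Xp i j k l \<notin> C" and "colored_link_diagram (Diagram (insert (Xp i j k l) C) U, \<kappa>)" and "\<kappa> i = \<kappa> l"
  shows "F (Diagram (insert (Xp i j k l) C) U, \<kappa>) =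
    var_t * var_w\<^sup>2 * F (Diagram (insert (Xm l i j k) C) U, \<kappa>) + (var_t - 1) * var_w * F (splice i j l k (Diagram C U), \<kappa>)"
proof -
  have m: "merge_colors (\<kappa> i) (\<kappa> l) \<kappa> = \<kappa>" using assms(3) by (auto simp: merge_colors_def)
  from skein_clear_denominators[OF F_skein[OF assms(1,2), unfolded m] var_nonzero(1,2)]
  show ?thesis by (simp add: algebra_simps)
qed

lemma coloration_merge: "coloration D \<kappa> \<Longrightarrow> coloration D (merge_colors a b \<kappa>)"
  unfolding coloration_def merge_colors_def by metis

text \<open>
  The same relation for the merged coloration, where merging has no further effect, eliminates the
  smoothing.
\<close>

lemma F_skein_merge:
  assumes "Xp i j k l \<notin> C" and "colored_link_diagram (Diagram (insert (Xp i j k l) C) U, \<kappa>)"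
  defines "\<kappa>' \<equiv> merge_colors (\<kappa> i) (\<kappa> l) \<kappa>"
  shows "F (Diagram (insert (Xp i j k l) C) U, \<kappa>) - F (Diagram (insert (Xp i j k l) C) U, \<kappa>') =
    var_w\<^sup>2 * (F (Diagram (insert (Xm l i j k) C) U, \<kappa>) - F (Diagram (insert (Xm l i j k) C) U, \<kappa>'))"
proof -
  have \<kappa>': "\<kappa>' i = \<kappa>' l" by (simp add: \<kappa>'_def merge_colors_def)
  have "colored_link_diagram (Diagram (insert (Xp i j k l) C) U, \<kappa>')"
    using assms(2) coloration_merge by (simp add: colored_link_diagram_def \<kappa>'_def)
  note 2 = F_skein_same[OF assms(1) this \<kappa>']
  from 2 have "(var_t - 1) * var_w * F (splice i j l k (Diagram C U), \<kappa>') =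
      F (Diagram (insert (Xp i j k l) C) U, \<kappa>') - var_t * var_w\<^sup>2 * F (Diagram (insert (Xm l i j k) C) U, \<kappa>')"
    by (metis add_diff_cancel_left')
  with skein_clear_denominators[OF F_skein[OF assms(1,2), folded \<kappa>'_def] var_nonzero(1,2)]
  have "var_t * (F (Diagram (insert (Xp i j k l) C) U, \<kappa>) - F (Diagram (insert (Xp i j k l) C) U, \<kappa>')) =
    var_t * (var_w\<^sup>2 * (F (Diagram (insert (Xm l i j k) C) U, \<kappa>) - F (Diagram (insert (Xm l i j k) C) U, \<kappa>')))"
    by (simp add: algebra_simps)
  then show ?thesis using var_nonzero(2) by simp
qed

lemma F_recolor:
  "colored_link_diagram (D, \<kappa>) \<Longrightarrow> colored_link_diagram (D, \<kappa>') \<Longrightarrow> equivalent_colorations D \<kappa> \<kappa>' \<Longrightarrow>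
    F (D, \<kappa>) = F (D, \<kappa>')"
  by (intro F_isotopic recolor)

text \<open>Both mergings induce the same partition of the edges, so it does not matter which of the
  two colours lies on the under-strand.\<close>

lemma F_merge_commute:
  assumes "colored_link_diagram (D, \<kappa>)"
  shows "F (D, merge_colors a b \<kappa>) = F (D, merge_colors b a \<kappa>)"
  by (rule F_recolor)
    (use assms coloration_merge in \<open>auto simp: colored_link_diagram_def equivalent_colorations_def merge_colors_def\<close>)

text \<open>At a negative crossing the relation is applied to \<open>flip c\<close>, which is
  positive, and solved in the other direction; this inverts the factor.\<close>

lemma F_flip_merge:
  assumes "c \<notin> C" and D: "colored_link_diagram (Diagram (insert c C) U, \<kappa>)"
    and "{\<kappa> (under_in c), \<kappa> (over_in c)} = {a, b}"
  defines "\<kappa>' \<equiv> merge_colors a b \<kappa>"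
  shows "F (Diagram (insert c C) U, \<kappa>) - F (Diagram (insert c C) U, \<kappa>') =
    (if positive c then var_w\<^sup>2 else 1 / var_w\<^sup>2) *
      (F (Diagram (insert (flip c) C) U, \<kappa>) - F (Diagram (insert (flip c) C) U, \<kappa>'))"
proof -
  have w: "well_formed (Diagram (insert c C) U)"
    using D by (simp add: colored_link_diagram_def link_diagram_def)
  have fc: "flip c \<notin> C" by (rule flip_notin[OF w assms(1)])
  note Df = colored_flip[OF D assms(1)]
  have ab: "F (X, merge_colors (\<kappa> i) (\<kappa> l) \<kappa>) = F (X, \<kappa>')"
    if "colored_link_diagram (X, \<kappa>)" "{\<kappa> i, \<kappa> l} = {a, b}" for X i l
  proof -
    have "\<kappa> i = a \<and> \<kappa> l = b \<or> \<kappa> i = b \<and> \<kappa> l = a" using that(2) by (simp add: doubleton_eq_iff)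
    then show ?thesis using F_merge_commute[OF that(1)] by (auto simp: \<kappa>'_def)
  qed
  show ?thesis
  proof (cases c)
    case (Xp i j k l)
    with assms(3) have "{\<kappa> i, \<kappa> l} = {a, b}" by simp
    from F_skein_merge[OF assms(1)[unfolded Xp] D[unfolded Xp]]
      ab[OF D this] ab[OF Df this] show ?thesis by (simp add: Xp)
  next
    case (Xm i j k l)
    with assms(3) have "{\<kappa> j, \<kappa> i} = {a, b}" by (simp add: insert_commute)
    from F_skein_merge[OF fc[unfolded Xm flip.simps] Df[unfolded Xm flip.simps]]
      ab[OF D this] ab[OF Df this] show ?thesis using var_nonzero(1) by (simp add: Xm)
  qed
qed

text \<open>In the negative case the relation is that of \<open>flip c\<close>. Its under-strand is
  the over-strand of \<open>c\<close>, which explains the exchanged arguments of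
  \<open>splice\<close>.\<close>

lemma F_flip_same:
  assumes "c \<notin> C" and D: "colored_link_diagram (Diagram (insert c C) U, \<kappa>)"
    and "\<kappa> (under_in c) = \<kappa> (over_in c)"
  shows "F (Diagram (insert c C) U, \<kappa>) = (if positive c
    then var_t * var_w\<^sup>2 * F (Diagram (insert (flip c) C) U, \<kappa>) +
      (var_t - 1) * var_w * F (splice (under_in c) (over_out c) (over_in c) (under_out c) (Diagram C U), \<kappa>)
    else (F (Diagram (insert (flip c) C) U, \<kappa>) -
      (var_t - 1) * var_w * F (splice (over_in c) (under_out c) (under_in c) (over_out c) (Diagram C U), \<kappa>)) /
      (var_t * var_w\<^sup>2))"
proof -
  have w: "well_formed (Diagram (insert c C) U)"
    using D by (simp add: colored_link_diagram_def link_diagram_def)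
  have fc: "flip c \<notin> C" by (rule flip_notin[OF w assms(1)])
  note Df = colored_flip[OF D assms(1)]
  show ?thesis
  proof (cases c)
    case (Xp i j k l)
    then show ?thesis
      using F_skein_same[of i j k l C U \<kappa>] assms(1,3) D by simp
  next
    case (Xm i j k l)
    then show ?thesis
      using F_skein_same[of j k l i C U \<kappa>] fc assms(3) Df var_nonzero by simp
  qed
qed

section \<open>Values on unlinks\<close>

lemma colored_circles:
  assumes "finite U" and "U \<noteq> {}"
  shows "colored_link_diagram (Diagram {} U, \<kappa>)"
proof -
  have "coloration (Diagram {} U) \<kappa>" by (rule colorationI) simp
  moreover have "planar (Diagram {} U)" by (simp add: planar_def faces_def pieces_def)
  ultimately show ?thesis
    using assms by (simp add: colored_link_diagram_def link_diagram_def well_formed_def edges_def)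
qed

text \<open>The figure-eight curve: one crossing, two edges \<open>e\<close> and \<open>f\<close>,
  and three faces, namely two loops and the outside.\<close>

lemma colored_kink:
  assumes "finite U" and "e \<noteq> f" and "e \<notin> U" and "f \<notin> U" and "\<kappa> e = \<kappa> f"
  shows "colored_link_diagram (Diagram {Xp f f e e} U, \<kappa>)"
proof -
  let ?R = "{((f, True), (e, False)), ((f, False), (f, False)), ((e, False), (f, True)), ((e, True), (e, True))}"
  have R: "\<Union>(left_turns ` {Xp f f e e}) = ?R" by simp
  have "{d. fst d \<in> \<Union>(set_crossing ` {Xp f f e e})} = {(f, True), (e, False), (f, False), (e, True)}"
  proof (rule set_eqI)
    fix d :: "nat \<times> bool"
    obtain n b where "d = (n, b)" by force
    then show "d \<in> {d. fst d \<in> \<Union>(set_crossing ` {Xp f f e e})} \<longleftrightarrow> d \<in> {(f, True), (e, False), (f, False), (e, True)}"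
      by (cases b) auto
  qed
  moreover have "?R\<^sup>* `` {(f, True)} = {(f, True), (e, False)}" "?R\<^sup>* `` {(e, False)} = {(f, True), (e, False)}"
    "?R\<^sup>* `` {(f, False)} = {(f, False)}" "?R\<^sup>* `` {(e, True)} = {(e, True)}"
    by (rule rtrancl_Image_eqI; use assms(2) in auto)+
  ultimately have "faces {Xp f f e e} = {{(f, True), (e, False)}, {(f, False)}, {(e, True)}}"
    unfolding faces_def R setcompr_eq_image by (simp add: insert_commute)
  then have "card (faces {Xp f f e e}) = 3" by simp
  moreover have "card (pieces {Xp f f e e}) = 1"
  proof -
    have "({f, e} \<times> {f, e})\<^sup>* `` {x} = {f, e}" if "x \<in> {f, e}" for x
      by (rule rtrancl_Image_eqI) (use that in auto)
    then have "pieces {Xp f f e e} = {{f, e}}"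
      by (auto simp: pieces_def)
    then show ?thesis by simp
  qed
  ultimately have "planar (Diagram {Xp f f e e} U)" by (simp add: planar_def)
  moreover have "well_formed (Diagram {Xp f f e e} U)"
    using assms by (auto simp: well_formed_def Let_def inj_on_def UNIV_bool)
  moreover have "coloration (Diagram {Xp f f e e} U) \<kappa>"
    by (rule colorationI) (use assms in auto)
  ultimately show ?thesis by (simp add: colored_link_diagram_def link_diagram_def edges_def)
qed

text \<open>A figure-eight diagram is unknotted for either sign of its crossing, and its smoothing
  consists of two circles. The relation for equal colours thus contains only the values with and
  without the circle \<open>e\<close>; solved for the former it produces
  \<open>delta\<close>.\<close>

lemma F_unlink_same:
  assumes "finite U" and "e \<notin> U" and "\<kappa> e \<in> \<kappa> ` U"
  shows "F (Diagram {} (insert e U), \<kappa>) = delta * F (Diagram {} U, \<kappa>)"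
proof -
  \<comment> \<open>The circle \<open>f\<close> has the colour of \<open>e\<close> and is the one
    that receives the kink.\<close>
  obtain f where f: "f \<in> U" "\<kappa> e = \<kappa> f" using assms(3) by auto
  define V where "V = U - {f}"
  have U: "U = insert f V" "f \<notin> V" "e \<notin> V" "e \<noteq> f" "finite V" using f assms by (auto simp: V_def)
  have D: "colored_link_diagram (Diagram {Xp f f e e} V, \<kappa>)"
    by (rule colored_kink) (use U f in auto)
  have Dm: "colored_link_diagram (Diagram {Xm e f f e} V, \<kappa>)"
    using colored_flip[OF D] by simp
  have DU: "colored_link_diagram (Diagram {} U, \<kappa>)"
    by (rule colored_circles) (use assms in auto)
  have "F (Diagram {Xp f f e e} V, \<kappa>) = F (Diagram {} U, \<kappa>)"
    by (rule F_isotopic, rule c_isotopic.reidemeister[OF D DU])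
      (use R1_under_first[of "Xp f f e e" "{}" V] in \<open>simp add: join_def U\<close>)
  moreover have "F (Diagram {Xm e f f e} V, \<kappa>) = F (Diagram {} U, \<kappa>)"
    by (rule F_isotopic, rule c_isotopic.reidemeister[OF Dm DU])
      (use R1_over_first[of "Xm e f f e" "{}" V] in \<open>simp add: join_def U\<close>)
  moreover have "splice f f e e (Diagram {} V) = Diagram {} (insert e U)"
    by (simp add: splice_def join_def U)
  ultimately have *: "F (Diagram {} U, \<kappa>) = var_t * var_w\<^sup>2 * F (Diagram {} U, \<kappa>) + (var_t - 1) * var_w * F (Diagram {} (insert e U), \<kappa>)"
    using F_skein_same[of f f e e "{}" V \<kappa>] D f by simp
  have "S = (1 / w - t * w) / (t - 1) * P"
    if "P = t * w\<^sup>2 * P + (t - 1) * w * S" "w \<noteq> 0" "t \<noteq> 1" for P S w t :: Qxtw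
  proof -
    have "(t - 1) * w * S = (1 - t * w\<^sup>2) * P" using that(1) by (simp add: algebra_simps)
    then have "S = (1 - t * w\<^sup>2) * P / ((t - 1) * w)" using that(2,3) by (simp add: field_simps)
    also have "\<dots> = (1 / w - t * w) / (t - 1) * P" using that(2,3) by (simp add: divide_simps power2_eq_square)
    finally show ?thesis .
  qed
  from this[OF * var_nonzero(1,3)] show ?thesis by (simp add: delta_def)
qed

lemma F_unlink_new:
  assumes "finite U" and "U \<noteq> {}" and "e \<notin> U" and "\<kappa> e \<notin> \<kappa> ` U"
  shows "F (Diagram {} (insert e U), \<kappa>) = 1 / (var_w * var_x) * F (Diagram {} U, \<kappa>)"
  by (rule F_new_circle) (use assms colored_circles in \<open>auto simp: edges_def\<close>)

end

section \<open>Certificates\<close>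

text \<open>
  A tree is a certificate for the computation of \<open>F\<close>: \<open>Skein\<close> resolves a crossing between strands of
  equal colour, with subtrees for the changed crossing and the smoothing, and \<open>Separate a b es\<close> changes
  crossings between the colours \<open>a\<close> and \<open>b\<close>, with subtrees for the changed diagram, the original diagram
  with merged colours, and the changed diagram with merged colours. Crossings are identified by
  their incoming under-edge.
\<close>

datatype tree =
    Unlink
  | Move move tree
  | Skein num tree tree
  | Separate nat nat "num list" tree tree tree

text \<open>Fractions are never reduced, so that addition needs only a shift by a power of two and
  no greatest common divisor.\<close>

type_synonym dyadic = "int \<times> nat"

definition dyadic :: "dyadic \<Rightarrow> rat" where
  "dyadic v = of_int (fst v) / 2 ^ snd v"

fun dyadic_add :: "dyadic \<Rightarrow> dyadic \<Rightarrow> dyadic" where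
  "dyadic_add (m, d) (n, e) =
     (if d \<le> e then (m * 2 ^ (e - d) + n, e) else (m + n * 2 ^ (d - e), d))"

fun dyadic_scale :: "int \<Rightarrow> nat \<Rightarrow> dyadic \<Rightarrow> dyadic" where
  "dyadic_scale k d (m, e) = (k * m, d + e)"

lemma dyadic_add: "dyadic (dyadic_add v v') = dyadic v + dyadic v'"
proof -
  have "(2 :: rat) ^ d = 2 ^ e * 2 ^ (d - e)" if "e \<le> d" for d e
    using that by (simp flip: power_add)
  note pow = this
  obtain m d n e where v: "v = (m, d)" "v' = (n, e)" by (cases v; cases v')
  show ?thesis
  proof (cases "d \<le> e")
    case True
    then show ?thesis using pow[OF True] by (simp add: v dyadic_def add_divide_distrib)
  next
    case False
    then have "e \<le> d" by simp
    then show ?thesis using pow[of e d] False by (simp add: v dyadic_def add_divide_distrib)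
  qed
qed

lemma dyadic_scale: "dyadic (dyadic_scale k d v) = of_int k / 2 ^ d * dyadic v"
  by (cases v) (simp add: dyadic_def power_add)

text \<open>At the chosen point \<open>delta\<close> is \<open>-7/2\<close> and \<open>1/(w x)\<close> is \<open>1 = 2/2\<close>.\<close>

fun unlink_value :: "palette \<Rightarrow> num list \<Rightarrow> dyadic option" where
  "unlink_value p [] = None"
| "unlink_value p (u # us) = (if us = [] then Some (1, 0)
     else if list_ex ((=) u) us then None
     else map_option (dyadic_scale (if list_ex (\<lambda>v. colour p v = colour p u) us then -7 else 2) 1)
       (unlink_value p us))"

text \<open>Names are looked up one after the other in the diagram already changed, where a changed
  crossing is known by its former incoming over-edge. The booleans record the signs before the
  change, which decide between the factors \<open>w^2\<close> and \<open>w^(-2)\<close>.\<close>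

fun separate :: "palette \<Rightarrow> nat \<Rightarrow> nat \<Rightarrow> num list \<Rightarrow> num crossing list \<Rightarrow> (num crossing list \<times> bool list) option" where
  "separate p a b [] cs = Some (cs, [])"
| "separate p a b (e # es) cs = (case pick e cs of None \<Rightarrow> None | Some (c, r) \<Rightarrow>
     let i = colour p (under_in c); j = colour p (over_in c)
     in if i = a \<and> j = b \<or> i = b \<and> j = a
     then (case separate p a b es (flip c # r) of None \<Rightarrow> None
       | Some (cs', ss) \<Rightarrow> Some (cs', positive c # ss))
     else None)"

text \<open>The factors \<open>4\<close> and \<open>1/4\<close> are \<open>w^2\<close> and
  \<open>w^(-2)\<close> at \<open>w = 2\<close>.\<close>

definition weight :: "bool list \<Rightarrow> dyadic \<Rightarrow> dyadic" where
  "weight ss = fold (\<lambda>s. if s then dyadic_scale 4 0 else dyadic_scale 1 2) ss"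

fun smoothing :: "num crossing \<Rightarrow> num crossing list \<times> num list \<Rightarrow> num crossing list \<times> num list" where
  "smoothing c D = (if positive c then splice_list (under_in c) (over_out c) (over_in c) (under_out c) D
     else splice_list (over_in c) (under_out c) (under_in c) (over_out c) D)"

text \<open>The constants are the coefficients of the relation for equal colours at the chosen
  point: \<open>8 = t w^2\<close> and \<open>2 = (t - 1) w\<close>. In the case
  \<open>Separate\<close> the difference of the values for \<open>p\<close> and for the merged
  palette is transported from the changed diagram, and the merged value of the original diagram is
  added back.\<close>

fun eval :: "tree \<Rightarrow> num crossing list \<Rightarrow> num list \<Rightarrow> palette \<Rightarrow> dyadic option" where
  "eval Unlink cs us p = (if cs = [] then unlink_value p us else None)"
| "eval (Move m t) cs us p = (case step m cs us of None \<Rightarrow> None | Some (cs', us') \<Rightarrow>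
     if valid cs' us' p then eval t cs' us' p else None)"
| "eval (Skein e t t') cs us p = (case pick e cs of None \<Rightarrow> None | Some (c, r) \<Rightarrow>
     if colour p (under_in c) = colour p (over_in c)
     then (case smoothing c (r, us) of (cs', us') \<Rightarrow>
       if valid cs' us' p
       then (case eval t (flip c # r) us p of None \<Rightarrow> None | Some v \<Rightarrow>
         (case eval t' cs' us' p of None \<Rightarrow> None | Some v' \<Rightarrow>
           Some (if positive c then dyadic_add (dyadic_scale 8 0 v) (dyadic_scale 2 0 v')
             else dyadic_scale 1 3 (dyadic_add v (dyadic_scale (-2) 0 v')))))
       else None)
     else None)"
| "eval (Separate a b es t t' t'') cs us p = (case separate p a b es cs of None \<Rightarrow> None | Some (cs', ss) \<Rightarrow>
     let q = merge a b p
     in (case eval t cs' us p of None \<Rightarrow> None | Some v \<Rightarrow>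
       (case eval t' cs us q of None \<Rightarrow> None | Some v' \<Rightarrow>
         (case eval t'' cs' us q of None \<Rightarrow> None | Some v'' \<Rightarrow>
           Some (dyadic_add (weight ss (dyadic_add v (dyadic_scale (-1) 0 v''))) v')))))"

context invariant_F
begin

lemma has_value_delta: "has_value delta (-7 / 2)"
proof -
  have "has_value delta ((1 / 2 - 2 * 2) / (2 - 1))"
    unfolding delta_def by (intro has_value_intros) simp_all
  then show ?thesis by simp
qed

lemma has_value_new: "has_value (1 / (var_w * var_x)) 1"
proof -
  have "has_value (1 / (var_w * var_x)) (1 / (2 * (1 / 2)))"
    by (intro has_value_intros) simp_all
  then show ?thesis by simp
qed

lemma unlink_value_sound:
  "unlink_value p us = Some v \<Longrightarrow> has_value (F (dg [] us, colouring p)) (dyadic v)"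
proof (induction us arbitrary: v)
  case Nil
  then show ?case by simp
next
  case (Cons u us)
  show ?case
  proof (cases "us = []")
    case True
    then show ?thesis using Cons.prems has_value_1 by (auto simp: dg_def F_circle dyadic_def)
  next
    case False
    let ?U = "numeral ` set us :: nat set" and ?same = "list_ex (\<lambda>v. colour p v = colour p u) us"
    from False Cons.prems obtain v' where u: "u \<notin> set us" and v': "unlink_value p us = Some v'"
      and v: "v = dyadic_scale (if ?same then -7 else 2) 1 v'"
      by (auto simp: list_ex_iff split: if_splits)
    have U: "finite ?U" "?U \<noteq> {}" "numeral u \<notin> ?U" using False u by auto
    have same: "?same \<longleftrightarrow> colouring p (numeral u) \<in> colouring p ` ?U"
      by (auto simp: list_ex_iff image_iff) metis
    note IH = Cons.IH[OF v']
    have dg: "dg [] (u # us) = Diagram {} (insert (numeral u) ?U)" "dg [] us = Diagram {} ?U" by (simp_all add: dg_def)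
    show ?thesis
    proof (cases ?same)
      case True
      then have "F (dg [] (u # us), colouring p) = delta * F (dg [] us, colouring p)"
        unfolding dg using same by (intro F_unlink_same U) simp
      then show ?thesis using has_value_mult[OF has_value_delta IH] True v by (simp add: dyadic_scale)
    next
      case F: False
      then have "F (dg [] (u # us), colouring p) = 1 / (var_w * var_x) * F (dg [] us, colouring p)"
        unfolding dg using same by (intro F_unlink_new U) simp
      then show ?thesis using has_value_mult[OF has_value_new IH] F v by (simp add: dyadic_scale)
    qed
  qed
qed

lemma pick_dg:
  assumes "pick e cs = Some (c, r)" and "distinct cs" and "colored_link_diagram (dg cs us, \<kappa>)"
  defines "C \<equiv> map_crossing numeral ` set r" and "d \<equiv> map_crossing numeral c :: nat crossing"
  shows "dg cs us = Diagram (insert d C) (numeral ` set us)" and "d \<notin> C"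
    and "dg (flip c # r) us = Diagram (insert (flip d) C) (numeral ` set us)"
    and "distinct (flip c # r)" and "colored_link_diagram (dg (flip c # r) us, \<kappa>)"
proof -
  have x: "set cs = insert c (set r)" "c \<notin> set r" "distinct r"
    using pick_sound[OF assms(1)] assms(2) by auto
  show 1: "dg cs us = Diagram (insert d C) (numeral ` set us)" using x by (simp add: dg_def C_def d_def)
  show 2: "d \<notin> C" unfolding C_def d_def by (rule map_num_notin[OF x(2)])
  show 3: "dg (flip c # r) us = Diagram (insert (flip d) C) (numeral ` set us)"
    by (simp add: dg_def C_def d_def map_flip)
  show "colored_link_diagram (dg (flip c # r) us, \<kappa>)"
    unfolding 3 by (rule colored_flip[OF assms(3)[unfolded 1] 2])
  have "flip d \<notin> C"
    by (rule flip_notin[OF _ 2, of "numeral ` set us"]) (use assms(3) in \<open>simp add: 1 colored_link_diagram_def link_diagram_def\<close>)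
  then have "flip c \<notin> set r" 
    using imageI[of "flip c" "set r" "map_crossing numeral"] by (auto simp: C_def d_def map_flip)
  then show "distinct (flip c # r)" using x by simp
qed

text \<open>The colours \<open>a\<close>, \<open>b\<close> and the palette are the same for all
  changes in the list, so the differences between original and merged coloration telescope: a whole
  batch of crossing changes leaves only three values to be computed.\<close>

lemma separate_sound:
  assumes "separate p a b es cs = Some (cs', ss)" and "distinct cs"
    and "colored_link_diagram (dg cs us, colouring p)"
  shows "distinct cs' \<and> colored_link_diagram (dg cs' us, colouring p) \<and>
    F (dg cs us, colouring p) - F (dg cs us, colouring (merge a b p)) =
    prod_list (map (\<lambda>s. if s then var_w\<^sup>2 else 1 / var_w\<^sup>2) ss) *
      (F (dg cs' us, colouring p) - F (dg cs' us, colouring (merge a b p)))"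
  using assms
proof (induction es arbitrary: cs ss)
  case Nil
  then show ?case by simp
next
  case (Cons e es)
  obtain c r where cr: "pick e cs = Some (c, r)" using Cons.prems(1) by (auto split: option.splits)
  then obtain ss' where s: "separate p a b es (flip c # r) = Some (cs', ss')" "ss = positive c # ss'"
    and ab: "{colour p (under_in c), colour p (over_in c)} = {a, b}"
    using Cons.prems(1) by (auto simp: Let_def split: option.splits if_splits)
  note pd = pick_dg[OF cr Cons.prems(2,3)]
  note IH = Cons.IH[OF s(1) pd(4,5)]
  have "F (dg cs us, colouring p) - F (dg cs us, colouring (merge a b p)) =
      (if positive c then var_w\<^sup>2 else 1 / var_w\<^sup>2) *
      (F (dg (flip c # r) us, colouring p) - F (dg (flip c # r) us, colouring (merge a b p)))"
    unfolding pd(1,3) colouring_merge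
    by (subst F_flip_merge[where a = a and b = b, OF pd(2) Cons.prems(3)[unfolded pd(1)]])
      (use ab in \<open>simp_all add: entries_map\<close>)
  then show ?case using IH s(2) by (simp add: mult.assoc)
qed

lemma weight_sound:
  "has_value z (dyadic v) \<Longrightarrow>
    has_value (prod_list (map (\<lambda>s. if s then var_w\<^sup>2 else 1 / var_w\<^sup>2) ss) * z) (dyadic (weight ss v))"
proof (induction ss arbitrary: z v)
  case Nil
  then show ?case by (simp add: weight_def)
next
  case (Cons s ss)
  let ?x = "if s then var_w\<^sup>2 else 1 / var_w\<^sup>2"
  have "has_value ((var_w * var_w) * z) (2 * 2 * dyadic v)" "has_value (1 / (var_w * var_w) * z) (1 / (2 * 2) * dyadic v)"
    by (intro has_value_intros Cons.prems; simp)+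
  then have "has_value (?x * z) (dyadic ((if s then dyadic_scale 4 0 else dyadic_scale 1 2) v))"
    by (auto simp: dyadic_scale power2_eq_square)
  from Cons.IH[OF this] show ?case by (simp add: weight_def mult_ac)
qed

theorem eval_sound:
  "eval T cs us p = Some v \<Longrightarrow> distinct cs \<Longrightarrow> colored_link_diagram (dg cs us, colouring p) \<Longrightarrow>
    has_value (F (dg cs us, colouring p)) (dyadic v)"
proof (induction T cs us p arbitrary: v rule: eval.induct)
  case (1 cs us p)
  then show ?case using unlink_value_sound by (simp split: if_splits)
next
  case (2 m t cs us p)
  then obtain cs' us' where s: "step m cs us = Some (cs', us')" and v: "valid cs' us' p" and e: "eval t cs' us' p = Some v"
    by (auto split: option.splits if_splits)
  note vs = valid_sound[OF v]
  \<comment> \<open>The move may be a Reidemeister rule read backwards, hence the symmetry of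
    c-isotopy.\<close>
  have "F (dg cs us, colouring p) = F (dg cs' us', colouring p)"
    using step_sound[OF s "2.prems"(2) vs(2)] "2.prems"(3) vs(1)
    by (auto intro: F_isotopic c_isotopic.reidemeister c_isotopic.sym)
  then show ?case using "2.IH"[OF s refl v e vs(2,1)] by simp
next
  case (3 e t t' cs us p)
  then obtain c r cs' us' where cr: "pick e cs = Some (c, r)" and col: "colour p (under_in c) = colour p (over_in c)"
    and sm: "smoothing c (r, us) = (cs', us')" and v: "valid cs' us' p"
    by (auto split: option.splits if_splits prod.splits)
  with "3.prems"(1) obtain w w' where w: "eval t (flip c # r) us p = Some w" and w': "eval t' cs' us' p = Some w'"
    and vw: "v = (if positive c then dyadic_add (dyadic_scale 8 0 w) (dyadic_scale 2 0 w')
             else dyadic_scale 1 3 (dyadic_add w (dyadic_scale (-2) 0 w')))"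
    by (auto split: option.splits)
  note pd = pick_dg[OF cr "3.prems"(2,3)]
  note vs = valid_sound[OF v]
  have h: "has_value (F (dg (flip c # r) us, colouring p)) (dyadic w)"
    by (rule "3.IH"(1)[OF cr refl col sm[symmetric] v w pd(4,5)])
  have h': "has_value (F (dg cs' us', colouring p)) (dyadic w')"
    by (rule "3.IH"(2)[OF cr refl col sm[symmetric] v w w' vs(2,1)])
  let ?C = "map_crossing numeral ` set r" and ?d = "map_crossing numeral c :: nat crossing" and ?U = "numeral ` set us"
  have sp: "dg cs' us' = (if positive c then splice (under_in ?d) (over_out ?d) (over_in ?d) (under_out ?d) (Diagram ?C ?U)
    else splice (over_in ?d) (under_out ?d) (under_in ?d) (over_out ?d) (Diagram ?C ?U))"
    using dg_splice_list[of "under_in c" "over_out c" "over_in c" "under_out c" "(r, us)"]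
      dg_splice_list[of "over_in c" "under_out c" "under_in c" "over_out c" "(r, us)"] sm
    by (auto simp: dg_def[of r us] entries_map split: if_splits)
  have F: "F (dg cs us, colouring p) = (if positive c
    then var_t * var_w\<^sup>2 * F (dg (flip c # r) us, colouring p) + (var_t - 1) * var_w * F (dg cs' us', colouring p)
    else (F (dg (flip c # r) us, colouring p) - (var_t - 1) * var_w * F (dg cs' us', colouring p)) / (var_t * var_w\<^sup>2))"
    unfolding pd(1,3) sp
    by (subst F_flip_same[OF pd(2) "3.prems"(3)[unfolded pd(1)]])
      (use col in \<open>simp_all add: entries_map\<close>)
  show ?case
  proof (cases "positive c")
    case True
    have "has_value (F (dg cs us, colouring p)) (2 * (2 * 2) * dyadic w + (2 - 1) * 2 * dyadic w')"
      unfolding F if_P[OF True] power2_eq_square by (intro has_value_intros h h')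
    then show ?thesis using True by (simp add: vw dyadic_add dyadic_scale)
  next
    case False
    have "has_value (F (dg cs us, colouring p)) ((dyadic w - (2 - 1) * 2 * dyadic w') / (2 * (2 * 2)))"
      unfolding F if_not_P[OF False] power2_eq_square by (intro has_value_intros h h') simp
    then show ?thesis using False by (simp add: vw dyadic_add dyadic_scale)
  qed
next
  case (4 a b es t t' t'' cs us p)
  then obtain cs' ss where s: "separate p a b es cs = Some (cs', ss)" by (auto split: option.splits)
  let ?q = "merge a b p"
  from "4.prems"(1) s obtain w w' w'' where w: "eval t cs' us p = Some w" "eval t' cs us ?q = Some w'" "eval t'' cs' us ?q = Some w''"
    and v: "v = dyadic_add (weight ss (dyadic_add w (dyadic_scale (-1) 0 w''))) w'"
    by (auto simp: Let_def split: option.splits)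
  note ss = separate_sound[OF s "4.prems"(2,3)]
  have m: "colored_link_diagram (X, colouring ?q)" if "colored_link_diagram (X, colouring p)" for X
    using that coloration_merge by (simp add: colored_link_diagram_def colouring_merge)
  have h: "has_value (F (dg cs' us, colouring p)) (dyadic w)"
    by (rule "4.IH"(1)[OF s refl refl w(1)]) (use ss in auto)
  have h': "has_value (F (dg cs us, colouring ?q)) (dyadic w')"
    by (rule "4.IH"(2)[OF s refl refl w(1,2)]) (use "4.prems"(2,3) m in auto)
  have h'': "has_value (F (dg cs' us, colouring ?q)) (dyadic w'')"
    by (rule "4.IH"(3)[OF s refl refl w]) (use ss m in auto)
  have "has_value (F (dg cs' us, colouring p) - F (dg cs' us, colouring ?q)) (dyadic (dyadic_add w (dyadic_scale (-1) 0 w'')))"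
    using has_value_diff[OF h h''] by (simp add: dyadic_add dyadic_scale)
  from has_value_add[OF weight_sound[OF this, of ss] h'] ss show ?case
    by (simp add: v dyadic_add diff_eq_eq)
qed

end

section \<open>Components, and colorations of type (1,1,1)\<close>

definition components_coloured :: "num crossing list \<Rightarrow> palette \<Rightarrow> bool" where
  "components_coloured cs p \<longleftrightarrow>
    (let ss = concat (map (\<lambda>c. [(under_in c, under_out c), (over_in c, over_out c)]) cs)
     in case build ss Leaf of None \<Rightarrow> False
      | Some T \<Rightarrow> (case orbits ss T Leaf (map fst ss) of None \<Rightarrow> False
        | Some ps \<Rightarrow> length ps = 3 \<and> distinct (map (\<lambda>q. colour p (hd q)) ps) \<and>
            list_all (\<lambda>q. list_all (\<lambda>e. colour p e = colour p (hd q)) q) ps))"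

text \<open>Components are the cycles of the map from the incoming to the outgoing edge of each
  strand, traced by the procedure that also traces the faces. One colour per cycle, with different
  colours on different cycles, says that the palette realizes the finest partition.\<close>

lemma components_coloured_sound:
  assumes "components_coloured cs p" and "link_diagram (dg cs [])"
  shows "card (components (dg cs [])) = 3"
    and "\<And>K K' e e'. K \<in> components (dg cs []) \<Longrightarrow> K' \<in> components (dg cs []) \<Longrightarrow> e \<in> K \<Longrightarrow> e' \<in> K' \<Longrightarrow>
      colouring p e = colouring p e' \<longleftrightarrow> K = K'"
proof -
  define ss where "ss = concat (map (\<lambda>c. [(under_in c, under_out c), (over_in c, over_out c)]) cs)"
  obtain T ps where T: "build ss Leaf = Some T" and ps: "orbits ss T Leaf (map fst ss) = Some ps"
    and c: "length ps = 3" "distinct (map (\<lambda>q. colour p (hd q)) ps)"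
      "\<And>q e. q \<in> set ps \<Longrightarrow> e \<in> set q \<Longrightarrow> colour p e = colour p (hd q)"
    using assms(1) unfolding components_coloured_def Let_def ss_def[symmetric]
    by (auto simp: list_all_iff split: option.splits)
  define R where "R = {(a, b). look T a = Some b}"
  have R: "R = set ss" using build_Leaf(2)[OF T] by (auto simp: R_def)
  note o = orbits_Leaf[OF ps, folded R_def]
  let ?D = "dg cs []" and ?C = "map_crossing numeral ` set cs :: nat crossing set"
  have R': "(\<Union>c\<in>?C. {(under_in c, under_out c), (over_in c, over_out c)}) = map_prod numeral numeral ` R"
    by (auto simp: R ss_def entries_map image_UN)
  \<comment> \<open>Orbits are started at incoming edges only. In a well-formed diagram without
    circles these are all edges, because each outgoing edge also enters a crossing.\<close>
  have "edges ?D = numeral ` set (map fst ss)"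
  proof -
    have "(\<lambda>(c, over). if over then over_in c else under_in c) ` (?C \<times> UNIV) =
        (\<lambda>(c, over). if over then over_out c else under_out c) ` (?C \<times> UNIV)"
      using assms(2) by (simp add: link_diagram_def well_formed_def Let_def dg_def)
    moreover have "(\<lambda>(c, over). if over then f c else g c) ` (?C \<times> UNIV) = (\<Union>c\<in>?C. {g c, f c})"
      for f g :: "nat crossing \<Rightarrow> nat"
    proof -
      have "?C \<times> UNIV = (\<lambda>c. (c, True)) ` ?C \<union> (\<lambda>c. (c, False)) ` ?C" by (auto simp: UNIV_bool)
      then show ?thesis by (simp only: image_Un image_image prod.case if_True if_False) auto
    qed
    ultimately have "(\<Union>c\<in>?C. {under_in c, over_in c}) = (\<Union>c\<in>?C. {under_out c, over_out c})"
      by metis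
    moreover have "edges ?D = (\<Union>c\<in>?C. {under_in c, over_in c}) \<union> (\<Union>c\<in>?C. {under_out c, over_out c})"
      by (auto simp: edges_def dg_def set_crossing_strands)
    ultimately have "edges ?D = (\<Union>c\<in>?C. {under_in c, over_in c})" by simp
    then show ?thesis by (simp add: ss_def entries_map image_UN)
  qed
  then have "components ?D = (\<lambda>e. (map_prod numeral numeral ` R)\<^sup>* `` {e}) ` numeral ` set (map fst ss)"
    unfolding components_def setcompr_eq_image using R' by (simp add: dg_def)
  also have "\<dots> = (`) numeral ` {R\<^sup>* `` {d} | d. d \<in> set (map fst ss)}"
    by (simp only: rtrancl_image_inj[OF inj_num] image_image setcompr_eq_image Collect_mem_eq)
  finally have comp: "components ?D = (`) numeral ` set ` set ps" using o(2) by simp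
  have "card (components ?D) = card (set ` set ps)"
    unfolding comp by (simp add: card_image inj_num inj_on_image inj_on_subset[OF inj_num])
  also have "\<dots> = card (set (map set ps))" by simp
  also have "\<dots> = length (map set ps)" by (rule distinct_card[OF o(1)])
  finally show "card (components ?D) = 3" by (simp add: c(1))
  show "colouring p e = colouring p e' \<longleftrightarrow> K = K'"
    if K: "K \<in> components ?D" "K' \<in> components ?D" "e \<in> K" "e' \<in> K'" for K K' e e'
  proof -
    obtain q q' where q: "q \<in> set ps" "q' \<in> set ps" "K = numeral ` set q" "K' = numeral ` set q'"
      using K(1,2) unfolding comp by auto
    have hd: "colouring p x = colour p (hd r)" if "r \<in> set ps" "x \<in> numeral ` set r" for r x
      using c(3) that by auto
    have "inj_on (\<lambda>q. colour p (hd q)) (set ps)" using c(2) by (simp add: distinct_map)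
    then have "colour p (hd q) = colour p (hd q') \<longleftrightarrow> q = q'" using q by (auto dest: inj_onD)
    moreover have "colouring p e = colour p (hd q)" "colouring p e' = colour p (hd q')" using hd q K(3,4) by auto
    moreover have "colouring p e = colour p (hd q')" if "K = K'" using hd[OF q(2), of e] q(4) K(3) that by simp
    ultimately show ?thesis using q by auto
  qed
qed

context invariant_F
begin

text \<open>Blocks of size one force a coloration to distinguish exactly the components. All such
  colorations are equivalent to \<kappa>, so invariance under recoloring reduces the set to one
  value.\<close>

lemma F_set_111:
  assumes D: "colored_link_diagram (D, \<kappa>)" and card: "card (components D) = 3"
    and \<kappa>: "\<And>K K' e e'. K \<in> components D \<Longrightarrow> K' \<in> components D \<Longrightarrow> e \<in> K \<Longrightarrow> e' \<in> K' \<Longrightarrow>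
      \<kappa> e = \<kappa> e' \<longleftrightarrow> K = K'"
  shows "F_set F [1, 1, 1] D = {F (D, \<kappa>)}"
proof -
  have comp: "\<exists>K\<in>components D. e \<in> K" if "e \<in> edges D" for e
    using that unfolding components_def by blast
  have "F (D, \<kappa>') = F (D, \<kappa>)"
    if P: "partition_on (components D) P" "image_mset card (mset_set P) = mset [1, 1, 1]"
      and cor: "corresponds D \<kappa>' P" for \<kappa>' P
  proof -
    have fin: "finite P" using P(2) by (cases "finite P") auto
    have B1: "card B = 1" if "B \<in> P" for B
    proof -
      have "card B \<in># image_mset card (mset_set P)" using that fin by auto
      then show ?thesis unfolding P(2) by simp
    qed
    have iff: "(\<exists>B\<in>P. K \<in> B \<and> K' \<in> B) \<longleftrightarrow> K = K'" if "K \<in> components D" "K' \<in> components D" for K K'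
    proof
      assume "\<exists>B\<in>P. K \<in> B \<and> K' \<in> B"
      then obtain B where B: "B \<in> P" "K \<in> B" "K' \<in> B" by blast
      obtain x where "B = {x}" using B1[OF B(1)] by (rule card_1_singletonE)
      then show "K = K'" using B by simp
    next
      assume "K = K'"
      then show "\<exists>B\<in>P. K \<in> B \<and> K' \<in> B"
        using partition_onD1[OF P(1)] that by blast
    qed
    have \<kappa>': "\<kappa>' e = \<kappa>' e' \<longleftrightarrow> K = K'" if "K \<in> components D" "K' \<in> components D" "e \<in> K" "e' \<in> K'" for K K' e e'
      using cor[unfolded corresponds_def, rule_format, OF that] iff[OF that(1,2)] by simp
    have "coloration D \<kappa>'" unfolding coloration_def using \<kappa>' by blast
    then have D': "colored_link_diagram (D, \<kappa>')" using D by (simp add: colored_link_diagram_def)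
    show ?thesis
    proof (rule F_recolor[OF D' D])
      show "equivalent_colorations D \<kappa>' \<kappa>"
        unfolding equivalent_colorations_def
      proof (intro ballI)
        fix e e' assume "e \<in> edges D" "e' \<in> edges D"
        then obtain K K' where "K \<in> components D" "K' \<in> components D" "e \<in> K" "e' \<in> K'"
          using comp by blast
        then show "\<kappa>' e = \<kappa>' e' \<longleftrightarrow> \<kappa> e = \<kappa> e'"
          using \<kappa>[of K K' e e'] \<kappa>'[of K K' e e'] by blast
      qed
    qed
  qed
  \<comment> \<open>The partition into singletons shows that the value for \<kappa> itself is
    attained, so the set is not empty.\<close>
  moreover have "\<exists>P. partition_on (components D) P \<and> image_mset card (mset_set P) = mset [1, 1, 1] \<and> corresponds D \<kappa> P"
  proof (intro exI conjI)
    let ?P = "(\<lambda>K. {K}) ` components D"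
    have ne: "K \<noteq> {}" if "K \<in> components D" for K using that by (auto simp: components_def)
    show "partition_on (components D) ?P"
      by (auto simp: partition_on_def disjoint_def)
    have "image_mset card (mset_set ?P) = image_mset (\<lambda>K. card {K}) (mset_set (components D))"
      by (simp add: multiset.map_comp comp_def flip: image_mset_mset_set)
    also have "\<dots> = replicate_mset 3 1" using card by (simp add: image_mset_const_eq)
    also have "\<dots> = mset [1, 1, 1]" by (simp add: numeral_3_eq_3)
    finally show "image_mset card (mset_set ?P) = mset [1, 1, 1]" .
    show "corresponds D \<kappa> ?P" unfolding corresponds_def using \<kappa> by auto
  qed
  ultimately show ?thesis unfolding F_set_def by blast
qed

end

definition has_values :: "Qxtw set \<Rightarrow> rat \<Rightarrow> bool" where
  "has_values S r \<longleftrightarrow> (\<exists>z. S = {z} \<and> has_value z r)"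

theorem F_set_eval:
  assumes "is_invariant_F F" and "D = dg cs []"
    and "valid cs [] p \<and> components_coloured cs p \<and> eval T cs [] p = Some v" and "dyadic v = r"
  shows "has_values (F_set F [1, 1, 1] D) r"
proof -
  interpret invariant_F F by unfold_locales (fact assms(1))
  have *: "valid cs [] p" "components_coloured cs p" "eval T cs [] p = Some v" using assms(3) by auto
  note vs = valid_sound[OF *(1)]
  have ld: "link_diagram (dg cs [])" using vs(1) by (simp add: colored_link_diagram_def)
  have "F_set F [1, 1, 1] (dg cs []) = {F (dg cs [], colouring p)}"
    by (rule F_set_111[OF vs(1)]) (use components_coloured_sound[OF *(2) ld] in auto)
  then show ?thesis using eval_sound[OF *(3) vs(2,1)] assms(2,4) by (auto simp: has_values_def)
qed

lemma has_values_neq: "has_values S r \<Longrightarrow> has_values S' r' \<Longrightarrow> r \<noteq> r' \<Longrightarrow> S \<noteq> S'"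
  unfolding has_values_def using has_value_unique by blast

section \<open>The twelve links\<close>

text \<open>Edge names in constructor form, on which the tries branch directly.\<close>

abbreviation "e1 \<equiv> num.One"
abbreviation "e2 \<equiv> num.Bit0 e1"
abbreviation "e3 \<equiv> num.Bit1 e1"
abbreviation "e4 \<equiv> num.Bit0 e2"
abbreviation "e5 \<equiv> num.Bit1 e2"
abbreviation "e6 \<equiv> num.Bit0 e3"
abbreviation "e7 \<equiv> num.Bit1 e3"
abbreviation "e8 \<equiv> num.Bit0 e4"
abbreviation "e9 \<equiv> num.Bit1 e4"
abbreviation "e10 \<equiv> num.Bit0 e5"
abbreviation "e11 \<equiv> num.Bit1 e5"
abbreviation "e12 \<equiv> num.Bit0 e6"
abbreviation "e13 \<equiv> num.Bit1 e6"
abbreviation "e14 \<equiv> num.Bit0 e7"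
abbreviation "e15 \<equiv> num.Bit1 e7"
abbreviation "e16 \<equiv> num.Bit0 e8"
abbreviation "e17 \<equiv> num.Bit1 e8"
abbreviation "e18 \<equiv> num.Bit0 e9"
abbreviation "e19 \<equiv> num.Bit1 e9"
abbreviation "e20 \<equiv> num.Bit0 e10"
abbreviation "e21 \<equiv> num.Bit1 e10"
abbreviation "e22 \<equiv> num.Bit0 e11"

lemma L11n325_11_value:
  assumes "is_invariant_F F"
  shows "has_values (F_set F [1, 1, 1] L11n325_11) (581 / 2048)"
proof (rule F_set_eval[OF assms])
  \<comment> \<open>The PD code after reversal of the second and third components: crossings between
    one of them and the first component change sign, the others keep it.\<close>
  let ?cs = "[Xp e7 e2 e6 e1, Xm e9 e3 e8 e4, Xm e6 e15 e5 e14, Xm e17 e8 e16 e7, Xm e10 e19 e9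
    e18, Xp e12 e20 e11 e21, Xm e14 e5 e13 e12, Xm e2 e16 e3 e15, Xp e4 e17 e1 e18, Xm
    e20 e13 e19 e22, Xp e22 e10 e21 e11]"
  \<comment> \<open>The thresholds are the first edges of the second and of the third
    component.\<close>
  let ?p = "(0, [(e5, 1), (e13, 2)])"
  show "L11n325_11 = dg ?cs []" by (simp add: L11n325_11_def pd_link_def dg_def)
  \<comment> \<open>The three changes put the third component above the second, after which moves
    alone reach an unlink. With these two colours merged, two further changes put the first
    component above the rest, and one colour remains for the crossings resolved by
    \<open>Skein\<close>.\<close>
  show "valid ?cs [] ?p \<and> components_coloured ?cs ?p \<and>
    eval (Separate 2 1 [e17, e14, e22] (Move (R2 e6 e5) (Move (R2 e11 e6) (Move (R1 e22) (Move (R3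
    e2 e8 e7) (Move (R2 e8 e9) (Move (R2 e9 e6) (Move (R2 e1 e2) Unlink))))))) (Separate 0 2
    [e2, e4] (Move (R3 e7 e16 e17) (Move (R2 e8 e9) (Move (R2 e17 e18) (Skein e12 (Move (R2
    e21 e22) (Move (R1 e22) (Skein e6 (Move (R2 e15 e14) (Skein e18 (Move (R2 e9 e6) Unlink)
    (Move (R1 e18) Unlink))) (Skein e18 (Move (R2 e9 e6) (Move (R1 e18) Unlink)) (Skein e12
    (Move (R2 e13 e18) Unlink) (Move (R1 e12) Unlink)))))) (Move (R1 e22) (Skein e6 (Move (R2
    e15 e14) (Skein e18 (Move (R2 e9 e6) (Move (R1 e18) Unlink)) (Skein e22 (Move (R2 e19 e18)
    Unlink) (Move (R1 e22) Unlink)))) (Skein e18 (Move (R2 e9 e6) (Skein e22 (Move (R2 e19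
    e18) Unlink) (Move (R1 e22) Unlink))) (Skein e22 (Move (R2 e19 e18) (Move (R1 e22)
    Unlink)) (Skein e22 (Move (R2 e19 e12) Unlink) (Move (R1 e22) Unlink)))))))))) (Skein e12
    (Move (R2 e21 e22) (Move (R1 e22) (Skein e17 (Move (R3 e2 e6 e7) (Move (R2 e8 e7) (Move
    (R2 e8 e9) (Move (R2 e2 e1) (Skein e12 (Move (R2 e13 e18) Unlink) (Move (R1 e12)
    Unlink)))))) (Skein e6 (Move (R2 e15 e14) (Move (R3 e2 e6 e17) (Move (R2 e6 e9) (Move (R2
    e1 e2) (Move (R1 e15) Unlink))))) (Skein e9 (Move (R2 e3 e2) (Skein e17 (Move (R2 e2 e1)
    (Skein e12 (Move (R2 e13 e18) Unlink) (Move (R1 e12) Unlink))) (Move (R1 e17) (Skein e12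
    (Move (R2 e13 e18) Unlink) (Move (R1 e12) Unlink))))) (Move (R2 e12 e9) (Move (R2 e6 e13)
    (Move (R1 e15) Unlink)))))))) (Move (R1 e22) (Skein e17 (Move (R3 e2 e6 e7) (Move (R2 e8
    e7) (Move (R2 e8 e9) (Move (R2 e2 e1) (Skein e22 (Move (R2 e19 e18) (Move (R1 e22)
    Unlink)) (Skein e22 (Move (R2 e19 e12) Unlink) (Move (R1 e22) Unlink))))))) (Skein e9
    (Move (R2 e3 e2) (Skein e17 (Move (R2 e2 e1) (Skein e18 (Move (R2 e9 e14) (Skein e22 (Move
    (R2 e19 e18) Unlink) (Move (R1 e22) Unlink))) (Skein e22 (Move (R2 e19 e18) (Move (R1 e22)
    Unlink)) (Skein e22 (Move (R2 e19 e12) Unlink) (Move (R1 e22) Unlink))))) (Move (R1 e17)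
    (Skein e18 (Move (R2 e9 e14) (Skein e22 (Move (R2 e19 e18) Unlink) (Move (R1 e22)
    Unlink))) (Skein e22 (Move (R2 e19 e18) (Move (R1 e22) Unlink)) (Skein e22 (Move (R2 e19
    e12) Unlink) (Move (R1 e22) Unlink))))))) (Move (R2 e22 e9) (Move (R2 e12 e19) (Move (R1
    e13) (Skein e12 (Move (R2 e13 e14) Unlink) (Move (R1 e12) Unlink))))))))) (Move (R3 e7 e16
    e17) (Move (R2 e8 e9) (Move (R2 e17 e18) (Skein e20 (Move (R3 e10 e13 e22) (Move (R2 e12
    e11) (Move (R2 e14 e13) (Move (R1 e14) (Skein e6 (Move (R2 e15 e14) Unlink) (Move (R1 e6)
    Unlink)))))) (Skein e12 (Move (R2 e21 e20) (Skein e6 (Move (R2 e15 e14) (Skein e18 (Move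
    (R2 e9 e6) Unlink) (Move (R1 e18) Unlink))) (Skein e18 (Move (R2 e9 e6) (Move (R1 e18)
    Unlink)) (Skein e12 (Move (R2 e13 e18) Unlink) (Move (R1 e12) Unlink))))) (Move (R1 e12)
    (Skein e6 (Move (R2 e15 e14) (Skein e18 (Move (R2 e9 e6) Unlink) (Move (R1 e18) Unlink)))
    (Skein e18 (Move (R2 e9 e6) (Move (R1 e18) Unlink)) (Skein e12 (Move (R2 e13 e18) Unlink)
    (Move (R1 e12) Unlink))))))))))) (Move (R2 e6 e5) (Move (R2 e11 e6) (Move (R1 e22) (Move
    (R3 e2 e8 e7) (Move (R2 e8 e9) (Move (R2 e9 e6) (Move (R2 e1 e2) Unlink))))))))
      ?cs [] ?p = Some (37184, 17)"
    by code_simp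
  show "dyadic (37184, 17) = 581 / 2048" by (simp add: dyadic_def)
qed

lemma L11n424_00_value:
  assumes "is_invariant_F F"
  shows "has_values (F_set F [1, 1, 1] L11n424_00) (-1849 / 2048)"
proof (rule F_set_eval[OF assms])
  let ?cs = "[Xm e8 e1 e9 e2, Xm e3 e10 e4 e11, Xm e5 e14 e6 e15, Xm e7 e16 e8 e17, Xm e18 e9 e19
    e10, Xp e11 e13 e12 e22, Xm e13 e4 e14 e5, Xm e15 e20 e16 e21, Xp e2 e18 e3 e17, Xp
    e19 e1 e20 e6, Xp e21 e7 e22 e12]"
  let ?p = "(0, [(e7, 1), (e13, 2)])"
  show "L11n424_00 = dg ?cs []" by (simp add: L11n424_00_def pd_link_def dg_def)
  \<comment> \<open>The changes at \<open>e5\<close> and \<open>e2\<close> put the first component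
    above the third. With three colours the pairs \<open>0, 2\<close>, then \<open>1, 2\<close>,
    then \<open>0, 1\<close> are separated in turn; each merged term has two colours and needs one
    more separation.\<close>
  show "valid ?cs [] ?p \<and> components_coloured ?cs ?p \<and>
    eval (Separate 0 2 [e5, e2] (Move (R2 e13 e14) (Move (R3 e8 e17 e18) (Move (R2 e19 e18)
    (Separate 1 2 [e7, e11] (Move (R2 e16 e17) (Move (R2 e22 e21) (Move (R1 e21) (Separate 0 1
    [e3] (Move (R2 e11 e10) Unlink) (Skein e11 (Move (R2 e4 e3) Unlink) (Move (R1 e11)
    Unlink)) (Move (R2 e11 e10) Unlink))))) (Separate 0 1 [e3] (Move (R2 e9 e10) (Skein e9
    (Move (R2 e22 e21) (Move (R1 e21) (Skein e9 (Move (R2 e18 e17) Unlink) (Move (R1 e9)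
    Unlink)))) (Move (R1 e21) (Skein e21 (Move (R2 e16 e17) (Move (R1 e21) Unlink)) (Skein e21
    (Move (R2 e16 e9) Unlink) (Move (R1 e21) Unlink)))))) (Skein e11 (Move (R2 e22 e21) (Move
    (R1 e21) (Skein e9 (Move (R2 e4 e3) (Skein e9 (Move (R2 e18 e17) Unlink) (Move (R1 e9)
    Unlink))) (Move (R1 e9) (Skein e9 (Move (R2 e18 e17) Unlink) (Move (R1 e9) Unlink))))))
    (Move (R1 e21) (Skein e9 (Move (R2 e4 e3) (Skein e21 (Move (R2 e16 e17) (Move (R1 e21)
    Unlink)) (Skein e21 (Move (R2 e16 e9) Unlink) (Move (R1 e21) Unlink)))) (Move (R1 e9)
    (Skein e21 (Move (R2 e16 e17) (Move (R1 e21) Unlink)) (Skein e21 (Move (R2 e16 e9) Unlink)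
    (Move (R1 e21) Unlink))))))) (Move (R2 e9 e10) (Skein e9 (Move (R2 e22 e21) (Move (R1 e21)
    (Skein e9 (Move (R2 e18 e17) Unlink) (Move (R1 e9) Unlink)))) (Move (R1 e21) (Skein e21
    (Move (R2 e16 e17) (Move (R1 e21) Unlink)) (Skein e21 (Move (R2 e16 e9) Unlink) (Move (R1
    e21) Unlink))))))) (Move (R2 e16 e17) (Move (R2 e22 e21) (Move (R1 e21) (Separate 0 1 [e3]
    (Move (R2 e11 e10) Unlink) (Skein e11 (Move (R2 e4 e3) Unlink) (Move (R1 e11) Unlink))
    (Move (R2 e11 e10) Unlink))))))))) (Separate 0 1 [e3, e18, e21] (Move (R2 e12 e11) (Move
    (R3 e2 e11 e8) (Move (R2 e11 e10) (Move (R2 e10 e9) (Skein e1 (Move (R2 e17 e16) (Move (R1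
    e15) (Skein e5 (Move (R2 e14 e15) Unlink) (Move (R1 e5) Unlink)))) (Move (R1 e1) (Skein e5
    (Move (R2 e14 e15) (Move (R1 e5) Unlink)) (Skein e21 (Move (R2 e16 e5) Unlink) (Move (R1
    e21) Unlink))))))))) (Skein e15 (Move (R3 e8 e19 e18) (Move (R3 e7 e20 e19) (Move (R2 e21
    e20) (Move (R3 e2 e19 e18) (Move (R1 e18) (Move (R3 e5 e12 e9) (Move (R2 e6 e1) (Move (R3
    e13 e12 e9) (Move (R2 e11 e12) (Move (R2 e20 e15) (Skein e11 (Move (R2 e4 e5) Unlink)
    (Move (R1 e11) Unlink)))))))))))) (Skein e7 (Move (R3 e8 e19 e20) (Move (R2 e19 e18)
    (Skein e11 (Move (R2 e22 e15) (Skein e5 (Move (R2 e15 e14) (Skein e11 (Move (R2 e4 e3)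
    (Skein e2 (Move (R2 e17 e18) Unlink) (Move (R1 e2) Unlink))) (Move (R1 e3) (Skein e2 (Move
    (R2 e17 e18) Unlink) (Move (R1 e2) Unlink))))) (Move (R1 e5) (Skein e11 (Move (R2 e4 e3)
    (Skein e2 (Move (R2 e17 e18) Unlink) (Move (R1 e2) Unlink))) (Move (R1 e3) (Skein e2 (Move
    (R2 e17 e18) Unlink) (Move (R1 e2) Unlink))))))) (Move (R1 e15) (Skein e2 (Move (R2 e18
    e17) (Skein e15 (Move (R2 e6 e1) (Skein e5 (Move (R2 e14 e15) Unlink) (Move (R1 e5)
    Unlink))) (Skein e15 (Move (R2 e6 e11) (Move (R1 e15) Unlink)) (Skein e5 (Move (R2 e14
    e15) Unlink) (Move (R1 e5) Unlink))))) (Move (R1 e2) (Skein e15 (Move (R2 e6 e1) (Skein e5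
    (Move (R2 e14 e15) Unlink) (Move (R1 e5) Unlink))) (Skein e15 (Move (R2 e6 e11) (Move (R1
    e15) Unlink)) (Skein e5 (Move (R2 e14 e15) Unlink) (Move (R1 e5) Unlink)))))))))) (Move
    (R2 e19 e20) (Move (R1 e18) (Move (R2 e6 e3) (Skein e5 (Move (R2 e14 e13) (Skein e7 (Move
    (R2 e22 e13) Unlink) (Move (R1 e7) Unlink))) (Move (R1 e13) (Skein e7 (Move (R2 e22 e13)
    Unlink) (Move (R1 e7) Unlink))))))))) (Move (R2 e12 e11) (Move (R3 e2 e11 e8) (Move (R2
    e11 e10) (Move (R2 e10 e9) (Skein e1 (Move (R2 e17 e16) (Move (R1 e15) (Skein e5 (Move (R2
    e14 e15) Unlink) (Move (R1 e5) Unlink)))) (Move (R1 e1) (Skein e5 (Move (R2 e14 e15) (Move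
    (R1 e5) Unlink)) (Skein e21 (Move (R2 e16 e5) Unlink) (Move (R1 e21) Unlink))))))))))
    (Move (R2 e13 e14) (Move (R3 e8 e17 e18) (Move (R2 e19 e18) (Separate 0 1 [e3, e17, e21]
    (Move (R2 e9 e10) (Move (R2 e7 e8) (Move (R2 e12 e7) (Move (R1 e21) Unlink)))) (Skein e11
    (Move (R2 e22 e21) (Move (R1 e21) (Skein e9 (Move (R2 e4 e3) (Skein e9 (Move (R2 e18 e17)
    Unlink) (Move (R1 e9) Unlink))) (Move (R1 e9) (Skein e9 (Move (R2 e18 e17) Unlink) (Move
    (R1 e9) Unlink)))))) (Move (R1 e21) (Skein e9 (Move (R2 e4 e3) (Skein e21 (Move (R2 e16
    e17) (Move (R1 e21) Unlink)) (Skein e21 (Move (R2 e16 e9) Unlink) (Move (R1 e21)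
    Unlink)))) (Move (R1 e9) (Skein e21 (Move (R2 e16 e17) (Move (R1 e21) Unlink)) (Skein e21
    (Move (R2 e16 e9) Unlink) (Move (R1 e21) Unlink))))))) (Move (R2 e9 e10) (Move (R2 e7 e8)
    (Move (R2 e12 e7) (Move (R1 e21) Unlink)))))))))
      ?cs [] ?p = Some (-118336, 17)"
    by code_simp
  show "dyadic (-118336, 17) = -1849 / 2048" by (simp add: dyadic_def)
qed

lemma L11n356_10_value:
  assumes "is_invariant_F F"
  shows "has_values (F_set F [1, 1, 1] L11n356_10) (-1073 / 16)"
proof (rule F_set_eval[OF assms])
  let ?cs = "[Xp e7 e2 e6 e1, Xp e11 e4 e10 e3, Xp e2 e5 e3 e6, Xm e16 e8 e17 e7, Xp e4 e9 e1 e10,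
    Xp e12 e19 e11 e18, Xm e14 e20 e13 e21, Xm e9 e15 e8 e16, Xp e17 e14 e18 e5, Xm e19
    e22 e20 e15, Xm e21 e13 e22 e12]"
  let ?p = "(0, [(e5, 1), (e15, 2)])"
  show "L11n356_10 = dg ?cs []" by (simp add: L11n356_10_def pd_link_def dg_def)
  \<comment> \<open>The first and third components have no common crossing. Lifting the first above
    the second and simplifying leaves a Hopf link of the other two, for which a single change at
    \<open>e12\<close> suffices.\<close>
  show "valid ?cs [] ?p \<and> components_coloured ?cs ?p \<and>
    eval (Separate 0 1 [e2, e4] (Move (R2 e7 e6) (Move (R2 e11 e10) (Move (R2 e16 e17) (Move (R2
    e11 e12) (Move (R1 e15) (Separate 1 2 [e12] (Move (R2 e22 e21) Unlink) (Skein e12 (Move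
    (R2 e22 e21) Unlink) (Move (R1 e12) Unlink)) (Move (R2 e22 e21) Unlink))))))) (Separate 0
    2 [e12, e14, e9] (Move (R2 e20 e21) (Move (R2 e15 e16) (Move (R2 e15 e18) (Move (R1 e15)
    (Skein e9 (Move (R2 e1 e2) (Skein e9 (Move (R2 e1 e4) Unlink) (Move (R1 e9) Unlink)))
    (Skein e5 (Move (R2 e3 e4) (Move (R1 e5) Unlink)) (Skein e9 (Move (R2 e1 e5) Unlink) (Move
    (R1 e9) Unlink)))))))) (Skein e7 (Move (R2 e1 e2) (Move (R2 e16 e17) (Move (R3 e19 e9 e8)
    (Move (R3 e12 e20 e21) (Move (R2 e8 e13) (Move (R1 e21) (Skein e11 (Move (R2 e1 e4) (Skein
    e11 (Move (R2 e21 e20) Unlink) (Move (R1 e11) Unlink))) (Move (R1 e11) (Skein e11 (Move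
    (R2 e21 e20) Unlink) (Move (R1 e11) Unlink)))))))))) (Skein e11 (Move (R2 e3 e4) (Move (R1
    e7) (Move (R2 e16 e17) (Move (R2 e11 e12) (Move (R1 e15) (Skein e12 (Move (R2 e22 e21)
    Unlink) (Move (R1 e12) Unlink))))))) (Skein e7 (Move (R2 e1 e11) (Skein e16 (Move (R2 e7
    e8) (Skein e12 (Move (R2 e18 e15) (Move (R1 e15) (Skein e12 (Move (R2 e22 e21) Unlink)
    (Move (R1 e12) Unlink)))) (Move (R1 e15) (Skein e15 (Move (R2 e20 e21) (Move (R1 e15)
    Unlink)) (Skein e12 (Move (R2 e22 e15) Unlink) (Move (R1 e12) Unlink)))))) (Move (R1 e16)
    (Skein e12 (Move (R2 e18 e15) (Move (R1 e15) (Skein e12 (Move (R2 e22 e21) Unlink) (Move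
    (R1 e12) Unlink)))) (Move (R1 e15) (Skein e15 (Move (R2 e20 e21) (Move (R1 e15) Unlink))
    (Skein e12 (Move (R2 e22 e15) Unlink) (Move (R1 e12) Unlink)))))))) (Move (R2 e16 e17)
    (Move (R1 e11) (Move (R2 e11 e12) (Move (R1 e15) (Skein e12 (Move (R2 e22 e21) Unlink)
    (Move (R1 e12) Unlink))))))))) (Move (R2 e20 e21) (Move (R2 e15 e16) (Move (R2 e15 e18)
    (Move (R1 e15) (Skein e9 (Move (R2 e1 e2) (Skein e9 (Move (R2 e1 e4) Unlink) (Move (R1 e9)
    Unlink))) (Skein e5 (Move (R2 e3 e4) (Move (R1 e5) Unlink)) (Skein e9 (Move (R2 e1 e5)
    Unlink) (Move (R1 e9) Unlink))))))))) (Move (R2 e7 e6) (Move (R2 e11 e10) (Move (R2 e16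
    e17) (Move (R2 e11 e12) (Move (R1 e15) (Separate 0 2 [e12] (Move (R2 e22 e21) Unlink)
    (Skein e12 (Move (R2 e22 e21) Unlink) (Move (R1 e12) Unlink)) (Move (R2 e22 e21)
    Unlink))))))))
      ?cs [] ?p = Some (-137344, 11)"
    by code_simp
  show "dyadic (-137344, 11) = -1073 / 16" by (simp add: dyadic_def)
qed

lemma L11n434_00_value:
  assumes "is_invariant_F F"
  shows "has_values (F_set F [1, 1, 1] L11n434_00) (71 / 8)"
proof (rule F_set_eval[OF assms])
  let ?cs = "[Xm e8 e1 e9 e2, Xp e14 e4 e15 e3, Xp e5 e17 e6 e16, Xm e2 e7 e3 e8, Xp e22 e10 e13
    e9, Xm e18 e11 e19 e12, Xp e12 e14 e7 e13, Xm e15 e20 e16 e21, Xm e10 e17 e11 e18, Xp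
    e19 e5 e20 e4, Xp e6 e22 e1 e21]"
  let ?p = "(0, [(e7, 1), (e13, 2)])"
  show "L11n434_00 = dg ?cs []" by (simp add: L11n434_00_def pd_link_def dg_def)
  \<comment> \<open>The first two changes put the second component above the third; colours
    \<open>0, 2\<close> and then \<open>0, 1\<close> follow.\<close>
  show "valid ?cs [] ?p \<and> components_coloured ?cs ?p \<and>
    eval (Separate 1 2 [e12, e10] (Move (R2 e17 e18) (Move (R2 e22 e13) (Move (R3 e15 e6 e5) (Move
    (R3 e5 e16 e17) (Move (R1 e17) (Separate 0 2 [e6, e4] (Move (R2 e22 e17) (Move (R2 e16
    e17) (Separate 0 1 [e2] (Move (R2 e8 e9) Unlink) (Skein e8 (Move (R2 e3 e2) Unlink) (Move
    (R1 e8) Unlink)) (Move (R2 e8 e9) Unlink)))) (Separate 0 1 [e2] (Move (R2 e8 e9) (Skein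
    e22 (Move (R2 e1 e6) (Skein e22 (Move (R2 e5 e6) Unlink) (Move (R1 e22) Unlink))) (Move
    (R1 e6) (Move (R1 e6) (Move (R1 e22) Unlink))))) (Skein e22 (Move (R2 e4 e3) (Skein e8
    (Move (R2 e1 e2) (Skein e6 (Move (R2 e17 e16) Unlink) (Move (R1 e6) Unlink))) (Move (R1
    e8) (Skein e6 (Move (R2 e17 e16) Unlink) (Move (R1 e6) Unlink))))) (Move (R1 e22) (Move
    (R1 e16) (Move (R1 e16) (Skein e8 (Move (R2 e3 e2) Unlink) (Move (R1 e8) Unlink))))))
    (Move (R2 e8 e9) (Skein e22 (Move (R2 e1 e6) (Skein e22 (Move (R2 e5 e6) Unlink) (Move (R1
    e22) Unlink))) (Move (R1 e6) (Move (R1 e6) (Move (R1 e22) Unlink)))))) (Move (R2 e22 e17)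
    (Move (R2 e16 e17) (Separate 0 1 [e2] (Move (R2 e8 e9) Unlink) (Skein e8 (Move (R2 e3 e2)
    Unlink) (Move (R1 e8) Unlink)) (Move (R2 e8 e9) Unlink)))))))))) (Separate 0 1 [e5, e2,
    e6] (Move (R2 e8 e7) (Move (R3 e19 e14 e15) (Move (R2 e15 e16) (Move (R2 e20 e21) (Skein
    e20 (Move (R2 e7 e12) (Move (R1 e20) (Skein e18 (Move (R2 e11 e12) Unlink) (Move (R1 e18)
    Unlink)))) (Move (R1 e12) (Skein e18 (Move (R2 e11 e12) (Move (R1 e18) Unlink)) (Skein e18
    (Move (R2 e11 e20) Unlink) (Move (R1 e18) Unlink))))))))) (Skein e5 (Move (R3 e19 e14 e15)
    (Move (R2 e15 e16) (Skein e18 (Move (R2 e10 e11) (Move (R1 e14) (Skein e8 (Move (R2 e2 e1)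
    (Skein e22 (Move (R2 e7 e10) (Skein e22 (Move (R2 e1 e4) Unlink) (Move (R1 e22) Unlink)))
    (Move (R1 e22) (Skein e22 (Move (R2 e1 e4) Unlink) (Move (R1 e22) Unlink))))) (Move (R1
    e8) (Skein e22 (Move (R2 e1 e10) (Skein e22 (Move (R2 e1 e4) Unlink) (Move (R1 e22)
    Unlink))) (Skein e22 (Move (R2 e1 e14) (Move (R1 e22) Unlink)) (Skein e22 (Move (R2 e1 e4)
    Unlink) (Move (R1 e22) Unlink)))))))) (Skein e18 (Move (R3 e10 e13 e22) (Move (R2 e13 e14)
    (Move (R1 e22) (Move (R3 e2 e9 e8) (Move (R2 e9 e10) (Move (R2 e2 e1) (Move (R1 e8)
    Unlink))))))) (Skein e8 (Move (R2 e2 e1) (Move (R1 e22) (Skein e18 (Move (R2 e11 e22)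
    (Skein e22 (Move (R2 e1 e4) Unlink) (Move (R1 e22) Unlink))) (Move (R1 e22) (Skein e22
    (Move (R2 e1 e4) Unlink) (Move (R1 e22) Unlink)))))) (Move (R1 e8) (Skein e22 (Move (R2 e4
    e1) (Move (R1 e20) (Skein e18 (Move (R2 e11 e20) Unlink) (Move (R1 e18) Unlink)))) (Skein
    e18 (Move (R2 e11 e22) (Skein e22 (Move (R2 e1 e4) Unlink) (Move (R1 e22) Unlink))) (Move
    (R1 e22) (Skein e22 (Move (R2 e1 e4) Unlink) (Move (R1 e22) Unlink))))))))))) (Move (R2
    e15 e16) (Move (R3 e10 e19 e20) (Move (R2 e19 e18) (Move (R1 e18) (Move (R2 e9 e10) (Move
    (R1 e4) (Skein e8 (Move (R2 e3 e2) Unlink) (Move (R1 e8) Unlink))))))))) (Move (R2 e8 e7)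
    (Move (R3 e19 e14 e15) (Move (R2 e15 e16) (Move (R2 e20 e21) (Skein e20 (Move (R2 e7 e12)
    (Move (R1 e20) (Skein e18 (Move (R2 e11 e12) Unlink) (Move (R1 e18) Unlink)))) (Move (R1
    e12) (Skein e18 (Move (R2 e11 e12) (Move (R1 e18) Unlink)) (Skein e18 (Move (R2 e11 e20)
    Unlink) (Move (R1 e18) Unlink)))))))))) (Move (R2 e17 e18) (Move (R2 e22 e13) (Move (R3
    e15 e6 e5) (Move (R3 e5 e16 e17) (Move (R1 e17) (Separate 0 1 [e6, e2, e4] (Move (R2 e8
    e9) (Move (R2 e22 e17) (Move (R2 e17 e16) Unlink))) (Skein e22 (Move (R2 e4 e3) (Skein e8
    (Move (R2 e1 e2) (Skein e6 (Move (R2 e17 e16) Unlink) (Move (R1 e6) Unlink))) (Move (R1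
    e8) (Skein e6 (Move (R2 e17 e16) Unlink) (Move (R1 e6) Unlink))))) (Move (R1 e22) (Move
    (R1 e16) (Move (R1 e16) (Skein e8 (Move (R2 e3 e2) Unlink) (Move (R1 e8) Unlink))))))
    (Move (R2 e8 e9) (Move (R2 e22 e17) (Move (R2 e17 e16) Unlink))))))))))
      ?cs [] ?p = Some (18176, 11)"
    by code_simp
  show "dyadic (18176, 11) = 71 / 8" by (simp add: dyadic_def)
qed

lemma L10n79_11_value:
  assumes "is_invariant_F F"
  shows "has_values (F_set F [1, 1, 1] L10n79_11) (733 / 16384)"
proof (rule F_set_eval[OF assms])
  let ?cs = "[Xp e7 e2 e6 e1, Xm e9 e3 e8 e4, Xm e6 e15 e5 e14, Xm e17 e8 e16 e7, Xm e10 e19 e9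
    e18, Xm e12 e13 e11 e20, Xm e14 e5 e13 e12, Xm e2 e16 e3 e15, Xp e4 e17 e1 e18, Xm
    e20 e11 e19 e10]"
  let ?p = "(0, [(e5, 1), (e13, 2)])"
  show "L10n79_11 = dg ?cs []" by (simp add: L10n79_11_def pd_link_def dg_def)
  \<comment> \<open>Lifting the third component above the second makes the three-coloured link
    trivial by moves alone, so only the merged colorations branch by \<open>Skein\<close>.\<close>
  show "valid ?cs [] ?p \<and> components_coloured ?cs ?p \<and>
    eval (Separate 2 1 [e17, e14, e20] (Move (R2 e6 e5) (Move (R2 e6 e11) (Move (R3 e2 e8 e7) (Move
    (R2 e8 e9) (Move (R2 e9 e6) (Move (R2 e1 e2) Unlink)))))) (Separate 0 2 [e2, e4] (Move (R3
    e7 e16 e17) (Move (R2 e8 e9) (Move (R2 e17 e18) (Skein e6 (Move (R2 e15 e14) (Skein e18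
    (Move (R2 e9 e6) (Skein e10 (Move (R2 e19 e18) Unlink) (Move (R1 e10) Unlink))) (Skein e10
    (Move (R2 e19 e18) (Move (R1 e10) Unlink)) (Skein e10 (Move (R2 e19 e20) Unlink) (Move (R1
    e10) Unlink))))) (Skein e18 (Move (R2 e9 e6) (Skein e10 (Move (R2 e19 e18) (Move (R1 e10)
    Unlink)) (Skein e10 (Move (R2 e19 e20) Unlink) (Move (R1 e10) Unlink)))) (Skein e10 (Move
    (R2 e19 e18) (Skein e10 (Move (R2 e19 e20) Unlink) (Move (R1 e10) Unlink))) (Skein e12
    (Move (R2 e13 e20) (Move (R1 e12) Unlink)) (Skein e10 (Move (R2 e19 e12) Unlink) (Move (R1
    e10) Unlink))))))))) (Skein e17 (Move (R3 e2 e6 e7) (Move (R2 e8 e7) (Move (R2 e8 e9)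
    (Move (R2 e2 e1) (Skein e10 (Move (R2 e19 e18) (Skein e10 (Move (R2 e19 e20) Unlink) (Move
    (R1 e10) Unlink))) (Skein e12 (Move (R2 e13 e20) (Move (R1 e12) Unlink)) (Skein e10 (Move
    (R2 e19 e12) Unlink) (Move (R1 e10) Unlink)))))))) (Skein e9 (Move (R2 e3 e2) (Skein e17
    (Move (R2 e2 e1) (Skein e18 (Move (R2 e9 e14) (Skein e10 (Move (R2 e19 e18) (Move (R1 e10)
    Unlink)) (Skein e10 (Move (R2 e19 e20) Unlink) (Move (R1 e10) Unlink)))) (Skein e10 (Move
    (R2 e19 e18) (Skein e10 (Move (R2 e19 e20) Unlink) (Move (R1 e10) Unlink))) (Skein e12
    (Move (R2 e13 e20) (Move (R1 e12) Unlink)) (Skein e10 (Move (R2 e19 e12) Unlink) (Move (R1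
    e10) Unlink)))))) (Move (R1 e17) (Skein e18 (Move (R2 e9 e14) (Skein e10 (Move (R2 e19
    e18) (Move (R1 e10) Unlink)) (Skein e10 (Move (R2 e19 e20) Unlink) (Move (R1 e10)
    Unlink)))) (Skein e10 (Move (R2 e19 e18) (Skein e10 (Move (R2 e19 e20) Unlink) (Move (R1
    e10) Unlink))) (Skein e12 (Move (R2 e13 e20) (Move (R1 e12) Unlink)) (Skein e10 (Move (R2
    e19 e12) Unlink) (Move (R1 e10) Unlink)))))))) (Move (R2 e10 e9) (Move (R2 e20 e19) (Move
    (R1 e11) (Skein e20 (Move (R2 e11 e14) (Move (R1 e20) Unlink)) (Skein e12 (Move (R2 e13
    e20) Unlink) (Move (R1 e12) Unlink)))))))) (Move (R3 e7 e16 e17) (Move (R2 e8 e9) (Move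
    (R2 e17 e18) (Skein e6 (Move (R2 e15 e14) (Skein e18 (Move (R2 e9 e6) (Skein e10 (Move (R2
    e19 e18) Unlink) (Move (R1 e10) Unlink))) (Skein e10 (Move (R2 e19 e18) (Move (R1 e10)
    Unlink)) (Skein e10 (Move (R2 e19 e20) Unlink) (Move (R1 e10) Unlink))))) (Skein e18 (Move
    (R2 e9 e6) (Skein e10 (Move (R2 e19 e18) (Move (R1 e10) Unlink)) (Skein e10 (Move (R2 e19
    e20) Unlink) (Move (R1 e10) Unlink)))) (Skein e10 (Move (R2 e19 e18) (Skein e10 (Move (R2
    e19 e20) Unlink) (Move (R1 e10) Unlink))) (Skein e12 (Move (R2 e13 e20) (Move (R1 e12)
    Unlink)) (Skein e10 (Move (R2 e19 e12) Unlink) (Move (R1 e10) Unlink)))))))))) (Move (R2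
    e6 e5) (Move (R2 e6 e11) (Move (R3 e2 e8 e7) (Move (R2 e8 e9) (Move (R2 e9 e6) (Move (R2
    e1 e2) Unlink)))))))
      ?cs [] ?p = Some (46912, 20)"
    by code_simp
  show "dyadic (46912, 20) = 733 / 16384" by (simp add: dyadic_def)
qed

lemma L10n95_10_value:
  assumes "is_invariant_F F"
  shows "has_values (F_set F [1, 1, 1] L10n95_10) (-1697 / 16384)"
proof (rule F_set_eval[OF assms])
  let ?cs = "[Xp e9 e2 e8 e1, Xp e3 e10 e4 e11, Xm e14 e5 e15 e6, Xm e16 e8 e17 e7, Xm e10 e20 e9
    e13, Xm e18 e12 e19 e11, Xm e4 e13 e5 e14, Xm e6 e15 e1 e16, Xm e7 e17 e12 e18, Xm
    e19 e2 e20 e3]"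
  let ?p = "(0, [(e7, 1), (e13, 2)])"
  show "L10n95_10 = dg ?cs []" by (simp add: L10n95_10_def pd_link_def dg_def)
  show "valid ?cs [] ?p \<and> components_coloured ?cs ?p \<and>
    eval (Separate 0 2 [e4, e6] (Move (R2 e14 e15) (Move (R3 e13 e9 e10) (Move (R2 e20 e19)
    (Separate 1 2 [e9, e7] (Move (R2 e14 e17) (Move (R2 e19 e14) (Separate 0 1 [e5] (Move (R2
    e10 e9) Unlink) (Skein e10 (Move (R2 e4 e5) Unlink) (Move (R1 e10) Unlink)) (Move (R2 e10
    e9) Unlink)))) (Separate 0 1 [e5] (Move (R2 e10 e11) (Skein e14 (Move (R2 e8 e7) (Skein
    e11 (Move (R2 e19 e14) Unlink) (Move (R1 e11) Unlink))) (Skein e11 (Move (R2 e19 e14)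
    (Move (R1 e11) Unlink)) (Skein e18 (Move (R2 e12 e11) Unlink) (Move (R1 e18) Unlink)))))
    (Skein e10 (Move (R2 e5 e4) (Skein e14 (Move (R2 e8 e7) (Skein e11 (Move (R2 e19 e14)
    Unlink) (Move (R1 e11) Unlink))) (Skein e11 (Move (R2 e19 e14) (Move (R1 e11) Unlink))
    (Skein e18 (Move (R2 e12 e11) Unlink) (Move (R1 e18) Unlink))))) (Move (R1 e10) (Skein e14
    (Move (R2 e8 e7) (Skein e11 (Move (R2 e19 e14) Unlink) (Move (R1 e11) Unlink))) (Skein e11
    (Move (R2 e19 e14) (Move (R1 e11) Unlink)) (Skein e18 (Move (R2 e12 e11) Unlink) (Move (R1
    e18) Unlink)))))) (Move (R2 e10 e11) (Skein e14 (Move (R2 e8 e7) (Skein e11 (Move (R2 e19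
    e14) Unlink) (Move (R1 e11) Unlink))) (Skein e11 (Move (R2 e19 e14) (Move (R1 e11)
    Unlink)) (Skein e18 (Move (R2 e12 e11) Unlink) (Move (R1 e18) Unlink)))))) (Move (R2 e14
    e17) (Move (R2 e19 e14) (Separate 0 1 [e5] (Move (R2 e10 e9) Unlink) (Skein e10 (Move (R2
    e4 e5) Unlink) (Move (R1 e10) Unlink)) (Move (R2 e10 e9) Unlink)))))))) (Separate 0 1 [e3,
    e16, e18] (Move (R2 e8 e7) (Move (R3 e19 e9 e10) (Move (R2 e10 e11) (Move (R2 e8 e11)
    (Skein e14 (Move (R2 e5 e6) (Skein e2 (Move (R2 e13 e14) Unlink) (Move (R1 e2) Unlink)))
    (Skein e2 (Move (R2 e13 e14) (Move (R1 e2) Unlink)) (Skein e2 (Move (R2 e13 e16) Unlink)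
    (Move (R1 e2) Unlink)))))))) (Skein e14 (Move (R2 e5 e6) (Skein e10 (Move (R3 e3 e20 e19)
    (Move (R2 e18 e19) (Skein e9 (Move (R2 e2 e5) (Skein e14 (Move (R2 e12 e7) (Skein e4 (Move
    (R2 e13 e14) Unlink) (Move (R1 e4) Unlink))) (Move (R1 e14) (Skein e4 (Move (R2 e13 e14)
    Unlink) (Move (R1 e4) Unlink))))) (Move (R1 e9) (Skein e14 (Move (R2 e5 e7) (Skein e4
    (Move (R2 e13 e14) Unlink) (Move (R1 e4) Unlink))) (Skein e4 (Move (R2 e13 e14) (Move (R1
    e4) Unlink)) (Skein e4 (Move (R2 e13 e18) Unlink) (Move (R1 e4) Unlink)))))))) (Move (R2
    e20 e19) (Move (R2 e5 e4) (Skein e11 (Move (R2 e19 e7) (Move (R1 e11) Unlink)) (Skein e18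
    (Move (R2 e12 e11) Unlink) (Move (R1 e18) Unlink))))))) (Skein e4 (Move (R2 e13 e14) (Move
    (R2 e10 e9) (Move (R2 e3 e4) (Move (R1 e19) (Skein e18 (Move (R2 e12 e11) Unlink) (Move
    (R1 e18) Unlink)))))) (Skein e10 (Move (R3 e3 e20 e19) (Move (R2 e18 e19) (Skein e9 (Move
    (R2 e2 e1) (Skein e16 (Move (R2 e12 e7) (Skein e4 (Move (R2 e13 e16) Unlink) (Move (R1 e4)
    Unlink))) (Move (R1 e16) (Skein e4 (Move (R2 e13 e16) Unlink) (Move (R1 e4) Unlink)))))
    (Move (R1 e9) (Skein e16 (Move (R2 e1 e7) (Skein e4 (Move (R2 e13 e16) Unlink) (Move (R1
    e4) Unlink))) (Skein e4 (Move (R2 e13 e16) (Move (R1 e4) Unlink)) (Skein e4 (Move (R2 e13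
    e18) Unlink) (Move (R1 e4) Unlink)))))))) (Move (R2 e20 e19) (Move (R2 e1 e4) (Skein e11
    (Move (R2 e19 e7) (Move (R1 e11) Unlink)) (Skein e18 (Move (R2 e12 e11) Unlink) (Move (R1
    e18) Unlink)))))))) (Move (R2 e8 e7) (Move (R3 e19 e9 e10) (Move (R2 e10 e11) (Move (R2 e8
    e11) (Skein e14 (Move (R2 e5 e6) (Skein e2 (Move (R2 e13 e14) Unlink) (Move (R1 e2)
    Unlink))) (Skein e2 (Move (R2 e13 e14) (Move (R1 e2) Unlink)) (Skein e2 (Move (R2 e13 e16)
    Unlink) (Move (R1 e2) Unlink))))))))) (Move (R2 e14 e15) (Move (R3 e13 e9 e10) (Move (R2
    e20 e19) (Separate 0 1 [e5, e14, e18] (Move (R2 e10 e11) (Move (R2 e8 e7) (Move (R2 e11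
    e8) Unlink))) (Skein e10 (Move (R2 e5 e4) (Skein e14 (Move (R2 e8 e7) (Skein e11 (Move (R2
    e19 e14) Unlink) (Move (R1 e11) Unlink))) (Skein e11 (Move (R2 e19 e14) (Move (R1 e11)
    Unlink)) (Skein e18 (Move (R2 e12 e11) Unlink) (Move (R1 e18) Unlink))))) (Move (R1 e10)
    (Skein e14 (Move (R2 e8 e7) (Skein e11 (Move (R2 e19 e14) Unlink) (Move (R1 e11) Unlink)))
    (Skein e11 (Move (R2 e19 e14) (Move (R1 e11) Unlink)) (Skein e18 (Move (R2 e12 e11)
    Unlink) (Move (R1 e18) Unlink)))))) (Move (R2 e10 e11) (Move (R2 e8 e7) (Move (R2 e11 e8)
    Unlink))))))))
      ?cs [] ?p = Some (-54304, 19)"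
    by code_simp
  show "dyadic (-54304, 19) = -1697 / 16384" by (simp add: dyadic_def)
qed

lemma L11a404_11_value:
  assumes "is_invariant_F F"
  shows "has_values (F_set F [1, 1, 1] L11a404_11) (481 / 4)"
proof (rule F_set_eval[OF assms])
  let ?cs = "[Xp e7 e2 e6 e1, Xp e13 e4 e12 e3, Xp e2 e5 e3 e6, Xm e15 e8 e14 e7, Xm e19 e10 e18
    e9, Xp e4 e11 e1 e12, Xm e5 e14 e10 e13, Xp e21 e15 e20 e16, Xm e9 e18 e8 e17, Xp e11
    e19 e22 e20, Xp e17 e21 e16 e22]"
  let ?p = "(0, [(e5, 1), (e11, 2)])"
  show "L11a404_11 = dg ?cs []" by (simp add: L11a404_11_def pd_link_def dg_def)
  \<comment> \<open>The first two changes put the second component above the third, which is a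
    positive trefoil by itself. No separation affects its three self-crossings; the recurring
    subtrees at \<open>Skein e21\<close> resolve them.\<close>
  show "valid ?cs [] ?p \<and> components_coloured ?cs ?p \<and>
    eval (Separate 1 2 [e5, e9] (Move (R2 e19 e18) (Move (R2 e14 e15) (Separate 0 1 [e2] (Move (R2
    e5 e6) (Separate 0 2 [e4] (Move (R2 e15 e12) (Skein e21 (Move (R2 e16 e15) (Move (R1 e21)
    Unlink)) (Skein e21 (Move (R2 e16 e19) Unlink) (Move (R1 e21) Unlink)))) (Skein e15 (Move
    (R2 e1 e4) (Skein e21 (Move (R2 e16 e15) (Move (R1 e21) Unlink)) (Skein e21 (Move (R2 e16
    e19) Unlink) (Move (R1 e21) Unlink)))) (Move (R1 e15) (Skein e21 (Move (R2 e16 e15) (Move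
    (R1 e21) Unlink)) (Skein e21 (Move (R2 e16 e19) Unlink) (Move (R1 e21) Unlink))))) (Move
    (R2 e15 e12) (Skein e21 (Move (R2 e16 e15) (Move (R1 e21) Unlink)) (Skein e21 (Move (R2
    e16 e19) Unlink) (Move (R1 e21) Unlink)))))) (Separate 0 2 [e4] (Move (R2 e15 e12) (Skein
    e5 (Move (R2 e3 e2) (Skein e21 (Move (R2 e16 e15) (Move (R1 e21) Unlink)) (Skein e21 (Move
    (R2 e16 e19) Unlink) (Move (R1 e21) Unlink)))) (Move (R1 e5) (Skein e21 (Move (R2 e16 e15)
    (Move (R1 e21) Unlink)) (Skein e21 (Move (R2 e16 e19) Unlink) (Move (R1 e21) Unlink))))))
    (Skein e5 (Move (R2 e1 e2) (Skein e15 (Move (R2 e1 e4) (Skein e21 (Move (R2 e16 e15) (Move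
    (R1 e21) Unlink)) (Skein e21 (Move (R2 e16 e19) Unlink) (Move (R1 e21) Unlink)))) (Move
    (R1 e15) (Skein e21 (Move (R2 e16 e15) (Move (R1 e21) Unlink)) (Skein e21 (Move (R2 e16
    e19) Unlink) (Move (R1 e21) Unlink)))))) (Move (R1 e5) (Skein e15 (Move (R2 e1 e4) (Skein
    e21 (Move (R2 e16 e15) (Move (R1 e21) Unlink)) (Skein e21 (Move (R2 e16 e19) Unlink) (Move
    (R1 e21) Unlink)))) (Move (R1 e15) (Skein e21 (Move (R2 e16 e15) (Move (R1 e21) Unlink))
    (Skein e21 (Move (R2 e16 e19) Unlink) (Move (R1 e21) Unlink))))))) (Move (R2 e15 e12)
    (Skein e5 (Move (R2 e3 e2) (Skein e21 (Move (R2 e16 e15) (Move (R1 e21) Unlink)) (Skein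
    e21 (Move (R2 e16 e19) Unlink) (Move (R1 e21) Unlink)))) (Move (R1 e5) (Skein e21 (Move
    (R2 e16 e15) (Move (R1 e21) Unlink)) (Skein e21 (Move (R2 e16 e19) Unlink) (Move (R1 e21)
    Unlink))))))) (Move (R2 e5 e6) (Separate 0 2 [e4] (Move (R2 e15 e12) (Skein e21 (Move (R2
    e16 e15) (Move (R1 e21) Unlink)) (Skein e21 (Move (R2 e16 e19) Unlink) (Move (R1 e21)
    Unlink)))) (Skein e15 (Move (R2 e1 e4) (Skein e21 (Move (R2 e16 e15) (Move (R1 e21)
    Unlink)) (Skein e21 (Move (R2 e16 e19) Unlink) (Move (R1 e21) Unlink)))) (Move (R1 e15)
    (Skein e21 (Move (R2 e16 e15) (Move (R1 e21) Unlink)) (Skein e21 (Move (R2 e16 e19)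
    Unlink) (Move (R1 e21) Unlink))))) (Move (R2 e15 e12) (Skein e21 (Move (R2 e16 e15) (Move
    (R1 e21) Unlink)) (Skein e21 (Move (R2 e16 e19) Unlink) (Move (R1 e21) Unlink)))))))))
    (Separate 0 1 [e2, e4] (Move (R2 e7 e6) (Move (R2 e13 e12) (Skein e21 (Move (R2 e17 e16)
    (Move (R1 e13) (Skein e17 (Move (R2 e8 e7) (Skein e17 (Move (R2 e9 e8) Unlink) (Move (R1
    e17) Unlink))) (Skein e13 (Move (R2 e10 e9) (Move (R1 e13) Unlink)) (Skein e17 (Move (R2
    e8 e13) Unlink) (Move (R1 e17) Unlink)))))) (Skein e13 (Move (R2 e16 e17) (Skein e13 (Move
    (R2 e8 e7) (Skein e17 (Move (R2 e8 e9) Unlink) (Move (R1 e17) Unlink))) (Move (R1 e13)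
    (Skein e17 (Move (R2 e9 e8) Unlink) (Move (R1 e17) Unlink))))) (Move (R1 e17) (Skein e17
    (Move (R2 e8 e7) (Skein e17 (Move (R2 e9 e8) Unlink) (Move (R1 e17) Unlink))) (Skein e13
    (Move (R2 e10 e9) (Move (R1 e13) Unlink)) (Skein e17 (Move (R2 e8 e13) Unlink) (Move (R1
    e17) Unlink))))))))) (Skein e11 (Move (R3 e17 e20 e21) (Move (R1 e21) (Move (R3 e9 e22
    e19) (Move (R1 e19) (Move (R3 e22 e15 e16) (Move (R3 e10 e15 e16) (Move (R1 e16) (Skein
    e19 (Move (R2 e10 e5) (Skein e11 (Move (R2 e8 e5) (Skein e5 (Move (R2 e1 e2) (Skein e11
    (Move (R2 e1 e4) Unlink) (Move (R1 e11) Unlink))) (Move (R1 e5) (Skein e11 (Move (R2 e1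
    e4) Unlink) (Move (R1 e11) Unlink))))) (Move (R1 e5) (Skein e11 (Move (R2 e1 e2) (Skein
    e11 (Move (R2 e1 e4) Unlink) (Move (R1 e11) Unlink))) (Skein e5 (Move (R2 e3 e4) (Move (R1
    e5) Unlink)) (Skein e11 (Move (R2 e1 e5) Unlink) (Move (R1 e11) Unlink))))))) (Move (R1
    e5) (Move (R1 e19) (Move (R1 e11) (Skein e11 (Move (R2 e1 e2) (Skein e11 (Move (R2 e1 e4)
    Unlink) (Move (R1 e11) Unlink))) (Skein e5 (Move (R2 e3 e4) (Move (R1 e5) Unlink)) (Skein
    e11 (Move (R2 e1 e5) Unlink) (Move (R1 e11) Unlink))))))))))))))) (Skein e5 (Move (R3 e2
    e14 e13) (Move (R3 e7 e14 e15) (Move (R2 e14 e13) (Skein e15 (Move (R2 e1 e4) (Skein e8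
    (Move (R2 e4 e3) (Skein e15 (Move (R2 e8 e9) (Skein e21 (Move (R2 e16 e15) Unlink) (Move
    (R1 e21) Unlink))) (Move (R1 e15) (Skein e21 (Move (R2 e16 e15) Unlink) (Move (R1 e21)
    Unlink))))) (Move (R1 e8) (Skein e15 (Move (R2 e8 e9) (Skein e21 (Move (R2 e16 e15)
    Unlink) (Move (R1 e21) Unlink))) (Move (R1 e15) (Skein e21 (Move (R2 e16 e15) Unlink)
    (Move (R1 e21) Unlink))))))) (Move (R1 e4) (Move (R2 e3 e4) (Move (R2 e8 e7) (Skein e21
    (Move (R2 e16 e15) Unlink) (Move (R1 e21) Unlink))))))))) (Skein e11 (Move (R2 e14 e9)
    (Move (R1 e15) (Skein e21 (Move (R2 e16 e11) (Skein e11 (Move (R2 e1 e2) (Skein e11 (Move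
    (R2 e1 e4) Unlink) (Move (R1 e11) Unlink))) (Skein e5 (Move (R2 e3 e4) (Move (R1 e5)
    Unlink)) (Skein e11 (Move (R2 e1 e5) Unlink) (Move (R1 e11) Unlink))))) (Move (R1 e11)
    (Skein e11 (Move (R2 e1 e2) (Skein e11 (Move (R2 e1 e4) Unlink) (Move (R1 e11) Unlink)))
    (Skein e5 (Move (R2 e3 e4) (Move (R1 e5) Unlink)) (Skein e11 (Move (R2 e1 e5) Unlink)
    (Move (R1 e11) Unlink)))))))) (Skein e15 (Move (R2 e8 e11) (Skein e21 (Move (R2 e16 e15)
    (Skein e11 (Move (R2 e1 e2) (Skein e11 (Move (R2 e1 e4) Unlink) (Move (R1 e11) Unlink)))
    (Skein e5 (Move (R2 e3 e4) (Move (R1 e5) Unlink)) (Skein e11 (Move (R2 e1 e5) Unlink)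
    (Move (R1 e11) Unlink))))) (Move (R1 e21) (Skein e11 (Move (R2 e1 e2) (Skein e11 (Move (R2
    e1 e4) Unlink) (Move (R1 e11) Unlink))) (Skein e5 (Move (R2 e3 e4) (Move (R1 e5) Unlink))
    (Skein e11 (Move (R2 e1 e5) Unlink) (Move (R1 e11) Unlink))))))) (Move (R1 e11) (Skein e21
    (Move (R2 e16 e11) (Skein e11 (Move (R2 e1 e2) (Skein e11 (Move (R2 e1 e4) Unlink) (Move
    (R1 e11) Unlink))) (Skein e5 (Move (R2 e3 e4) (Move (R1 e5) Unlink)) (Skein e11 (Move (R2
    e1 e5) Unlink) (Move (R1 e11) Unlink))))) (Move (R1 e11) (Skein e11 (Move (R2 e1 e2)
    (Skein e11 (Move (R2 e1 e4) Unlink) (Move (R1 e11) Unlink))) (Skein e5 (Move (R2 e3 e4)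
    (Move (R1 e5) Unlink)) (Skein e11 (Move (R2 e1 e5) Unlink) (Move (R1 e11)
    Unlink))))))))))) (Move (R2 e7 e6) (Move (R2 e13 e12) (Skein e15 (Move (R2 e8 e7) (Skein
    e19 (Move (R2 e8 e9) (Skein e21 (Move (R2 e16 e15) (Move (R1 e21) Unlink)) (Skein e21
    (Move (R2 e16 e19) Unlink) (Move (R1 e21) Unlink)))) (Move (R1 e19) (Skein e21 (Move (R2
    e16 e15) (Move (R1 e21) Unlink)) (Skein e21 (Move (R2 e16 e19) Unlink) (Move (R1 e21)
    Unlink)))))) (Skein e15 (Move (R3 e19 e8 e9) (Move (R2 e13 e8) (Move (R2 e21 e20) (Move
    (R1 e9) (Move (R1 e21) Unlink))))) (Skein e19 (Move (R2 e8 e9) (Skein e21 (Move (R2 e16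
    e15) (Move (R1 e21) Unlink)) (Skein e21 (Move (R2 e16 e19) Unlink) (Move (R1 e21)
    Unlink)))) (Move (R1 e19) (Skein e21 (Move (R2 e16 e15) (Move (R1 e21) Unlink)) (Skein e21
    (Move (R2 e16 e19) Unlink) (Move (R1 e21) Unlink)))))))))) (Move (R2 e19 e18) (Move (R2
    e14 e15) (Separate 0 1 [e2, e4] (Move (R2 e5 e6) (Move (R2 e15 e12) (Skein e21 (Move (R2
    e16 e15) (Move (R1 e21) Unlink)) (Skein e21 (Move (R2 e16 e19) Unlink) (Move (R1 e21)
    Unlink))))) (Skein e5 (Move (R2 e1 e2) (Skein e15 (Move (R2 e1 e4) (Skein e21 (Move (R2
    e16 e15) (Move (R1 e21) Unlink)) (Skein e21 (Move (R2 e16 e19) Unlink) (Move (R1 e21)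
    Unlink)))) (Move (R1 e15) (Skein e21 (Move (R2 e16 e15) (Move (R1 e21) Unlink)) (Skein e21
    (Move (R2 e16 e19) Unlink) (Move (R1 e21) Unlink)))))) (Move (R1 e5) (Skein e15 (Move (R2
    e1 e4) (Skein e21 (Move (R2 e16 e15) (Move (R1 e21) Unlink)) (Skein e21 (Move (R2 e16 e19)
    Unlink) (Move (R1 e21) Unlink)))) (Move (R1 e15) (Skein e21 (Move (R2 e16 e15) (Move (R1
    e21) Unlink)) (Skein e21 (Move (R2 e16 e19) Unlink) (Move (R1 e21) Unlink))))))) (Move (R2
    e5 e6) (Move (R2 e15 e12) (Skein e21 (Move (R2 e16 e15) (Move (R1 e21) Unlink)) (Skein e21
    (Move (R2 e16 e19) Unlink) (Move (R1 e21) Unlink)))))))))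
      ?cs [] ?p = Some (492544, 12)"
    by code_simp
  show "dyadic (492544, 12) = 481 / 4" by (simp add: dyadic_def)
qed

lemma L11a428_01_value:
  assumes "is_invariant_F F"
  shows "has_values (F_set F [1, 1, 1] L11a428_01) (2177 / 8)"
proof (rule F_set_eval[OF assms])
  let ?cs = "[Xm e6 e1 e7 e2, Xm e13 e3 e12 e4, Xp e15 e6 e14 e5, Xp e21 e8 e20 e7, Xm e2 e9 e3
    e10, Xp e19 e11 e18 e12, Xp e10 e13 e5 e14, Xm e4 e16 e1 e15, Xp e11 e17 e22 e18, Xp
    e8 e19 e9 e20, Xp e17 e21 e16 e22]"
  let ?p = "(0, [(e5, 1), (e11, 2)])"
  show "L11a428_01 = dg ?cs []" by (simp add: L11a428_01_def pd_link_def dg_def)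
  \<comment> \<open>As for the other alternating link, the second component is lifted above the
    third, again a positive trefoil that is left to \<open>Skein e21\<close>.\<close>
  show "valid ?cs [] ?p \<and> components_coloured ?cs ?p \<and>
    eval (Separate 1 2 [e10, e8] (Move (R2 e21 e20) (Move (R2 e14 e15) (Separate 0 1 [e2] (Move (R2
    e10 e7) (Separate 0 2 [e4] (Move (R2 e15 e16) (Skein e21 (Move (R2 e16 e11) (Move (R1 e21)
    Unlink)) (Skein e21 (Move (R2 e16 e17) Unlink) (Move (R1 e21) Unlink)))) (Skein e15 (Move
    (R2 e4 e1) (Skein e21 (Move (R2 e16 e11) (Move (R1 e21) Unlink)) (Skein e21 (Move (R2 e16
    e17) Unlink) (Move (R1 e21) Unlink)))) (Move (R1 e15) (Skein e21 (Move (R2 e16 e11) (Move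
    (R1 e21) Unlink)) (Skein e21 (Move (R2 e16 e17) Unlink) (Move (R1 e21) Unlink))))) (Move
    (R2 e15 e16) (Skein e21 (Move (R2 e16 e11) (Move (R1 e21) Unlink)) (Skein e21 (Move (R2
    e16 e17) Unlink) (Move (R1 e21) Unlink)))))) (Separate 0 2 [e4] (Move (R2 e15 e16) (Skein
    e10 (Move (R2 e3 e2) (Skein e21 (Move (R2 e16 e11) (Move (R1 e21) Unlink)) (Skein e21
    (Move (R2 e16 e17) Unlink) (Move (R1 e21) Unlink)))) (Move (R1 e10) (Skein e21 (Move (R2
    e16 e11) (Move (R1 e21) Unlink)) (Skein e21 (Move (R2 e16 e17) Unlink) (Move (R1 e21)
    Unlink)))))) (Skein e10 (Move (R2 e1 e2) (Skein e15 (Move (R2 e4 e1) (Skein e21 (Move (R2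
    e16 e11) (Move (R1 e21) Unlink)) (Skein e21 (Move (R2 e16 e17) Unlink) (Move (R1 e21)
    Unlink)))) (Move (R1 e15) (Skein e21 (Move (R2 e16 e11) (Move (R1 e21) Unlink)) (Skein e21
    (Move (R2 e16 e17) Unlink) (Move (R1 e21) Unlink)))))) (Move (R1 e10) (Skein e15 (Move (R2
    e4 e1) (Skein e21 (Move (R2 e16 e11) (Move (R1 e21) Unlink)) (Skein e21 (Move (R2 e16 e17)
    Unlink) (Move (R1 e21) Unlink)))) (Move (R1 e15) (Skein e21 (Move (R2 e16 e11) (Move (R1
    e21) Unlink)) (Skein e21 (Move (R2 e16 e17) Unlink) (Move (R1 e21) Unlink))))))) (Move (R2
    e15 e16) (Skein e10 (Move (R2 e3 e2) (Skein e21 (Move (R2 e16 e11) (Move (R1 e21) Unlink))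
    (Skein e21 (Move (R2 e16 e17) Unlink) (Move (R1 e21) Unlink)))) (Move (R1 e10) (Skein e21
    (Move (R2 e16 e11) (Move (R1 e21) Unlink)) (Skein e21 (Move (R2 e16 e17) Unlink) (Move (R1
    e21) Unlink))))))) (Move (R2 e10 e7) (Separate 0 2 [e4] (Move (R2 e15 e16) (Skein e21
    (Move (R2 e16 e11) (Move (R1 e21) Unlink)) (Skein e21 (Move (R2 e16 e17) Unlink) (Move (R1
    e21) Unlink)))) (Skein e15 (Move (R2 e4 e1) (Skein e21 (Move (R2 e16 e11) (Move (R1 e21)
    Unlink)) (Skein e21 (Move (R2 e16 e17) Unlink) (Move (R1 e21) Unlink)))) (Move (R1 e15)
    (Skein e21 (Move (R2 e16 e11) (Move (R1 e21) Unlink)) (Skein e21 (Move (R2 e16 e17)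
    Unlink) (Move (R1 e21) Unlink))))) (Move (R2 e15 e16) (Skein e21 (Move (R2 e16 e11) (Move
    (R1 e21) Unlink)) (Skein e21 (Move (R2 e16 e17) Unlink) (Move (R1 e21) Unlink)))))))))
    (Separate 0 1 [e2, e4] (Move (R3 e6 e16 e15) (Move (R3 e13 e5 e10) (Move (R2 e14 e15)
    (Move (R2 e10 e9) (Skein e16 (Move (R2 e6 e9) (Skein e21 (Move (R2 e9 e8) (Skein e21 (Move
    (R2 e16 e11) (Move (R1 e21) Unlink)) (Skein e21 (Move (R2 e16 e17) Unlink) (Move (R1 e21)
    Unlink)))) (Move (R1 e21) (Skein e21 (Move (R2 e16 e11) (Move (R1 e21) Unlink)) (Skein e21
    (Move (R2 e16 e17) Unlink) (Move (R1 e21) Unlink)))))) (Move (R1 e9) (Skein e21 (Move (R2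
    e16 e8) (Skein e21 (Move (R2 e16 e11) (Move (R1 e21) Unlink)) (Skein e21 (Move (R2 e16
    e17) Unlink) (Move (R1 e21) Unlink)))) (Skein e19 (Move (R2 e9 e11) (Skein e21 (Move (R2
    e16 e19) Unlink) (Move (R1 e21) Unlink))) (Skein e19 (Move (R2 e9 e17) (Move (R1 e19)
    Unlink)) (Skein e21 (Move (R2 e16 e19) Unlink) (Move (R1 e21) Unlink))))))))))) (Skein e21
    (Move (R2 e7 e8) (Skein e15 (Move (R2 e5 e10) (Skein e10 (Move (R2 e1 e2) (Skein e15 (Move
    (R2 e4 e1) (Skein e21 (Move (R2 e16 e11) (Move (R1 e21) Unlink)) (Skein e21 (Move (R2 e16
    e17) Unlink) (Move (R1 e21) Unlink)))) (Move (R1 e15) (Skein e21 (Move (R2 e16 e11) (Move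
    (R1 e21) Unlink)) (Skein e21 (Move (R2 e16 e17) Unlink) (Move (R1 e21) Unlink)))))) (Move
    (R1 e10) (Skein e15 (Move (R2 e4 e1) (Skein e21 (Move (R2 e16 e11) (Move (R1 e21) Unlink))
    (Skein e21 (Move (R2 e16 e17) Unlink) (Move (R1 e21) Unlink)))) (Move (R1 e15) (Skein e21
    (Move (R2 e16 e11) (Move (R1 e21) Unlink)) (Skein e21 (Move (R2 e16 e17) Unlink) (Move (R1
    e21) Unlink)))))))) (Move (R1 e10) (Skein e21 (Move (R2 e12 e11) (Move (R1 e21) (Skein e15
    (Move (R2 e1 e2) (Skein e15 (Move (R2 e1 e4) Unlink) (Move (R1 e15) Unlink))) (Skein e10
    (Move (R2 e3 e4) (Move (R1 e10) Unlink)) (Skein e15 (Move (R2 e1 e10) Unlink) (Move (R1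
    e15) Unlink)))))) (Skein e21 (Move (R2 e12 e17) (Skein e15 (Move (R2 e1 e2) (Skein e15
    (Move (R2 e1 e4) Unlink) (Move (R1 e15) Unlink))) (Skein e10 (Move (R2 e3 e4) (Move (R1
    e10) Unlink)) (Skein e15 (Move (R2 e1 e10) Unlink) (Move (R1 e15) Unlink))))) (Move (R1
    e21) (Skein e15 (Move (R2 e1 e2) (Skein e15 (Move (R2 e1 e4) Unlink) (Move (R1 e15)
    Unlink))) (Skein e10 (Move (R2 e3 e4) (Move (R1 e10) Unlink)) (Skein e15 (Move (R2 e1 e10)
    Unlink) (Move (R1 e15) Unlink)))))))))) (Skein e6 (Move (R3 e15 e1 e4) (Move (R3 e10 e1
    e4) (Move (R2 e2 e1) (Move (R3 e16 e21 e9) (Move (R1 e9) (Skein e13 (Move (R2 e4 e1)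
    (Skein e15 (Move (R2 e9 e19) (Skein e21 (Move (R2 e16 e15) (Move (R1 e21) Unlink)) (Skein
    e21 (Move (R2 e16 e17) Unlink) (Move (R1 e21) Unlink)))) (Skein e15 (Move (R2 e9 e11)
    (Skein e21 (Move (R2 e16 e15) Unlink) (Move (R1 e21) Unlink))) (Skein e21 (Move (R2 e16
    e15) (Move (R1 e21) Unlink)) (Skein e21 (Move (R2 e16 e17) Unlink) (Move (R1 e21)
    Unlink)))))) (Move (R1 e13) (Skein e15 (Move (R2 e9 e19) (Skein e21 (Move (R2 e16 e15)
    (Move (R1 e21) Unlink)) (Skein e21 (Move (R2 e16 e17) Unlink) (Move (R1 e21) Unlink))))
    (Skein e15 (Move (R2 e9 e11) (Skein e21 (Move (R2 e16 e15) Unlink) (Move (R1 e21)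
    Unlink))) (Skein e21 (Move (R2 e16 e15) (Move (R1 e21) Unlink)) (Skein e21 (Move (R2 e16
    e17) Unlink) (Move (R1 e21) Unlink)))))))))))) (Skein e21 (Move (R3 e17 e1 e4) (Move (R3
    e11 e1 e19) (Move (R2 e1 e4) (Move (R1 e4) (Move (R2 e13 e12) (Move (R2 e3 e6) (Move (R1
    e6) (Move (R1 e13) Unlink)))))))) (Skein e15 (Move (R2 e5 e10) (Move (R1 e10) (Skein e15
    (Move (R2 e4 e1) (Skein e21 (Move (R2 e16 e11) (Move (R1 e21) Unlink)) (Skein e21 (Move
    (R2 e16 e17) Unlink) (Move (R1 e21) Unlink)))) (Move (R1 e15) (Skein e21 (Move (R2 e16
    e11) (Move (R1 e21) Unlink)) (Skein e21 (Move (R2 e16 e17) Unlink) (Move (R1 e21)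
    Unlink))))))) (Move (R1 e10) (Skein e10 (Move (R2 e15 e3) (Move (R1 e15) (Skein e21 (Move
    (R2 e16 e11) (Move (R1 e21) Unlink)) (Skein e21 (Move (R2 e16 e17) Unlink) (Move (R1 e21)
    Unlink))))) (Skein e15 (Move (R2 e10 e1) (Skein e21 (Move (R2 e16 e11) (Move (R1 e21)
    Unlink)) (Skein e21 (Move (R2 e16 e17) Unlink) (Move (R1 e21) Unlink)))) (Move (R1 e15)
    (Skein e21 (Move (R2 e16 e11) (Move (R1 e21) Unlink)) (Skein e21 (Move (R2 e16 e17)
    Unlink) (Move (R1 e21) Unlink))))))))))) (Move (R3 e6 e16 e15) (Move (R3 e13 e5 e10) (Move
    (R2 e14 e15) (Move (R2 e10 e9) (Skein e16 (Move (R2 e6 e9) (Skein e21 (Move (R2 e9 e8)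
    (Skein e21 (Move (R2 e16 e11) (Move (R1 e21) Unlink)) (Skein e21 (Move (R2 e16 e17)
    Unlink) (Move (R1 e21) Unlink)))) (Move (R1 e21) (Skein e21 (Move (R2 e16 e11) (Move (R1
    e21) Unlink)) (Skein e21 (Move (R2 e16 e17) Unlink) (Move (R1 e21) Unlink)))))) (Move (R1
    e9) (Skein e21 (Move (R2 e16 e8) (Skein e21 (Move (R2 e16 e11) (Move (R1 e21) Unlink))
    (Skein e21 (Move (R2 e16 e17) Unlink) (Move (R1 e21) Unlink)))) (Skein e19 (Move (R2 e9
    e11) (Skein e21 (Move (R2 e16 e19) Unlink) (Move (R1 e21) Unlink))) (Skein e19 (Move (R2
    e9 e17) (Move (R1 e19) Unlink)) (Skein e21 (Move (R2 e16 e19) Unlink) (Move (R1 e21)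
    Unlink)))))))))))) (Move (R2 e21 e20) (Move (R2 e14 e15) (Separate 0 1 [e2, e4] (Move (R2
    e10 e7) (Move (R2 e15 e16) (Skein e21 (Move (R2 e16 e11) (Move (R1 e21) Unlink)) (Skein
    e21 (Move (R2 e16 e17) Unlink) (Move (R1 e21) Unlink))))) (Skein e10 (Move (R2 e1 e2)
    (Skein e15 (Move (R2 e4 e1) (Skein e21 (Move (R2 e16 e11) (Move (R1 e21) Unlink)) (Skein
    e21 (Move (R2 e16 e17) Unlink) (Move (R1 e21) Unlink)))) (Move (R1 e15) (Skein e21 (Move
    (R2 e16 e11) (Move (R1 e21) Unlink)) (Skein e21 (Move (R2 e16 e17) Unlink) (Move (R1 e21)
    Unlink)))))) (Move (R1 e10) (Skein e15 (Move (R2 e4 e1) (Skein e21 (Move (R2 e16 e11)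
    (Move (R1 e21) Unlink)) (Skein e21 (Move (R2 e16 e17) Unlink) (Move (R1 e21) Unlink))))
    (Move (R1 e15) (Skein e21 (Move (R2 e16 e11) (Move (R1 e21) Unlink)) (Skein e21 (Move (R2
    e16 e17) Unlink) (Move (R1 e21) Unlink))))))) (Move (R2 e10 e7) (Move (R2 e15 e16) (Skein
    e21 (Move (R2 e16 e11) (Move (R1 e21) Unlink)) (Skein e21 (Move (R2 e16 e17) Unlink) (Move
    (R1 e21) Unlink)))))))))
      ?cs [] ?p = Some (557312, 11)"
    by code_simp
  show "dyadic (557312, 11) = 2177 / 8" by (simp add: dyadic_def)
qed

lemma L10n76_11_value:
  assumes "is_invariant_F F"
  shows "has_values (F_set F [1, 1, 1] L10n76_11) (209 / 8192)"
proof (rule F_set_eval[OF assms])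
  let ?cs = "[Xp e7 e2 e6 e1, Xm e9 e3 e8 e4, Xm e6 e15 e5 e14, Xm e17 e8 e16 e7, Xm e10 e19 e9
    e18, Xm e12 e13 e11 e20, Xm e14 e11 e13 e10, Xm e2 e16 e3 e15, Xp e4 e17 e1 e18, Xm
    e20 e5 e19 e12]"
  let ?p = "(0, [(e5, 1), (e13, 2)])"
  show "L10n76_11 = dg ?cs []" by (simp add: L10n76_11_def pd_link_def dg_def)
  \<comment> \<open>Three changes put the third component above the second and already yield an
    unlink up to moves.\<close>
  show "valid ?cs [] ?p \<and> components_coloured ?cs ?p \<and>
    eval (Separate 2 1 [e17, e14, e20] (Move (R2 e12 e5) (Move (R2 e6 e5) (Move (R3 e2 e8 e7) (Move
    (R2 e8 e9) (Move (R2 e9 e6) (Move (R2 e1 e2) Unlink)))))) (Separate 0 2 [e2, e4] (Move (R3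
    e7 e16 e17) (Move (R2 e8 e9) (Move (R2 e17 e18) (Skein e12 (Move (R2 e13 e14) (Skein e6
    (Move (R2 e15 e14) (Skein e18 (Move (R2 e9 e6) Unlink) (Move (R1 e18) Unlink))) (Skein e18
    (Move (R2 e9 e6) (Move (R1 e18) Unlink)) (Skein e12 (Move (R2 e19 e18) Unlink) (Move (R1
    e12) Unlink))))) (Move (R1 e14) (Move (R1 e12) (Skein e6 (Move (R2 e15 e14) (Move (R1 e6)
    Unlink)) (Skein e18 (Move (R2 e9 e6) Unlink) (Move (R1 e18) Unlink))))))))) (Skein e17
    (Move (R3 e2 e6 e7) (Move (R2 e8 e7) (Move (R2 e8 e9) (Move (R2 e2 e1) (Skein e10 (Move
    (R2 e19 e20) (Skein e10 (Move (R2 e13 e20) Unlink) (Move (R1 e10) Unlink))) (Move (R1 e10)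
    (Move (R1 e12) (Move (R1 e12) Unlink)))))))) (Skein e9 (Move (R2 e3 e2) (Skein e6 (Move
    (R3 e20 e9 e10) (Move (R3 e12 e9 e10) (Move (R2 e9 e14) (Move (R1 e12) (Move (R1 e5) (Move
    (R1 e5) (Skein e17 (Move (R2 e1 e2) Unlink) (Move (R1 e17) Unlink)))))))) (Skein e10 (Move
    (R2 e19 e20) (Skein e17 (Move (R2 e2 e1) (Skein e10 (Move (R2 e13 e20) Unlink) (Move (R1
    e10) Unlink))) (Move (R1 e17) (Skein e10 (Move (R2 e13 e20) Unlink) (Move (R1 e10)
    Unlink))))) (Move (R1 e20) (Move (R1 e20) (Move (R1 e6) (Skein e17 (Move (R2 e1 e2)
    Unlink) (Move (R1 e17) Unlink)))))))) (Move (R2 e10 e9) (Move (R1 e2) (Move (R2 e19 e6)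
    (Move (R1 e10) (Move (R1 e12) (Move (R1 e12) Unlink)))))))) (Move (R3 e7 e16 e17) (Move
    (R2 e8 e9) (Move (R2 e17 e18) (Skein e12 (Move (R2 e13 e14) (Skein e6 (Move (R2 e15 e14)
    (Skein e18 (Move (R2 e9 e6) Unlink) (Move (R1 e18) Unlink))) (Skein e18 (Move (R2 e9 e6)
    (Move (R1 e18) Unlink)) (Skein e12 (Move (R2 e19 e18) Unlink) (Move (R1 e12) Unlink)))))
    (Move (R1 e14) (Move (R1 e12) (Skein e6 (Move (R2 e15 e14) (Move (R1 e6) Unlink)) (Skein
    e18 (Move (R2 e9 e6) Unlink) (Move (R1 e18) Unlink)))))))))) (Move (R2 e12 e5) (Move (R2
    e6 e5) (Move (R3 e2 e8 e7) (Move (R2 e8 e9) (Move (R2 e9 e6) (Move (R2 e1 e2)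
    Unlink)))))))
      ?cs [] ?p = Some (3344, 17)"
    by code_simp
  show "dyadic (3344, 17) = 209 / 8192" by (simp add: dyadic_def)
qed

lemma L11n425_10_value:
  assumes "is_invariant_F F"
  shows "has_values (F_set F [1, 1, 1] L11n425_10) (-2221 / 8192)"
proof (rule F_set_eval[OF assms])
  let ?cs = "[Xp e9 e2 e8 e1, Xp e3 e10 e4 e11, Xm e5 e14 e6 e15, Xm e16 e8 e17 e7, Xm e10 e18 e9
    e19, Xm e12 e22 e11 e13, Xm e13 e4 e14 e5, Xp e20 e16 e21 e15, Xm e17 e2 e18 e3, Xm
    e6 e19 e1 e20, Xm e21 e7 e22 e12]"
  let ?p = "(0, [(e7, 1), (e13, 2)])"
  show "L11n425_10 = dg ?cs []" by (simp add: L11n425_10_def pd_link_def dg_def)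
  \<comment> \<open>The changes at \<open>e5\<close> and \<open>e6\<close> put the first component
    above the third; colours \<open>1, 2\<close> and \<open>0, 1\<close> are separated
    afterwards.\<close>
  show "valid ?cs [] ?p \<and> components_coloured ?cs ?p \<and>
    eval (Separate 0 2 [e5, e6] (Move (R2 e13 e14) (Move (R3 e12 e20 e21) (Move (R1 e21) (Move (R3
    e17 e9 e10) (Move (R2 e19 e18) (Separate 1 2 [e9, e7] (Move (R2 e16 e21) (Move (R2 e21
    e18) (Separate 0 1 [e3] (Move (R2 e10 e9) Unlink) (Skein e10 (Move (R2 e4 e3) Unlink)
    (Move (R1 e10) Unlink)) (Move (R2 e10 e9) Unlink)))) (Separate 0 1 [e3] (Move (R2 e10 e11)
    (Skein e16 (Move (R2 e8 e11) (Skein e11 (Move (R2 e21 e16) Unlink) (Move (R1 e11)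
    Unlink))) (Move (R1 e11) (Move (R1 e16) (Move (R1 e11) Unlink))))) (Skein e16 (Move (R2 e8
    e9) (Skein e10 (Move (R2 e3 e4) (Skein e11 (Move (R2 e21 e16) Unlink) (Move (R1 e11)
    Unlink))) (Move (R1 e10) (Skein e11 (Move (R2 e21 e16) Unlink) (Move (R1 e11) Unlink)))))
    (Move (R1 e9) (Move (R1 e16) (Move (R1 e9) (Skein e10 (Move (R2 e4 e3) Unlink) (Move (R1
    e10) Unlink)))))) (Move (R2 e10 e11) (Skein e16 (Move (R2 e8 e11) (Skein e11 (Move (R2 e21
    e16) Unlink) (Move (R1 e11) Unlink))) (Move (R1 e11) (Move (R1 e16) (Move (R1 e11)
    Unlink)))))) (Move (R2 e16 e21) (Move (R2 e21 e18) (Separate 0 1 [e3] (Move (R2 e10 e9)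
    Unlink) (Skein e10 (Move (R2 e4 e3) Unlink) (Move (R1 e10) Unlink)) (Move (R2 e10 e9)
    Unlink)))))))))) (Separate 0 1 [e3, e16, e21] (Move (R2 e7 e12) (Move (R3 e5 e20 e21)
    (Move (R1 e21) (Move (R3 e17 e9 e8) (Move (R2 e8 e7) (Move (R2 e9 e8) (Skein e2 (Move (R2
    e21 e20) (Skein e20 (Move (R2 e1 e2) Unlink) (Move (R1 e20) Unlink))) (Move (R1 e20) (Move
    (R1 e2) (Move (R1 e20) Unlink)))))))))) (Skein e16 (Move (R3 e17 e9 e8) (Move (R2 e9 e10)
    (Move (R3 e20 e5 e6) (Move (R3 e6 e17 e16) (Move (R1 e16) (Skein e13 (Move (R3 e12 e4 e3)
    (Move (R3 e1 e11 e10) (Move (R2 e3 e2) (Skein e10 (Move (R2 e22 e21) (Skein e11 (Move (R2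
    e1 e2) (Skein e21 (Move (R2 e6 e1) Unlink) (Move (R1 e21) Unlink))) (Move (R1 e11) (Skein
    e21 (Move (R2 e6 e1) Unlink) (Move (R1 e21) Unlink))))) (Move (R2 e10 e11) (Move (R2 e6
    e5) (Move (R1 e12) Unlink))))))) (Skein e10 (Move (R2 e3 e2) (Move (R1 e1) (Move (R1 e1)
    (Move (R1 e13) (Skein e12 (Move (R2 e22 e13) Unlink) (Move (R1 e12) Unlink)))))) (Move (R1
    e10) (Skein e12 (Move (R2 e21 e22) (Move (R1 e1) (Move (R1 e1) (Move (R1 e21) Unlink))))
    (Skein e1 (Move (R2 e22 e21) (Skein e21 (Move (R2 e6 e1) Unlink) (Move (R1 e21) Unlink)))
    (Move (R1 e1) (Move (R1 e12) (Move (R1 e12) Unlink))))))))))))) (Move (R2 e9 e8) (Move (R2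
    e20 e21) (Move (R1 e10) (Move (R2 e1 e6) (Move (R1 e15) (Skein e5 (Move (R2 e14 e15)
    Unlink) (Move (R1 e5) Unlink)))))))) (Move (R2 e7 e12) (Move (R3 e5 e20 e21) (Move (R1
    e21) (Move (R3 e17 e9 e8) (Move (R2 e8 e7) (Move (R2 e9 e8) (Skein e2 (Move (R2 e21 e20)
    (Skein e20 (Move (R2 e1 e2) Unlink) (Move (R1 e20) Unlink))) (Move (R1 e20) (Move (R1 e2)
    (Move (R1 e20) Unlink))))))))))) (Move (R2 e13 e14) (Move (R3 e12 e20 e21) (Move (R1 e21)
    (Move (R3 e17 e9 e10) (Move (R2 e19 e18) (Separate 0 1 [e3, e16, e18] (Move (R2 e10 e11)
    (Move (R2 e8 e11) (Move (R2 e11 e12) Unlink))) (Skein e16 (Move (R2 e8 e9) (Skein e10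
    (Move (R2 e3 e4) (Skein e11 (Move (R2 e21 e16) Unlink) (Move (R1 e11) Unlink))) (Move (R1
    e10) (Skein e11 (Move (R2 e21 e16) Unlink) (Move (R1 e11) Unlink))))) (Move (R1 e9) (Move
    (R1 e16) (Move (R1 e9) (Skein e10 (Move (R2 e4 e3) Unlink) (Move (R1 e10) Unlink))))))
    (Move (R2 e10 e11) (Move (R2 e8 e11) (Move (R2 e11 e12) Unlink))))))))))
      ?cs [] ?p = Some (-17768, 16)"
    by code_simp
  show "dyadic (-17768, 16) = -2221 / 8192" by (simp add: dyadic_def)
qed

lemma L11n358_11_value:
  assumes "is_invariant_F F"
  shows "has_values (F_set F [1, 1, 1] L11n358_11) (-7928)"
proof (rule F_set_eval[OF assms])
  let ?cs = "[Xp e7 e2 e6 e1, Xp e11 e4 e10 e3, Xp e2 e5 e3 e6, Xm e8 e17 e7 e16, Xp e4 e9 e1 e10,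
    Xp e12 e18 e11 e19, Xp e14 e20 e13 e21, Xm e16 e9 e15 e8, Xp e18 e22 e17 e15, Xp e20
    e14 e19 e5, Xp e22 e12 e21 e13]"
  let ?p = "(0, [(e5, 1), (e15, 2)])"
  show "L11n358_11 = dg ?cs []" by (simp add: L11n358_11_def pd_link_def dg_def)
  \<comment> \<open>The second component is lifted above the third by three changes. The first
    component meets only the second one, so that separating colours \<open>0\<close> and
    \<open>1\<close> completes the three-coloured branch.\<close>
  show "valid ?cs [] ?p \<and> components_coloured ?cs ?p \<and>
    eval (Separate 1 2 [e8, e12, e14] (Move (R2 e21 e22) (Move (R2 e16 e17) (Move (R2 e22 e19)
    (Move (R1 e22) (Separate 0 1 [e2, e4] (Move (R2 e9 e6) (Move (R2 e9 e10) Unlink)) (Skein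
    e9 (Move (R2 e1 e2) (Skein e9 (Move (R2 e1 e4) Unlink) (Move (R1 e9) Unlink))) (Skein e5
    (Move (R2 e3 e4) (Move (R1 e5) Unlink)) (Skein e9 (Move (R2 e1 e5) Unlink) (Move (R1 e9)
    Unlink)))) (Move (R2 e9 e6) (Move (R2 e9 e10) Unlink))))))) (Separate 0 1 [e2, e4] (Move
    (R2 e7 e6) (Move (R2 e11 e10) (Skein e8 (Move (R2 e16 e17) (Move (R1 e18) (Skein e12 (Move
    (R2 e19 e20) (Skein e12 (Move (R2 e21 e20) Unlink) (Move (R1 e12) Unlink))) (Move (R1 e20)
    (Move (R1 e20) (Move (R1 e12) Unlink)))))) (Move (R1 e8) (Skein e14 (Move (R2 e21 e22)
    (Skein e14 (Move (R2 e19 e18) (Move (R1 e14) Unlink)) (Skein e14 (Move (R2 e19 e22)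
    Unlink) (Move (R1 e14) Unlink)))) (Move (R1 e14) (Move (R1 e22) (Skein e22 (Move (R2 e17
    e18) Unlink) (Move (R1 e22) Unlink))))))))) (Skein e14 (Move (R2 e21 e22) (Skein e14 (Move
    (R2 e22 e19) (Move (R1 e22) (Skein e8 (Move (R2 e16 e15) (Skein e9 (Move (R2 e1 e2) (Skein
    e9 (Move (R2 e1 e4) Unlink) (Move (R1 e9) Unlink))) (Skein e5 (Move (R2 e3 e4) (Move (R1
    e5) Unlink)) (Skein e9 (Move (R2 e1 e5) Unlink) (Move (R1 e9) Unlink))))) (Move (R1 e8)
    (Skein e9 (Move (R2 e1 e2) (Skein e9 (Move (R2 e1 e4) Unlink) (Move (R1 e9) Unlink)))
    (Skein e5 (Move (R2 e3 e4) (Move (R1 e5) Unlink)) (Skein e9 (Move (R2 e1 e5) Unlink) (Move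
    (R1 e9) Unlink)))))))) (Skein e8 (Move (R2 e16 e17) (Move (R1 e14) (Move (R1 e14) (Skein
    e9 (Move (R2 e1 e2) (Skein e9 (Move (R2 e1 e4) Unlink) (Move (R1 e9) Unlink))) (Skein e5
    (Move (R2 e3 e4) (Move (R1 e5) Unlink)) (Skein e9 (Move (R2 e1 e5) Unlink) (Move (R1 e9)
    Unlink))))))) (Move (R1 e8) (Skein e14 (Move (R2 e22 e9) (Skein e5 (Move (R2 e1 e2) (Skein
    e9 (Move (R2 e1 e4) Unlink) (Move (R1 e9) Unlink))) (Move (R1 e5) (Skein e9 (Move (R2 e1
    e4) Unlink) (Move (R1 e9) Unlink))))) (Move (R1 e14) (Skein e9 (Move (R2 e1 e2) (Skein e9
    (Move (R2 e1 e4) Unlink) (Move (R1 e9) Unlink))) (Skein e5 (Move (R2 e3 e4) (Move (R1 e5)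
    Unlink)) (Skein e9 (Move (R2 e1 e5) Unlink) (Move (R1 e9) Unlink)))))))))) (Move (R1 e14)
    (Move (R1 e22) (Skein e8 (Move (R2 e16 e17) (Move (R1 e18) (Move (R1 e18) (Skein e9 (Move
    (R2 e1 e2) (Skein e9 (Move (R2 e1 e4) Unlink) (Move (R1 e9) Unlink))) (Skein e5 (Move (R2
    e3 e4) (Move (R1 e5) Unlink)) (Skein e9 (Move (R2 e1 e5) Unlink) (Move (R1 e9)
    Unlink))))))) (Move (R1 e8) (Skein e22 (Move (R2 e18 e5) (Skein e5 (Move (R2 e1 e2) (Skein
    e9 (Move (R2 e1 e4) Unlink) (Move (R1 e9) Unlink))) (Move (R1 e5) (Skein e9 (Move (R2 e1
    e4) Unlink) (Move (R1 e9) Unlink))))) (Move (R1 e22) (Skein e9 (Move (R2 e1 e2) (Skein e9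
    (Move (R2 e1 e4) Unlink) (Move (R1 e9) Unlink))) (Skein e5 (Move (R2 e3 e4) (Move (R1 e5)
    Unlink)) (Skein e9 (Move (R2 e1 e5) Unlink) (Move (R1 e9) Unlink))))))))))) (Move (R2 e7
    e6) (Move (R2 e11 e10) (Skein e12 (Move (R3 e16 e19 e18) (Move (R2 e22 e15) (Move (R3 e8
    e19 e18) (Move (R2 e13 e14) (Move (R2 e19 e16) (Move (R1 e16) Unlink)))))) (Skein e8 (Move
    (R2 e16 e17) (Move (R1 e12) (Move (R1 e20) (Move (R1 e20) (Move (R1 e12) Unlink))))) (Move
    (R1 e8) (Skein e14 (Move (R2 e21 e22) (Skein e14 (Move (R2 e19 e22) Unlink) (Move (R1 e14)
    Unlink))) (Move (R1 e14) (Move (R1 e12) (Move (R1 e12) Unlink)))))))))) (Move (R2 e21 e22)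
    (Move (R2 e16 e17) (Move (R2 e22 e19) (Move (R1 e22) (Separate 0 1 [e2, e4] (Move (R2 e9
    e6) (Move (R2 e9 e10) Unlink)) (Skein e9 (Move (R2 e1 e2) (Skein e9 (Move (R2 e1 e4)
    Unlink) (Move (R1 e9) Unlink))) (Skein e5 (Move (R2 e3 e4) (Move (R1 e5) Unlink)) (Skein
    e9 (Move (R2 e1 e5) Unlink) (Move (R1 e9) Unlink)))) (Move (R2 e9 e6) (Move (R2 e9 e10)
    Unlink))))))))
      ?cs [] ?p = Some (-253696, 5)"
    by code_simp
  show "dyadic (-253696, 5) = -7928" by (simp add: dyadic_def)
qed

lemma L11n418_10_value:
  assumes "is_invariant_F F"
  shows "has_values (F_set F [1, 1, 1] L11n418_10) (-10358)"
proof (rule F_set_eval[OF assms])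
  let ?cs = "[Xp e9 e2 e8 e1, Xp e3 e10 e4 e11, Xm e5 e14 e6 e15, Xp e8 e17 e7 e16, Xp e18 e9 e19
    e10, Xp e12 e21 e11 e20, Xm e13 e6 e14 e1, Xp e15 e13 e16 e22, Xp e2 e18 e3 e17, Xp
    e19 e5 e20 e4, Xp e21 e12 e22 e7]"
  let ?p = "(0, [(e7, 1), (e13, 2)])"
  show "L11n418_10 = dg ?cs []" by (simp add: L11n418_10_def pd_link_def dg_def)
  \<comment> \<open>The changes at \<open>e5\<close> and \<open>e2\<close> put the first component
    above the third, followed by the separation of colours \<open>1, 2\<close> and
    \<open>0, 1\<close>.\<close>
  show "valid ?cs [] ?p \<and> components_coloured ?cs ?p \<and>
    eval (Separate 0 2 [e5, e2] (Move (R2 e14 e13) (Move (R1 e13) (Move (R3 e9 e17 e18) (Move (R2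
    e19 e18) (Separate 1 2 [e8, e12] (Move (R2 e22 e21) (Move (R2 e21 e18) (Separate 0 1 [e3]
    (Move (R2 e10 e9) Unlink) (Skein e10 (Move (R2 e4 e3) Unlink) (Move (R1 e10) Unlink))
    (Move (R2 e10 e9) Unlink)))) (Separate 0 1 [e3] (Move (R2 e10 e11) (Skein e8 (Move (R2 e22
    e21) (Skein e21 (Move (R2 e11 e8) Unlink) (Move (R1 e21) Unlink))) (Move (R1 e8) (Move (R1
    e12) (Move (R1 e12) Unlink))))) (Skein e8 (Move (R2 e22 e21) (Skein e10 (Move (R2 e3 e4)
    (Skein e21 (Move (R2 e11 e8) Unlink) (Move (R1 e21) Unlink))) (Move (R1 e10) (Skein e21
    (Move (R2 e11 e8) Unlink) (Move (R1 e21) Unlink))))) (Move (R1 e8) (Move (R1 e21) (Move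
    (R1 e21) (Skein e10 (Move (R2 e4 e3) Unlink) (Move (R1 e10) Unlink)))))) (Move (R2 e10
    e11) (Skein e8 (Move (R2 e22 e21) (Skein e21 (Move (R2 e11 e8) Unlink) (Move (R1 e21)
    Unlink))) (Move (R1 e8) (Move (R1 e12) (Move (R1 e12) Unlink)))))) (Move (R2 e22 e21)
    (Move (R2 e21 e18) (Separate 0 1 [e3] (Move (R2 e10 e9) Unlink) (Skein e10 (Move (R2 e4
    e3) Unlink) (Move (R1 e10) Unlink)) (Move (R2 e10 e9) Unlink))))))))) (Separate 0 1 [e3,
    e18, e21] (Move (R2 e12 e7) (Move (R3 e2 e8 e9) (Move (R2 e8 e7) (Move (R2 e9 e8) (Skein
    e5 (Move (R2 e14 e13) (Move (R1 e13) (Skein e5 (Move (R2 e20 e17) Unlink) (Move (R1 e5)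
    Unlink)))) (Move (R1 e13) (Skein e5 (Move (R2 e20 e13) (Move (R1 e5) Unlink)) (Skein e5
    (Move (R2 e20 e17) Unlink) (Move (R1 e5) Unlink))))))))) (Skein e8 (Move (R3 e18 e3 e2)
    (Move (R3 e21 e16 e15) (Move (R3 e12 e16 e15) (Move (R2 e16 e17) (Skein e7 (Move (R2 e22
    e21) (Skein e5 (Move (R2 e14 e21) (Move (R1 e21) (Skein e9 (Move (R2 e5 e2) (Skein e5
    (Move (R2 e20 e19) Unlink) (Move (R1 e5) Unlink))) (Move (R1 e9) (Skein e5 (Move (R2 e20
    e19) Unlink) (Move (R1 e5) Unlink)))))) (Move (R1 e21) (Skein e9 (Move (R2 e21 e2) (Skein
    e5 (Move (R2 e20 e21) (Move (R1 e5) Unlink)) (Skein e5 (Move (R2 e20 e19) Unlink) (Move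
    (R1 e5) Unlink)))) (Move (R1 e9) (Skein e5 (Move (R2 e20 e21) (Move (R1 e5) Unlink))
    (Skein e5 (Move (R2 e20 e19) Unlink) (Move (R1 e5) Unlink)))))))) (Move (R1 e7) (Move (R2
    e8 e9) (Move (R2 e6 e5) (Move (R1 e21) (Skein e5 (Move (R2 e20 e19) Unlink) (Move (R1 e5)
    Unlink))))))))))) (Move (R3 e18 e3 e2) (Move (R3 e2 e8 e9) (Move (R1 e9) (Skein e5 (Move
    (R2 e14 e13) (Move (R1 e13) (Move (R1 e21) (Move (R1 e21) (Skein e10 (Move (R2 e2 e3)
    (Skein e5 (Move (R2 e20 e10) Unlink) (Move (R1 e5) Unlink))) (Skein e5 (Move (R2 e20 e10)
    (Move (R1 e5) Unlink)) (Skein e5 (Move (R2 e20 e19) Unlink) (Move (R1 e5) Unlink))))))))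
    (Move (R1 e13) (Skein e12 (Move (R2 e21 e20) (Skein e10 (Move (R2 e2 e3) (Skein e13 (Move
    (R2 e16 e10) (Move (R1 e13) Unlink)) (Skein e5 (Move (R2 e20 e13) Unlink) (Move (R1 e5)
    Unlink)))) (Skein e13 (Move (R2 e16 e10) (Skein e5 (Move (R2 e20 e13) Unlink) (Move (R1
    e5) Unlink))) (Skein e5 (Move (R2 e20 e13) (Move (R1 e5) Unlink)) (Skein e5 (Move (R2 e20
    e19) Unlink) (Move (R1 e5) Unlink)))))) (Move (R1 e12) (Move (R1 e5) (Skein e10 (Move (R2
    e2 e3) (Skein e5 (Move (R2 e20 e10) Unlink) (Move (R1 e5) Unlink))) (Skein e5 (Move (R2
    e20 e10) (Move (R1 e5) Unlink)) (Skein e5 (Move (R2 e20 e19) Unlink) (Move (R1 e5)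
    Unlink))))))))))))) (Move (R2 e12 e7) (Move (R3 e2 e8 e9) (Move (R2 e8 e7) (Move (R2 e9
    e8) (Skein e5 (Move (R2 e14 e13) (Move (R1 e13) (Skein e5 (Move (R2 e20 e17) Unlink) (Move
    (R1 e5) Unlink)))) (Move (R1 e13) (Skein e5 (Move (R2 e20 e13) (Move (R1 e5) Unlink))
    (Skein e5 (Move (R2 e20 e17) Unlink) (Move (R1 e5) Unlink)))))))))) (Move (R2 e14 e13)
    (Move (R1 e13) (Move (R3 e9 e17 e18) (Move (R2 e19 e18) (Separate 0 1 [e3, e17, e21] (Move
    (R2 e10 e11) (Move (R2 e8 e11) (Move (R2 e12 e11) Unlink))) (Skein e8 (Move (R2 e22 e21)
    (Skein e10 (Move (R2 e3 e4) (Skein e21 (Move (R2 e11 e8) Unlink) (Move (R1 e21) Unlink)))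
    (Move (R1 e10) (Skein e21 (Move (R2 e11 e8) Unlink) (Move (R1 e21) Unlink))))) (Move (R1
    e8) (Move (R1 e21) (Move (R1 e21) (Skein e10 (Move (R2 e4 e3) Unlink) (Move (R1 e10)
    Unlink)))))) (Move (R2 e10 e11) (Move (R2 e8 e11) (Move (R2 e12 e11) Unlink)))))))))
      ?cs [] ?p = Some (-331456, 5)"
    by code_simp
  show "dyadic (-331456, 5) = -10358" by (simp add: dyadic_def)
qed

theorem proposition2:
  fixes F :: "colored_diagram \<Rightarrow> Qxtw"
  assumes "is_invariant_F F"
  shows
    "F_set F [1, 1, 1] L11n325_11 \<noteq> F_set F [1, 1, 1] L11n424_00 \<and>
     F_set F [1, 1, 1] L11n356_10 \<noteq> F_set F [1, 1, 1] L11n434_00 \<and>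
     F_set F [1, 1, 1] L10n79_11 \<noteq> F_set F [1, 1, 1] L10n95_10 \<and>
     F_set F [1, 1, 1] L11a404_11 \<noteq> F_set F [1, 1, 1] L11a428_01 \<and>
     F_set F [1, 1, 1] L10n76_11 \<noteq> F_set F [1, 1, 1] L11n425_10 \<and>
     F_set F [1, 1, 1] L11n358_11 \<noteq> F_set F [1, 1, 1] L11n418_10"
proof (intro conjI)
  show "F_set F [1, 1, 1] L11n325_11 \<noteq> F_set F [1, 1, 1] L11n424_00"
    by (rule has_values_neq[OF L11n325_11_value[OF assms] L11n424_00_value[OF assms]]) simp
  show "F_set F [1, 1, 1] L11n356_10 \<noteq> F_set F [1, 1, 1] L11n434_00"
    by (rule has_values_neq[OF L11n356_10_value[OF assms] L11n434_00_value[OF assms]]) simp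
  show "F_set F [1, 1, 1] L10n79_11 \<noteq> F_set F [1, 1, 1] L10n95_10"
    by (rule has_values_neq[OF L10n79_11_value[OF assms] L10n95_10_value[OF assms]]) simp
  show "F_set F [1, 1, 1] L11a404_11 \<noteq> F_set F [1, 1, 1] L11a428_01"
    by (rule has_values_neq[OF L11a404_11_value[OF assms] L11a428_01_value[OF assms]]) simp
  show "F_set F [1, 1, 1] L10n76_11 \<noteq> F_set F [1, 1, 1] L11n425_10"
    by (rule has_values_neq[OF L10n76_11_value[OF assms] L11n425_10_value[OF assms]]) simp
  show "F_set F [1, 1, 1] L11n358_11 \<noteq> F_set F [1, 1, 1] L11n418_10"
    by (rule has_values_neq[OF L11n358_11_value[OF assms] L11n418_10_value[OF assms]]) simp
qed

end
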